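(* Let $\mathcal{A}$ be a $C^*$-algebra. For a closed (two-sided) ideal $\mathcal{I}$ of $\mathcal{A}$ let $\hat{\mathcal{A}}^{\mathcal{I}}=\{[\pi]\in\hat{\mathcal{A}}:\pi(\mathcal{I})\neq0\}$. Then: (a) The correspondence $\mathcal{I}\mapsto(\mathcal{P}(\mathcal{A}),p_{\mathcal{A}},\hat{\mathcal{A}})_{\hat{\mathcal{A}}^{\mathcal{I}}}$ is a bijection from the set of closed ideals of $\mathcal{A}$ onto $Bun_o(\mathcal{A})$, and $\mathcal{I}=\ker\bigoplus_{[\pi]\in\hat{\mathcal{A}}\setminus\hat{\mathcal{A}}^{\mathcal{I}}}\pi$ for every closed ideal $\mathcal{I}$. (b) The correspondence $\mathcal{A}/\mathcal{I}\mapsto(\mathcal{P}(\mathcal{A}),p_{\mathcal{A}},\hat{\mathcal{A}})_{\hat{\mathcal{A}}\setminus\hat{\mathcal{A}}^{\mathcal{I}}}$ is a bijection from the set of quotient $C^*$-algebras of $\mathcal{A}$ (by closed ideals $\mathcal{I}$) onto $Bun_c(\mathcal{A})$.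
   Context: For a $C^*$-algebra $\mathcal{A}$, $\mathcal{P}(\mathcal{A})$ is the set of pure states with the $w^*$-topology; $\hat{\mathcal{A}}$ is the spectrum (unitary equivalence classes $[\pi]$ of nonzero irreducible representations) with the Jacobson topology; $p_{\mathcal{A}}:\mathcal{P}(\mathcal{A})\to\hat{\mathcal{A}}$ sends a pure state to the class of its GNS representation. Each fiber $p_{\mathcal{A}}^{-1}([\pi])$ is a Kähler manifold, identified with the projective space of the Hilbert space $\mathcal{H}_\pi$ of $\pi$ (a pure state $\omega(a)=\langle x|\pi(a)x\rangle$, $\|x\|=1$, corresponds to $[x]$), and $(\mathcal{P}(\mathcal{A}),p_{\mathcal{A}},\hat{\mathcal{A}})$ is called the uniform Kähler bundle of $\mathcal{A}$. For a bundle $(\mathcal{E},p,\mathcal{X})$ and $\mathcal{U}\subseteq\mathcal{X}$, the restriction $(\mathcal{E},p,\mathcal{X})_{\mathcal{U}}$ is the bundle $(p^{-1}(\mathcal{U}),p|_{p^{-1}(\mathcal{U})},\mathcal{U})$. $Bun_o(\mathcal{A}):=\{(\mathcal{P}(\mathcal{A}),p_{\mathcal{A}},\hat{\mathcal{A}})_{\mathcal{U}} : \mathcal{U}\subseteq\hat{\mathcal{A}}\text{ open}\}$ and $Bun_c(\mathcal{A}):=\{(\mathcal{P}(\mathcal{A}),p_{\mathcal{A}},\hat{\mathcal{A}})_{\mathcal{V}} : \mathcal{V}\subseteq\hat{\mathcal{A}}\text{ closed}\}$. *)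

theory Defs
  imports "HOL-Analysis.Analysis"
begin

section \<open>C*-algebras, closed ideals and quotients\<close>

text \<open>No unit is assumed, and the zero algebra is allowed.  Submultiplicativity of the norm is
  part of \<^class>\<open>real_normed_algebra\<close>.\<close>

class cstar_algebra = real_normed_algebra + banach +
  fixes scaleC :: "complex \<Rightarrow> 'a \<Rightarrow> 'a" (infixr "*\<^sub>C" 75)
    and star :: "'a \<Rightarrow> 'a"
  assumes scaleC_add_right: "c *\<^sub>C (x + y) = c *\<^sub>C x + c *\<^sub>C y"
    and scaleC_add_left: "(c + d) *\<^sub>C x = c *\<^sub>C x + d *\<^sub>C x"
    and scaleC_scaleC: "c *\<^sub>C (d *\<^sub>C x) = (c * d) *\<^sub>C x"
    and scaleC_of_real: "complex_of_real r *\<^sub>C x = r *\<^sub>R x"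
    and mult_scaleC_left: "(c *\<^sub>C x) * y = c *\<^sub>C (x * y)"
    and mult_scaleC_right: "x * (c *\<^sub>C y) = c *\<^sub>C (x * y)"
    and norm_scaleC: "norm (c *\<^sub>C x) = cmod c * norm x"
    and star_star: "star (star x) = x"
    and star_add: "star (x + y) = star x + star y"
    and star_scaleC: "star (c *\<^sub>C x) = cnj c *\<^sub>C star x"
    and star_mult: "star (x * y) = star y * star x"
    and cstar_identity: "norm (star x * x) = (norm x)\<^sup>2"

definition closed_ideal :: "'a::cstar_algebra set \<Rightarrow> bool" where
  "closed_ideal I \<longleftrightarrow> closed I \<and> 0 \<in> I \<and> (\<forall>x\<in>I. \<forall>y\<in>I. x + y \<in> I) \<and>
     (\<forall>c. \<forall>x\<in>I. c *\<^sub>C x \<in> I) \<and> (\<forall>a. \<forall>x\<in>I. a * x \<in> I \<and> x * a \<in> I)"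

text \<open>A quotient of the algebra is not a type, so quotients are recorded as explicit structures
  on the set of cosets, with the quotient norm.  Each operation is the union of the cosets of all
  results on representatives, which is a single coset when \<open>I\<close> is a closed ideal.\<close>

record 'b cstar_structure =
  cs_carrier :: "'b set"
  cs_zero :: 'b
  cs_add :: "'b \<Rightarrow> 'b \<Rightarrow> 'b"
  cs_mult :: "'b \<Rightarrow> 'b \<Rightarrow> 'b"
  cs_scale :: "complex \<Rightarrow> 'b \<Rightarrow> 'b"
  cs_star :: "'b \<Rightarrow> 'b"
  cs_norm :: "'b \<Rightarrow> real"

definition ideal_coset :: "'a::cstar_algebra set \<Rightarrow> 'a \<Rightarrow> 'a set" where
  "ideal_coset I a = {a + i | i. i \<in> I}"

definition quotient_cstar :: "'a::cstar_algebra set \<Rightarrow> 'a set cstar_structure" where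
  "quotient_cstar I =
    \<lparr> cs_carrier = range (ideal_coset I),
      cs_zero = ideal_coset I 0,
      cs_add = (\<lambda>X Y. \<Union>x\<in>X. \<Union>y\<in>Y. ideal_coset I (x + y)),
      cs_mult = (\<lambda>X Y. \<Union>x\<in>X. \<Union>y\<in>Y. ideal_coset I (x * y)),
      cs_scale = (\<lambda>c X. \<Union>x\<in>X. ideal_coset I (c *\<^sub>C x)),
      cs_star = (\<lambda>X. \<Union>x\<in>X. ideal_coset I (star x)),
      cs_norm = (\<lambda>X. INF x\<in>X. norm x) \<rparr>"

definition quotient_cstar_algebras :: "'a::cstar_algebra set cstar_structure set" where
  "quotient_cstar_algebras = {quotient_cstar I | I. closed_ideal I}"


section \<open>Hilbert spaces\<close>

record 'h hilbert =
  hcarrier :: "'h set"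
  hzero :: 'h
  hadd :: "'h \<Rightarrow> 'h \<Rightarrow> 'h"
  hscale :: "complex \<Rightarrow> 'h \<Rightarrow> 'h"
  hinner :: "'h \<Rightarrow> 'h \<Rightarrow> complex"

definition hdiff :: "'h hilbert \<Rightarrow> 'h \<Rightarrow> 'h \<Rightarrow> 'h" where
  "hdiff H x y = hadd H x (hscale H (-1) y)"

definition hnorm :: "'h hilbert \<Rightarrow> 'h \<Rightarrow> real" where
  "hnorm H x = sqrt (Re (hinner H x x))"

text \<open>Inner products are linear in the second argument.\<close>

locale hilbert_space =
  fixes H :: "'h hilbert"
  assumes zero_closed: "hzero H \<in> hcarrier H"
    and add_closed: "\<lbrakk>x \<in> hcarrier H; y \<in> hcarrier H\<rbrakk> \<Longrightarrow> hadd H x y \<in> hcarrier H"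
    and scale_closed: "x \<in> hcarrier H \<Longrightarrow> hscale H c x \<in> hcarrier H"
    and add_assoc: "\<lbrakk>x \<in> hcarrier H; y \<in> hcarrier H; z \<in> hcarrier H\<rbrakk> \<Longrightarrow>
          hadd H (hadd H x y) z = hadd H x (hadd H y z)"
    and add_commute: "\<lbrakk>x \<in> hcarrier H; y \<in> hcarrier H\<rbrakk> \<Longrightarrow> hadd H x y = hadd H y x"
    and add_zero: "x \<in> hcarrier H \<Longrightarrow> hadd H x (hzero H) = x"
    and diff_self: "x \<in> hcarrier H \<Longrightarrow> hdiff H x x = hzero H"
    and scale_add_right: "\<lbrakk>x \<in> hcarrier H; y \<in> hcarrier H\<rbrakk> \<Longrightarrow>
          hscale H c (hadd H x y) = hadd H (hscale H c x) (hscale H c y)"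
    and scale_add_left: "x \<in> hcarrier H \<Longrightarrow>
          hscale H (c + d) x = hadd H (hscale H c x) (hscale H d x)"
    and scale_scale: "x \<in> hcarrier H \<Longrightarrow> hscale H c (hscale H d x) = hscale H (c * d) x"
    and scale_one: "x \<in> hcarrier H \<Longrightarrow> hscale H 1 x = x"
    and inner_add_right: "\<lbrakk>x \<in> hcarrier H; y \<in> hcarrier H; z \<in> hcarrier H\<rbrakk> \<Longrightarrow>
          hinner H x (hadd H y z) = hinner H x y + hinner H x z"
    and inner_scale_right: "\<lbrakk>x \<in> hcarrier H; y \<in> hcarrier H\<rbrakk> \<Longrightarrow>
          hinner H x (hscale H c y) = c * hinner H x y"
    and inner_commute: "\<lbrakk>x \<in> hcarrier H; y \<in> hcarrier H\<rbrakk> \<Longrightarrow>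
          hinner H y x = cnj (hinner H x y)"
    and inner_nonneg: "x \<in> hcarrier H \<Longrightarrow> hinner H x x \<in> \<real>\<^sub>\<ge>\<^sub>0"
    and inner_definite: "\<lbrakk>x \<in> hcarrier H; hinner H x x = 0\<rbrakk> \<Longrightarrow> x = hzero H"
    and complete: "\<lbrakk>\<And>n::nat. s n \<in> hcarrier H;
          \<forall>e>0. \<exists>N. \<forall>m\<ge>N. \<forall>n\<ge>N. hnorm H (hdiff H (s m) (s n)) < e\<rbrakk> \<Longrightarrow>
          \<exists>x\<in>hcarrier H. (\<lambda>n. hnorm H (hdiff H (s n) x)) \<longlonglongrightarrow> 0"

definition closed_hsubspace :: "'h hilbert \<Rightarrow> 'h set \<Rightarrow> bool" where
  "closed_hsubspace H K \<longleftrightarrow> K \<subseteq> hcarrier H \<and> hzero H \<in> K \<and>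
     (\<forall>x\<in>K. \<forall>y\<in>K. hadd H x y \<in> K) \<and> (\<forall>c. \<forall>x\<in>K. hscale H c x \<in> K) \<and>
     (\<forall>s. \<forall>x\<in>hcarrier H. (\<forall>n::nat. s n \<in> K) \<longrightarrow>
        (\<lambda>n. hnorm H (hdiff H (s n) x)) \<longlonglongrightarrow> 0 \<longrightarrow> x \<in> K)"

definition hilbert_sum :: "'i set \<Rightarrow> ('i \<Rightarrow> 'h hilbert) \<Rightarrow> ('i \<Rightarrow> 'h) hilbert" where
  "hilbert_sum S H =
    \<lparr> hcarrier = {f \<in> \<Pi>\<^sub>E i\<in>S. hcarrier (H i). (\<lambda>i. (hnorm (H i) (f i))\<^sup>2) summable_on S},
      hzero = (\<lambda>i\<in>S. hzero (H i)),
      hadd = (\<lambda>f g. \<lambda>i\<in>S. hadd (H i) (f i) (g i)),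
      hscale = (\<lambda>c f. \<lambda>i\<in>S. hscale (H i) c (f i)),
      hinner = (\<lambda>f g. infsum (\<lambda>i. hinner (H i) (f i) (g i)) S) \<rparr>"


section \<open>Representations\<close>

record ('a, 'h) rep =
  rep_space :: "'h hilbert"
  rep_act :: "'a \<Rightarrow> 'h \<Rightarrow> 'h"

locale star_representation = hilbert_space "rep_space \<pi>"
  for \<pi> :: "('a::cstar_algebra, 'h) rep" +
  assumes act_closed: "x \<in> hcarrier (rep_space \<pi>) \<Longrightarrow> rep_act \<pi> a x \<in> hcarrier (rep_space \<pi>)"
    and act_add: "\<lbrakk>x \<in> hcarrier (rep_space \<pi>); y \<in> hcarrier (rep_space \<pi>)\<rbrakk> \<Longrightarrow>
          rep_act \<pi> a (hadd (rep_space \<pi>) x y) = hadd (rep_space \<pi>) (rep_act \<pi> a x) (rep_act \<pi> a y)"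
    and act_scale: "x \<in> hcarrier (rep_space \<pi>) \<Longrightarrow>
          rep_act \<pi> a (hscale (rep_space \<pi>) c x) = hscale (rep_space \<pi>) c (rep_act \<pi> a x)"
    and act_bounded: "\<exists>K. \<forall>x\<in>hcarrier (rep_space \<pi>).
          hnorm (rep_space \<pi>) (rep_act \<pi> a x) \<le> K * hnorm (rep_space \<pi>) x"
    and rep_add: "x \<in> hcarrier (rep_space \<pi>) \<Longrightarrow>
          rep_act \<pi> (a + b) x = hadd (rep_space \<pi>) (rep_act \<pi> a x) (rep_act \<pi> b x)"
    and rep_scaleC: "x \<in> hcarrier (rep_space \<pi>) \<Longrightarrow>
          rep_act \<pi> (c *\<^sub>C a) x = hscale (rep_space \<pi>) c (rep_act \<pi> a x)"
    and rep_mult: "x \<in> hcarrier (rep_space \<pi>) \<Longrightarrow>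
          rep_act \<pi> (a * b) x = rep_act \<pi> a (rep_act \<pi> b x)"
    and rep_star: "\<lbrakk>x \<in> hcarrier (rep_space \<pi>); y \<in> hcarrier (rep_space \<pi>)\<rbrakk> \<Longrightarrow>
          hinner (rep_space \<pi>) (rep_act \<pi> (star a) x) y = hinner (rep_space \<pi>) x (rep_act \<pi> a y)"

definition rep_ker :: "('a, 'h) rep \<Rightarrow> 'a set" where
  "rep_ker \<pi> = {a. \<forall>x\<in>hcarrier (rep_space \<pi>). rep_act \<pi> a x = hzero (rep_space \<pi>)}"

definition rep_nonzero_on :: "('a, 'h) rep \<Rightarrow> 'a set \<Rightarrow> bool" where
  "rep_nonzero_on \<pi> J \<longleftrightarrow>
     (\<exists>a\<in>J. \<exists>x\<in>hcarrier (rep_space \<pi>). rep_act \<pi> a x \<noteq> hzero (rep_space \<pi>))"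

definition irreducible_rep :: "('a::cstar_algebra, 'h) rep \<Rightarrow> bool" where
  "irreducible_rep \<pi> \<longleftrightarrow> star_representation \<pi> \<and> rep_nonzero_on \<pi> UNIV \<and>
     (\<forall>K. closed_hsubspace (rep_space \<pi>) K \<and> (\<forall>a. \<forall>x\<in>K. rep_act \<pi> a x \<in> K) \<longrightarrow>
        K = {hzero (rep_space \<pi>)} \<or> K = hcarrier (rep_space \<pi>))"

definition unitarily_equivalent :: "('a, 'h) rep \<Rightarrow> ('a, 'k) rep \<Rightarrow> bool" where
  "unitarily_equivalent \<pi> \<rho> \<longleftrightarrow>
     (\<exists>U. bij_betw U (hcarrier (rep_space \<pi>)) (hcarrier (rep_space \<rho>)) \<and>
        (\<forall>x\<in>hcarrier (rep_space \<pi>). \<forall>y\<in>hcarrier (rep_space \<pi>).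
           U (hadd (rep_space \<pi>) x y) = hadd (rep_space \<rho>) (U x) (U y) \<and>
           hinner (rep_space \<rho>) (U x) (U y) = hinner (rep_space \<pi>) x y) \<and>
        (\<forall>c. \<forall>x\<in>hcarrier (rep_space \<pi>).
           U (hscale (rep_space \<pi>) c x) = hscale (rep_space \<rho>) c (U x)) \<and>
        (\<forall>a. \<forall>x\<in>hcarrier (rep_space \<pi>). U (rep_act \<pi> a x) = rep_act \<rho> a (U x)))"

definition rep_sum :: "'i set \<Rightarrow> ('i \<Rightarrow> ('a, 'h) rep) \<Rightarrow> ('a, 'i \<Rightarrow> 'h) rep" where
  "rep_sum S \<pi> =
    \<lparr> rep_space = hilbert_sum S (\<lambda>i. rep_space (\<pi> i)),
      rep_act = (\<lambda>a f. \<lambda>i\<in>S. rep_act (\<pi> i) a (f i)) \<rparr>"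


section \<open>The spectrum and its Jacobson topology\<close>

text \<open>The vectors of a GNS space are sets of sequences in the algebra.  Every irreducible
  representation, on whatever Hilbert space, is unitarily equivalent to the GNS representation of
  any of its vector states, so restricting to Hilbert spaces carried by subsets of this type
  loses no equivalence class.\<close>

type_synonym 'a gns_vector = "(nat \<Rightarrow> 'a) set"
type_synonym 'a rep_class = "('a, 'a gns_vector) rep set"

definition irreps :: "('a::cstar_algebra, 'a gns_vector) rep set" where
  "irreps = {\<pi>. irreducible_rep \<pi>}"

definition unitary_equivalence ::
    "(('a::cstar_algebra, 'a gns_vector) rep \<times> ('a, 'a gns_vector) rep) set" where
  "unitary_equivalence = {(\<pi>, \<rho>). \<pi> \<in> irreps \<and> \<rho> \<in> irreps \<and> unitarily_equivalent \<pi> \<rho>}"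

definition spectrum :: "'a::cstar_algebra rep_class set" where
  "spectrum = irreps // unitary_equivalence"

text \<open>Unitarily equivalent representations have the same kernel, so for \<open>c = [\<pi>]\<close> the following
  intersection is just \<open>ker \<pi>\<close>.\<close>

definition class_ker :: "'a rep_class \<Rightarrow> 'a set" where
  "class_ker c = (\<Inter>\<pi>\<in>c. rep_ker \<pi>)"

definition primitive_ideals :: "'a::cstar_algebra set set" where
  "primitive_ideals = rep_ker ` irreps"

text \<open>A set \<open>F\<close> of primitive ideals is closed iff it contains every primitive ideal that
  contains \<open>\<Inter>F\<close>; the topology of the spectrum is the inverse image under \<open>[\<pi>] \<mapsto> ker \<pi>\<close>.\<close>

definition hull_kernel_topology :: "'a::cstar_algebra set topology" where
  "hull_kernel_topology =
     topology (\<lambda>U. U \<subseteq> primitive_ideals \<and>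
       {P \<in> primitive_ideals. \<Inter>(primitive_ideals - U) \<subseteq> P} = primitive_ideals - U)"

definition jacobson_topology :: "'a::cstar_algebra rep_class topology" where
  "jacobson_topology = pullback_topology spectrum class_ker hull_kernel_topology"

definition spectrum_of_ideal :: "'a::cstar_algebra set \<Rightarrow> 'a rep_class set" where
  "spectrum_of_ideal I = {c \<in> spectrum. \<exists>\<pi>\<in>c. rep_nonzero_on \<pi> I}"


section \<open>Pure states and the GNS construction\<close>

definition state :: "('a::cstar_algebra \<Rightarrow> complex) \<Rightarrow> bool" where
  "state \<omega> \<longleftrightarrow> bounded_linear \<omega> \<and> (\<forall>c a. \<omega> (c *\<^sub>C a) = c * \<omega> a) \<and>
     (\<forall>a. \<omega> (star a * a) \<in> \<real>\<^sub>\<ge>\<^sub>0) \<and> onorm \<omega> = 1"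

definition pure_states :: "('a::cstar_algebra \<Rightarrow> complex) set" where
  "pure_states = {\<omega>. state \<omega> \<and>
     (\<forall>\<phi> \<psi> t. state \<phi> \<and> state \<psi> \<and> 0 < t \<and> t < 1 \<and>
        \<omega> = (\<lambda>a. complex_of_real t * \<phi> a + complex_of_real (1 - t) * \<psi> a) \<longrightarrow>
        \<phi> = \<omega> \<and> \<psi> = \<omega>)}"

text \<open>The GNS space of \<open>\<omega>\<close> is the completion of the algebra for the seminorm
  \<open>a \<mapsto> sqrt (\<omega> (star a * a))\<close>: Cauchy sequences modulo null sequences.\<close>

definition gns_cauchy :: "('a::cstar_algebra \<Rightarrow> complex) \<Rightarrow> (nat \<Rightarrow> 'a) set" where
  "gns_cauchy \<omega> = {s. \<forall>e>0. \<exists>N. \<forall>m\<ge>N. \<forall>n\<ge>N. Re (\<omega> (star (s m - s n) * (s m - s n))) < e}"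

definition gns_class :: "('a::cstar_algebra \<Rightarrow> complex) \<Rightarrow> (nat \<Rightarrow> 'a) \<Rightarrow> 'a gns_vector" where
  "gns_class \<omega> s = {t \<in> gns_cauchy \<omega>. (\<lambda>n. \<omega> (star (s n - t n) * (s n - t n))) \<longlonglongrightarrow> 0}"

definition gns_space :: "('a::cstar_algebra \<Rightarrow> complex) \<Rightarrow> 'a gns_vector hilbert" where
  "gns_space \<omega> =
    \<lparr> hcarrier = gns_class \<omega> ` gns_cauchy \<omega>,
      hzero = gns_class \<omega> (\<lambda>n. 0),
      hadd = (\<lambda>X Y. \<Union>s\<in>X. \<Union>t\<in>Y. gns_class \<omega> (\<lambda>n. s n + t n)),
      hscale = (\<lambda>c X. \<Union>s\<in>X. gns_class \<omega> (\<lambda>n. c *\<^sub>C s n)),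
      hinner = (\<lambda>X Y. THE l. \<forall>s\<in>X. \<forall>t\<in>Y. (\<lambda>n. \<omega> (star (s n) * t n)) \<longlonglongrightarrow> l) \<rparr>"

definition gns_rep :: "('a::cstar_algebra \<Rightarrow> complex) \<Rightarrow> ('a, 'a gns_vector) rep" where
  "gns_rep \<omega> =
    \<lparr> rep_space = gns_space \<omega>,
      rep_act = (\<lambda>a X. \<Union>s\<in>X. gns_class \<omega> (\<lambda>n. a * s n)) \<rparr>"

definition gns_projection :: "('a::cstar_algebra \<Rightarrow> complex) \<Rightarrow> 'a rep_class" where
  "gns_projection \<omega> = unitary_equivalence `` {gns_rep \<omega>}"


section \<open>The uniform Kaehler bundle\<close>

definition vector_state :: "('a, 'h) rep \<Rightarrow> 'h \<Rightarrow> 'a \<Rightarrow> complex" where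
  "vector_state \<pi> x = (\<lambda>a. hinner (rep_space \<pi>) x (rep_act \<pi> a x))"

text \<open>A holomorphic chart with values in a Hilbert space, together with the coordinate expression
  of the Kaehler metric: \<open>chart_metric z v u\<close> is the value at the point with coordinate \<open>z\<close> on
  the tangent vectors \<open>v\<close> (antilinear) and \<open>u\<close> (linear).\<close>

record ('e, 'h) kaehler_chart =
  chart_domain :: "'e set"
  chart_model :: "'h hilbert"
  chart_map :: "'e \<Rightarrow> 'h"
  chart_metric :: "'h \<Rightarrow> 'h \<Rightarrow> 'h \<Rightarrow> complex"

text \<open>The standard affine charts \<open>[x] \<mapsto> x / \<langle>h|x\<rangle> - h\<close> (\<open>h\<close> a unit vector, \<open>\<langle>h|x\<rangle> \<noteq> 0\<close>) of
  the projective space of the representation space, with values in the orthogonal complement of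
  \<open>h\<close> and with the Fubini-Study metric, transported along the identification of \<open>[x]\<close> with the
  vector state of \<open>x\<close>.\<close>

definition projective_chart ::
    "('a, 'h) rep \<Rightarrow> 'h \<Rightarrow> ('a \<Rightarrow> complex, 'h) kaehler_chart" where
  "projective_chart \<pi> h =
    (let H = rep_space \<pi>;
         X = {x \<in> hcarrier H. hnorm H x = 1 \<and> hinner H h x \<noteq> 0};
         w = (\<lambda>z. complex_of_real (1 / (1 + (hnorm H z)\<^sup>2)))
     in \<lparr> chart_domain = vector_state \<pi> ` X,
          chart_model = H \<lparr> hcarrier := {z \<in> hcarrier H. hinner H h z = 0} \<rparr>,
          chart_map = (\<lambda>\<omega>\<in>vector_state \<pi> ` X. THE z. \<exists>x\<in>X.
             \<omega> = vector_state \<pi> x \<and> z = hdiff H (hscale H (1 / hinner H h x) x) h),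
          chart_metric = (\<lambda>z v u. w z * hinner H v u - (w z)\<^sup>2 * hinner H v z * hinner H z u) \<rparr>)"

text \<open>Charts coming from all representatives of the class are used, so that no representative
  has to be chosen; unitary intertwiners are isomorphisms between them.\<close>

definition fibre_atlas ::
    "'a::cstar_algebra rep_class \<Rightarrow> ('a \<Rightarrow> complex, 'a gns_vector) kaehler_chart set" where
  "fibre_atlas c = {projective_chart \<pi> h | \<pi> h.
     \<pi> \<in> c \<and> h \<in> hcarrier (rep_space \<pi>) \<and> hnorm (rep_space \<pi>) h = 1}"

record ('e, 'x, 'h) kaehler_bundle =
  total_space :: "'e topology"
  bundle_proj :: "'e \<Rightarrow> 'x"
  base_space :: "'x topology"
  fibre_structure :: "'x \<Rightarrow> ('e, 'h) kaehler_chart set"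

type_synonym 'a cstar_bundle =
  "('a \<Rightarrow> complex, 'a rep_class, 'a gns_vector) kaehler_bundle"

text \<open>The topology of the type \<^typ>\<open>'a \<Rightarrow> complex\<close> is that of pointwise convergence, which on
  the dual space is the weak* topology.\<close>

definition uniform_kaehler_bundle :: "'a::cstar_algebra cstar_bundle" where
  "uniform_kaehler_bundle =
    \<lparr> total_space = top_of_set pure_states,
      bundle_proj = restrict gns_projection pure_states,
      base_space = jacobson_topology,
      fibre_structure = restrict fibre_atlas spectrum \<rparr>"

definition bundle_restriction ::
    "('e, 'x, 'h) kaehler_bundle \<Rightarrow> 'x set \<Rightarrow> ('e, 'x, 'h) kaehler_bundle" where
  "bundle_restriction B U =
    (let E = {e \<in> topspace (total_space B). bundle_proj B e \<in> U}
     in \<lparr> total_space = subtopology (total_space B) E,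
          bundle_proj = restrict (bundle_proj B) E,
          base_space = subtopology (base_space B) U,
          fibre_structure = restrict (fibre_structure B) U \<rparr>)"

definition Bun_o :: "'a::cstar_algebra cstar_bundle set" where
  "Bun_o = {bundle_restriction uniform_kaehler_bundle U | U. openin jacobson_topology U}"

definition Bun_c :: "'a::cstar_algebra cstar_bundle set" where
  "Bun_c = {bundle_restriction uniform_kaehler_bundle V | V. closedin jacobson_topology V}"

end

theory Submission
  imports Defs
begin

text \<open>Everything rests on one fact: if \<open>I\<close> is a closed ideal and \<open>a \<notin> I\<close>, some irreducible
  representation kills \<open>I\<close> but not \<open>a\<close>.  Hence \<open>I\<close> is the intersection of the kernels of the
  classes outside \<open>spectrum_of_ideal I\<close>.  The closed sets of the Jacobson topology are the sets of
  classes whose kernel contains a given closed ideal, because kernels of irreducible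
  representations are closed prime ideals, and a restricted bundle remembers its base.

  For the separation, let \<open>p(a)\<close> be the least \<open>s\<close> such that \<open>s - Re a\<close> is positive modulo \<open>I\<close> in
  the unitization.  This is a sublinear functional with \<open>p(a\<^sup>*a) \<ge> dist(a, I)\<^sup>2\<close>; an extreme real
  linear functional below \<open>p\<close> with the same value at \<open>a\<^sup>*a\<close> is the real part of a positive
  functional vanishing on \<open>I\<close>, and extremality makes its GNS representation irreducible.
  Positivity of \<open>h\<close> means \<open>\<parallel>t - h\<parallel> \<le> t\<close> for some \<open>t \<ge> 0\<close>; this makes the order theory of
  C*-algebras accessible through square roots and unitaries, without spectra.\<close>

section \<open>Positive elements of a unital C*-algebra\<close>

text \<open>Separation takes place in the unitization rather than in the quotient: positivity modulo
  \<open>I\<close> is positivity after correction by a self-adjoint element of \<open>I\<close>, and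
  \<open>infdist a I\<close> stands for the quotient norm. With positivity defined by a norm
  inequality, sums are harmless, but positivity of \<open>star x * x\<close> becomes the hard
  theorem of the order theory; contractivity of representations, continuity of the GNS action and
  the bounds on functionals all rest on it. The missing unit shapes the rest. Upper bounds are
  scalars of the unitization, dominated functionals have norm at most one instead of exactly one,
  and the cyclic vector of a GNS space is not the class of an element but comes from the Riesz
  representation theorem. Extremality concerns real functionals below a sublinear one, so Zorn's
  lemma does the work of weak* compactness. The representation obtained lives on a GNS space, hence
  on the very type to which the spectrum is restricted, and no transfer between types of Hilbert
  spaces occurs.\<close>

class unital_cstar_algebra = cstar_algebra + real_normed_algebra_1

section \<open>Elementary algebra of involution, scalars and norm\<close>

lemma star_zero [simp]: "star (0::'a::cstar_algebra) = 0"
  using star_add[of "0::'a" 0] by simp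

lemma star_minus [simp]: "star (- x) = - star (x::'a::cstar_algebra)"
  using star_add[of x "- x"] by (simp add: eq_neg_iff_add_eq_0 add.commute)

lemma star_diff: "star (x - y) = star x - star (y::'a::cstar_algebra)"
  using star_add[of x "- y"] by simp

lemma star_scaleR: "star (r *\<^sub>R x) = r *\<^sub>R star (x::'a::cstar_algebra)"
  using star_scaleC[of "complex_of_real r" x] by (simp add: scaleC_of_real)

lemma scaleC_minus_left: "(- c) *\<^sub>C x = - (c *\<^sub>C (x::'a::cstar_algebra))"
proof -
  have "0 *\<^sub>C x = 0" using scaleC_of_real[of 0 x] by simp
  then show ?thesis using scaleC_add_left[of "- c" c x] by (simp add: eq_neg_iff_add_eq_0)
qed

lemma scaleC_zero_right [simp]: "c *\<^sub>C (0::'a::cstar_algebra) = 0"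
  using scaleC_add_right[of c "0::'a" 0] by simp

lemma scaleC_minus_right: "c *\<^sub>C (- x) = - (c *\<^sub>C (x::'a::cstar_algebra))"
  using scaleC_add_right[of c x "- x"] by (simp add: eq_neg_iff_add_eq_0 add.commute)

lemma scaleC_diff_right: "c *\<^sub>C (x - y) = c *\<^sub>C x - c *\<^sub>C (y::'a::cstar_algebra)"
  using scaleC_add_right[of c x "- y"] by (simp add: scaleC_minus_right)

lemma scaleC_one [simp]: "1 *\<^sub>C x = (x::'a::cstar_algebra)"
  using scaleC_of_real[of 1 x] by simp

lemma scaleC_zero_left [simp]: "0 *\<^sub>C x = (0::'a::cstar_algebra)"
  using scaleC_of_real[of 0 x] by simp

lemma scaleR_scaleC: "r *\<^sub>R (c *\<^sub>C x) = (complex_of_real r * c) *\<^sub>C (x::'a::cstar_algebra)"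
  by (simp add: scaleC_scaleC flip: scaleC_of_real)

lemma norm_star [simp]: "norm (star x) = norm (x::'a::cstar_algebra)"
proof -
  have le: "norm y \<le> norm (star y)" for y :: 'a
  proof (cases "norm y = 0")
    case False
    have "(norm y)\<^sup>2 \<le> norm (star y) * norm y"
      using cstar_identity[of y] norm_mult_ineq[of "star y" y] by simp
    then show ?thesis using False by (simp add: power2_eq_square)
  qed simp
  show ?thesis using le[of x] le[of "star x"] by (simp add: star_star)
qed

lemma bounded_linear_star: "bounded_linear (star :: 'a::cstar_algebra \<Rightarrow> 'a)"
  by (rule bounded_linear_intro[of _ 1]) (simp_all add: star_add star_scaleR)

lemma norm_sq_selfadjoint: "star k = k \<Longrightarrow> norm (k * k) = (norm (k::'a::cstar_algebra))\<^sup>2"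
  using cstar_identity[of k] by simp

lemma star_one [simp]: "star (1::'a::unital_cstar_algebra) = 1"
  by (metis mult.right_neutral mult.left_neutral star_mult star_star)

lemma star_of_real [simp]: "star (of_real r::'a::unital_cstar_algebra) = of_real r"
  by (simp add: of_real_def star_scaleR)

lemma star_power: "star (x ^ n) = star (x::'a::unital_cstar_algebra) ^ n"
  by (induction n) (simp_all add: star_mult power_commutes)

text \<open>In spectral terms the inequality places the spectrum of \<open>h\<close> in the interval
  from 0 to \<open>2 * t\<close>. Leaving \<open>t\<close> existential makes the cone convex at
  once, because witnesses add and scale.\<close>

definition cpos :: "'a::unital_cstar_algebra \<Rightarrow> bool" where
  "cpos h \<longleftrightarrow> star h = h \<and> (\<exists>t\<ge>0. norm (of_real t - h) \<le> t)"

lemma cpos_selfadjoint: "cpos h \<Longrightarrow> star h = h"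
  by (simp add: cpos_def)

lemma cpos_norm_diff: "star h = h \<Longrightarrow> norm h \<le> t \<Longrightarrow> cpos (of_real t - h)"
  unfolding cpos_def by (intro conjI exI[of _ t]) (auto simp: star_diff intro: order_trans[OF norm_ge_zero])

lemma cpos_norm_add: "star h = h \<Longrightarrow> norm h \<le> t \<Longrightarrow> cpos (of_real t + h)"
  using cpos_norm_diff[of "- h" t] by simp

lemma cpos_zero [simp]: "cpos 0"
  unfolding cpos_def by (auto intro: exI[of _ 0])

lemma cpos_add:
  assumes "cpos h" "cpos k" shows "cpos (h + k)"
proof -
  obtain s t where "s \<ge> 0" "norm (of_real s - h) \<le> s" "t \<ge> 0" "norm (of_real t - k) \<le> t"
    using assms unfolding cpos_def by auto
  moreover have "norm (of_real (s + t) - (h + k)) \<le> norm (of_real s - h) + norm (of_real t - k)"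
    using norm_triangle_ineq[of "of_real s - h" "of_real t - k"] by (simp add: algebra_simps)
  ultimately show ?thesis
    using assms unfolding cpos_def by (intro conjI exI[of _ "s + t"]) (auto simp: star_add)
qed

lemma cpos_scaleR:
  assumes "cpos h" "0 \<le> r" shows "cpos (r *\<^sub>R h)"
proof -
  obtain t where t: "t \<ge> 0" "norm (of_real t - h) \<le> t"
    using assms unfolding cpos_def by auto
  have "norm (of_real (r * t) - r *\<^sub>R h) = r * norm (of_real t - h)"
  proof -
    have "of_real (r * t) - r *\<^sub>R h = r *\<^sub>R (of_real t - h)"
      by (simp add: of_real_def scaleR_diff_right)
    then show ?thesis using assms by simp
  qed
  then show ?thesis
    using assms t unfolding cpos_def
    by (intro conjI exI[of _ "r * t"]) (auto simp: star_scaleR mult_left_mono)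
qed

lemma cpos_of_real: "0 \<le> r \<Longrightarrow> cpos (of_real r)"
  using cpos_norm_diff[of 0 r] by simp

text \<open>The solution \<open>c\<close> is the limit of the iteration \<open>c \<mapsto> (x + c\<^sup>2) / 2\<close>, whose increments are
  dominated by those of the same iteration at the real number \<open>1\<close>.\<close>

lemma one_minus_sqrt_exists:
  fixes x :: "'a::unital_cstar_algebra"
  assumes sa: "star x = x" and le: "norm x \<le> 1"
  shows "\<exists>c. star c = c \<and> norm c \<le> 1 \<and> (1 - c) * (1 - c) = 1 - x \<and> (\<forall>y. y * x = x * y \<longrightarrow> y * c = c * y)"
proof -
  define c where "c = rec_nat 0 (\<lambda>_ u. (1/2) *\<^sub>R (x + u * u))"
  define r where "r = rec_nat 0 (\<lambda>_ u::real. (1 + u * u) / 2)"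
  have c: "c 0 = 0" "c (Suc n) = (1/2) *\<^sub>R (x + c n * c n)" for n by (simp_all add: c_def)
  have r: "r 0 = 0" "r (Suc n) = (1 + r n * r n) / 2" for n by (simp_all add: r_def)
  have comm: "y * c n = c n * y" if "y * x = x * y" for y n
  proof (induction n)
    case (Suc n)
    have "y * (c n * c n) = c n * c n * y" using Suc by (metis mult.assoc)
    then show ?case using that by (simp add: c algebra_simps)
  qed (simp add: c)
  have xc: "x * c n = c n * x" for n by (rule comm) simp
  have cc: "c m * c n = c n * c m" for m n by (rule comm) (simp add: xc)
  have r01: "0 \<le> r n \<and> r n \<le> 1" for n
  proof (induction n)
    case (Suc n)
    then have "r n * r n \<le> 1 * 1" by (intro mult_mono) auto
    then show ?case using Suc by (simp add: r)
  qed (simp add: r)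
  have cr: "norm (c n) \<le> r n" for n
  proof (induction n)
    case (Suc n)
    have "norm (c n * c n) \<le> norm (c n) * norm (c n)" by (rule norm_mult_ineq)
    also have "\<dots> \<le> r n * r n" using Suc r01[of n] by (intro mult_mono) auto
    finally have "norm (x + c n * c n) \<le> 1 + r n * r n"
      using le norm_triangle_ineq[of x "c n * c n"] by linarith
    then show ?case by (simp add: c r)
  qed (simp add: c r)
  have step: "norm (c (Suc n) - c n) \<le> r (Suc n) - r n" for n
  proof (induction n)
    case 0 then show ?case using le by (simp add: c r)
  next
    case (Suc n)
    \<comment> \<open>A difference of squares factors because the iterates commute
      (\<open>cc\<close>). The same identity holds for \<open>r\<close>, so the factors can be
      majorized one by one.\<close>
    have "c (Suc (Suc n)) - c (Suc n) = (1/2) *\<^sub>R ((c (Suc n) - c n) * (c (Suc n) + c n))"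
    proof -
      have "c (Suc (Suc n)) - c (Suc n) = (1/2) *\<^sub>R (x + c (Suc n) * c (Suc n)) - (1/2) *\<^sub>R (x + c n * c n)"
        using c(2)[of "Suc n"] c(2)[of n] by metis
      also have "\<dots> = (1/2) *\<^sub>R ((c (Suc n) - c n) * (c (Suc n) + c n))"
        unfolding scaleR_diff_right[symmetric] by (simp add: algebra_simps cc[of n "Suc n"])
      finally show ?thesis .
    qed
    then have "norm (c (Suc (Suc n)) - c (Suc n)) \<le> (norm (c (Suc n) - c n) * norm (c (Suc n) + c n)) / 2"
      using norm_mult_ineq by auto
    also have "\<dots> \<le> ((r (Suc n) - r n) * (r (Suc n) + r n)) / 2"
    proof -
      have "norm (c (Suc n) + c n) \<le> r (Suc n) + r n"
        using cr[of n] cr[of "Suc n"] norm_triangle_ineq[of "c (Suc n)" "c n"] by linarith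
      then have "norm (c (Suc n) - c n) * norm (c (Suc n) + c n) \<le> (r (Suc n) - r n) * (r (Suc n) + r n)"
        using Suc order_trans[OF norm_ge_zero Suc] by (intro mult_mono) auto
      then show ?thesis by simp
    qed
    also have "\<dots> = r (Suc (Suc n)) - r (Suc n)"
    proof -
      have "r (Suc (Suc n)) - r (Suc n) = (1 + r (Suc n) * r (Suc n)) / 2 - (1 + r n * r n) / 2"
        using r(2)[of "Suc n"] r(2)[of n] by metis
      then show ?thesis by (simp add: field_simps)
    qed
    finally show ?case .
  qed
  \<comment> \<open>Increments of \<open>r\<close> dominate norms, hence are nonnegative; being
    bounded by 1, the majorant converges.\<close>
  have "incseq r" using step by (intro incseq_SucI) (smt (verit) norm_ge_zero)
  then obtain L where "r \<longlonglongrightarrow> L" using r01 incseq_convergent[of r 1] by metis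
  then have "summable (\<lambda>n. r (Suc n) - r n)" using telescope_summable by blast
  then have "summable (\<lambda>n. norm (c (Suc n) - c n))"
    by (rule summable_comparison_test'[where N = 0]) (use step in auto)
  then have "summable (\<lambda>n. c (Suc n) - c n)" by (rule summable_norm_cancel)
  then have "convergent (\<lambda>n. \<Sum>i<n. c (Suc i) - c i)" using summable_iff_convergent by blast
  then have "convergent c" by (simp add: sum_lessThan_telescope c(1))
  then obtain d where d: "c \<longlonglongrightarrow> d" by (auto simp: convergent_def)
  have "(\<lambda>n. c (Suc n)) \<longlonglongrightarrow> (1/2) *\<^sub>R (x + d * d)"
    unfolding c by (intro tendsto_intros d)
  \<comment> \<open>The fixed point equation \<open>2 d = x + d * d\<close> is
    \<open>(1 - d) * (1 - d) = 1 - x\<close> rearranged.\<close>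
  then have dd: "d = (1/2) *\<^sub>R (x + d * d)" using d LIMSEQ_unique LIMSEQ_Suc by blast
  then have "2 *\<^sub>R d = x + d * d" by (metis (no_types, opaque_lifting) scaleR_half_double scaleR_2 scaleR_add_right)
  then have "(1 - d) * (1 - d) = 1 - x" by (simp add: algebra_simps scaleR_2)
  moreover have "star d = d"
  proof -
    have "star (c n) = c n" for n
      by (induction n) (simp_all add: c star_scaleR star_add star_mult sa)
    then show ?thesis using bounded_linear.tendsto[OF bounded_linear_star d] d LIMSEQ_unique by simp
  qed
  moreover have "norm d \<le> 1"
    using LIMSEQ_le_const2[OF tendsto_norm[OF d], of 1] cr r01 by (meson order_trans)
  moreover have "y * d = d * y" if "y * x = x * y" for y
    using tendsto_mult_left[OF d, of y] tendsto_mult_right[OF d, of y] comm[OF that] LIMSEQ_unique by simp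
  ultimately show ?thesis by blast
qed

text \<open>Dividing by a witness \<open>t\<close> turns \<open>h\<close> into \<open>1 - x\<close>
  with \<open>norm x \<le> 1\<close>. The commutation clause is the trace of functional calculus
  that survives: the root commutes with whatever commutes with \<open>h\<close>, so roots of
  commuting elements can be multiplied freely.\<close>

lemma cpos_sqrt:
  assumes "cpos h"
  shows "\<exists>k. star k = k \<and> k * k = h \<and> cpos k \<and> (\<forall>y. y * h = h * y \<longrightarrow> y * k = k * y)"
proof -
  obtain t0 where "t0 \<ge> 0" "norm (of_real t0 - h) \<le> t0" using assms unfolding cpos_def by auto
  \<comment> \<open>A positive witness is required for the division below; enlarging a witness keeps
    it one.\<close>
  define t where "t = t0 + 1"
  have t: "t > 0" "norm (of_real t - h) \<le> t"
    using \<open>t0 \<ge> 0\<close> \<open>norm (of_real t0 - h) \<le> t0\<close> norm_triangle_ineq[of "of_real t0 - h" 1]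
    by (auto simp: t_def algebra_simps)
  define x where "x = 1 - (1 / t) *\<^sub>R h"
  have "x = (1 / t) *\<^sub>R (of_real t - h)" using t by (simp add: x_def of_real_def scaleR_diff_right)
  then have "norm x = norm (of_real t - h) / t" using t by simp
  then have "norm x \<le> 1" using t by simp
  moreover have "star x = x" using assms by (simp add: x_def star_diff star_scaleR cpos_def)
  ultimately obtain c where c: "star c = c" "norm c \<le> 1" "(1 - c) * (1 - c) = 1 - x"
      "\<And>y. y * x = x * y \<Longrightarrow> y * c = c * y"
    using one_minus_sqrt_exists[of x] by blast
  define k where "k = sqrt t *\<^sub>R (1 - c)"
  have "k * k = t *\<^sub>R (1 - x)" using t c(3) by (simp add: k_def)
  then have "k * k = h" using t by (simp add: x_def)
  moreover have "star k = k" using c(1) by (simp add: k_def star_scaleR star_diff)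
  moreover have "cpos k"
    unfolding k_def using t cpos_norm_diff[of c 1] c(1,2) by (intro cpos_scaleR) auto
  moreover have "y * k = k * y" if "y * h = h * y" for y
  proof -
    have "y * c = c * y" using that by (intro c(4)) (simp add: x_def algebra_simps)
    then show ?thesis by (simp add: k_def algebra_simps)
  qed
  ultimately show ?thesis by blast
qed

text \<open>A self-adjoint \<open>k\<close> with \<open>\<parallel>k\<parallel> \<le> 1\<close> is the real part of the unitary \<open>k + \<i> d\<close>, where
  \<open>d = \<surd>(1 - k\<^sup>2)\<close>; such unitaries replace the functional calculus in norm estimates.\<close>

lemma norm_unitary_parts:
  fixes k d :: "'a::unital_cstar_algebra"
  assumes "star k = k" "star d = d" "k * d = d * k" "k * k + d * d = 1"
  shows "norm (k + \<i> *\<^sub>C d) = 1"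
proof -
  have "star (k + \<i> *\<^sub>C d) * (k + \<i> *\<^sub>C d) = 1"
    using assms by (simp add: star_add star_scaleC scaleC_minus_left algebra_simps mult_scaleC_left
      mult_scaleC_right scaleC_scaleC scaleC_diff_right)
  then show ?thesis using cstar_identity[of "k + \<i> *\<^sub>C d"] by (simp add: power2_eq_1_iff) (smt (verit) norm_ge_zero)
qed

text \<open>The triangle inequality alone would give 2. The bound 1 is exactly what makes
  \<open>k * k\<close> positive with witness \<open>t = 1\<close>.\<close>

lemma norm_one_minus_square:
  fixes k :: "'a::unital_cstar_algebra"
  assumes sa: "star k = k" and le: "norm k \<le> 1"
  shows "norm (1 - k * k) \<le> 1"
proof -
  have "norm (k * k) \<le> 1" using norm_sq_selfadjoint[OF sa] le by (simp add: power_le_one)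
  then have "cpos (1 - k * k)" using cpos_norm_diff[of "k * k" 1] sa by (simp add: star_mult)
  then obtain d where d: "star d = d" "d * d = 1 - k * k" "\<And>y. y * (1 - k * k) = (1 - k * k) * y \<Longrightarrow> y * d = d * y"
    using cpos_sqrt by blast
  have kd: "k * d = d * k" by (rule d(3)) (simp add: algebra_simps)
  define u where "u = k + \<i> *\<^sub>C d"
  define v where "v = k + \<i> *\<^sub>C (- d)"
  have u: "norm u = 1" unfolding u_def using sa d(1,2) kd by (intro norm_unitary_parts) auto
  have v: "norm v = 1" unfolding v_def using sa d(1,2) kd by (intro norm_unitary_parts) auto
  \<comment> \<open>With k, d in the roles of cosine and sine this is
    \<open>4 sin^2 x = 2 - exp(2ix) - exp(-2ix)\<close>; the norms on the right add up to 4.\<close>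
  have "4 *\<^sub>R (1 - k * k) = 2 *\<^sub>R 1 - u * u - v * v"
  proof -
    have "u * u + v * v = 2 *\<^sub>R (k * k - d * d)"
      by (simp add: u_def v_def algebra_simps mult_scaleC_left mult_scaleC_right scaleC_scaleC
        scaleC_minus_left scaleC_minus_right scaleR_2 scaleC_diff_right scaleC_add_right)
    then have "u * u + v * v = 4 *\<^sub>R (k * k) - 2 *\<^sub>R 1"
      using d(2) by (simp add: scaleR_diff_right) (simp flip: scaleR_add_left)
    moreover have "4 *\<^sub>R (1::'a) = 2 *\<^sub>R 1 + 2 *\<^sub>R 1" by (simp flip: scaleR_add_left)
    ultimately show ?thesis by (simp add: algebra_simps)
  qed
  then have "4 * norm (1 - k * k) = norm (2 *\<^sub>R 1 - u * u - v * v)"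
    by (metis abs_numeral norm_scaleR)
  also have "\<dots> \<le> 2 + norm u * norm u + norm v * norm v"
    using norm_triangle_ineq4[of "2 *\<^sub>R 1 - u * u" "v * v"] norm_triangle_ineq4[of "2 *\<^sub>R 1" "u * u"]
      norm_mult_ineq[of u u] norm_mult_ineq[of v v] by auto
  finally show ?thesis using u v by simp
qed

lemma cpos_square:
  fixes k :: "'a::unital_cstar_algebra"
  assumes "star k = k" shows "cpos (k * k)"
proof (cases "k = 0")
  case False
  define l where "l = (1 / norm k) *\<^sub>R k"
  have "norm (1 - l * l) \<le> 1"
    using assms False by (intro norm_one_minus_square) (auto simp: l_def star_scaleR)
  then have "cpos (l * l)" using assms unfolding cpos_def
    by (intro conjI exI[of _ 1]) (auto simp: star_mult l_def star_scaleR)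
  then have "cpos ((norm k)\<^sup>2 *\<^sub>R (l * l))" by (rule cpos_scaleR) simp
  then show ?thesis using False by (simp add: l_def power2_eq_square)
qed simp

text \<open>The case of conjugation that needs only squares: with d the root of \<open>h\<close>,
  the product is \<open>(k * d) * (k * d)\<close>. General conjugation has to wait for positivity of
  \<open>star x * x\<close>.\<close>

lemma cpos_mult_commuting:
  fixes k h :: "'a::unital_cstar_algebra"
  assumes "star k = k" "cpos h" "k * h = h * k"
  shows "cpos (k * h * k)"
proof -
  obtain d where d: "star d = d" "d * d = h" "k * d = d * k"
    using cpos_sqrt[OF assms(2)] assms(3) by metis
  have "cpos ((k * d) * (k * d))" using d assms by (intro cpos_square) (simp add: star_mult)
  moreover have "(k * d) * (k * d) = k * h * k" using d by (metis mult.assoc)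
  ultimately show ?thesis by simp
qed

text \<open>The roots of \<open>a\<close> and \<open>1 - a\<close> are the two parts of a unitary,
  so the root of \<open>a\<close> is the mean of two elements of norm 1.\<close>

lemma norm_le_one_of_cpos:
  fixes a :: "'a::unital_cstar_algebra"
  assumes "cpos a" "cpos (1 - a)" shows "norm a \<le> 1"
proof -
  obtain k where k: "star k = k" "k * k = a" "\<And>y. y * a = a * y \<Longrightarrow> y * k = k * y"
    using cpos_sqrt[OF assms(1)] by blast
  obtain d where d: "star d = d" "d * d = 1 - a" "\<And>y. y * (1 - a) = (1 - a) * y \<Longrightarrow> y * d = d * y"
    using cpos_sqrt[OF assms(2)] by blast
  have kd: "k * d = d * k" by (rule d(3)) (simp add: algebra_simps flip: k(2))
  have u: "norm (k + \<i> *\<^sub>C d) = 1" "norm (k + \<i> *\<^sub>C (- d)) = 1"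
    using k(1,2) d(1,2) kd by (intro norm_unitary_parts; simp)+
  have "norm (2 *\<^sub>R k) \<le> 1 + 1"
    using norm_triangle_ineq[of "k + \<i> *\<^sub>C d" "k + \<i> *\<^sub>C (- d)"] u
    by (simp add: scaleC_minus_right scaleR_2)
  then have "norm k \<le> 1" by simp
  then show ?thesis using norm_sq_selfadjoint[OF k(1)] k(2) by (simp add: power_le_one)
qed

lemma norm_le_of_cpos:
  fixes a :: "'a::unital_cstar_algebra"
  assumes "cpos a" "cpos (of_real r - a)" "0 \<le> r" shows "norm a \<le> r"
proof (rule field_le_epsilon)
  \<comment> \<open>The slack keeps the divisor \<open>r + e\<close> positive even when
    \<open>r = 0\<close>.\<close>
  fix e :: real assume e: "e > 0"
  have "cpos (of_real (r + e) - a)"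
    using cpos_add[OF assms(2) cpos_of_real[of e]] e by (simp add: algebra_simps)
  then have "cpos ((1 / (r + e)) *\<^sub>R (of_real (r + e) - a))"
    using e assms(3) by (intro cpos_scaleR) auto
  moreover have "(1 / (r + e)) *\<^sub>R (of_real (r + e) - a) = 1 - (1 / (r + e)) *\<^sub>R a"
    using e assms(3) by (simp add: of_real_def scaleR_diff_right del: scaleR_add_left)
  moreover have "cpos ((1 / (r + e)) *\<^sub>R a)" using e assms by (intro cpos_scaleR) auto
  ultimately have "norm ((1 / (r + e)) *\<^sub>R a) \<le> 1" by (metis norm_le_one_of_cpos)
  moreover have "norm ((1 / (r + e)) *\<^sub>R a) = norm a / (r + e)" using e assms(3) by simp
  ultimately show "norm a \<le> r + e" using e assms(3) by (simp add: divide_le_eq)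
qed

lemma norm_mono_cpos:
  fixes a b :: "'a::unital_cstar_algebra"
  assumes "cpos a" "cpos (b - a)" shows "norm a \<le> norm b"
proof -
  have "star b = b" using cpos_add[OF assms] cpos_selfadjoint by fastforce
  then have "cpos (of_real (norm b) - b)" by (intro cpos_norm_diff) auto
  from cpos_add[OF this assms(2)] have "cpos (of_real (norm b) - a)" by simp
  then show ?thesis using assms by (intro norm_le_of_cpos) auto
qed

text \<open>Bernoulli's inequality for \<open>1 + k * k\<close>. If q is the remainder for n, the
  next one is \<open>q + k * q * k\<close> plus n times the fourth power of k, all positive because
  k commutes with q. It supplies the growth that contradicts boundedness in
  \<open>star_mult_self_ne_neg_square\<close>.\<close>

lemma bernoulli_cpos:
  fixes k :: "'a::unital_cstar_algebra"
  assumes sa: "star k = k"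
  shows "cpos ((1 + k * k) ^ n - 1 - of_nat n * (k * k))"
proof (induction n)
  case (Suc n)
  define q where "q = (1 + k * k) ^ n - 1 - of_nat n * (k * k)"
  have kp: "k * (1 + k * k) ^ n = (1 + k * k) ^ n * k"
    by (rule power_commuting_commutes[symmetric]) (simp add: algebra_simps)
  have kq: "k * q = q * k"
    unfolding q_def using kp by (simp add: algebra_simps) (metis mult.assoc mult_of_nat_commute)
  have kkq: "k * k * q = k * q * k" using kq by (metis mult.assoc)
  have "(1 + k * k) ^ Suc n - 1 - of_nat (Suc n) * (k * k) = q + k * q * k + of_nat n * ((k * k) * (k * k))"
  proof -
    have "(1 + k * k) ^ Suc n = (1 + k * k) * (q + 1 + of_nat n * (k * k))"
      by (simp add: q_def)
    also have "\<dots> = q + 1 + of_nat n * (k * k) + k * q * k + k * k + of_nat n * ((k * k) * (k * k))"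
    proof -
      have "k * k * (of_nat n * (k * k)) = of_nat n * ((k * k) * (k * k))"
        by (metis mult.assoc mult_of_nat_commute)
      then show ?thesis by (simp add: distrib_left distrib_right kkq)
    qed
    finally show ?thesis by (simp add: algebra_simps)
  qed
  moreover have "cpos (of_nat n * ((k * k) * (k * k)))"
  proof -
    have "of_nat n * ((k * k) * (k * k)) = real n *\<^sub>R ((k * k) * (k * k))"
      by (simp add: scaleR_conv_of_real)
    then show ?thesis using sa by (metis cpos_scaleR cpos_square of_nat_0_le_iff star_mult)
  qed
  moreover have "cpos q" using Suc by (simp only: q_def)
  ultimately show ?case using kq sa by (metis cpos_add cpos_mult_commuting)
qed simp

text \<open>If \<open>y\<^sup>*y = - k\<^sup>2\<close> then \<open>z = y y\<^sup>*\<close> is positive, since \<open>y y\<^sup>* + y\<^sup>*y\<close> is a sum of squares of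
  self-adjoint elements.  Normalising \<open>\<parallel>y\<parallel> \<le> 1\<close>, the element
  \<open>y\<^sup>* (1 - z)\<^sup>n y = - k\<^sup>2 (1 + k\<^sup>2)\<^sup>n\<close> stays bounded, which forces \<open>k = 0\<close>.\<close>

lemma star_mult_self_ne_neg_square:
  fixes y k :: "'a::unital_cstar_algebra"
  assumes sa: "star k = k" and y1: "norm y \<le> 1" and yk: "star y * y = - (k * k)"
  shows "y = 0"
proof -
  define z where "z = y * star y"
  define c where "c = k * k"
  have "cpos z"
  proof -
    define p where "p = (1/2) *\<^sub>R (y + star y)"
    define q where "q = (\<i> / 2) *\<^sub>C (star y - y)"
    have sp: "star p = p" by (simp add: p_def star_scaleR star_add star_star add.commute)
    have sq: "star q = q"
      by (simp add: q_def star_scaleR star_scaleC star_diff star_star scaleC_minus_left flip: scaleC_minus_right)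
    have "p * p + q * q = (1/2) *\<^sub>R (star y * y + z)"
    proof -
      have "4 *\<^sub>R (p * p) = (y + star y) * (y + star y)" by (simp add: p_def)
      moreover have "4 *\<^sub>R (q * q) = - ((star y - y) * (star y - y))"
        by (simp add: q_def mult_scaleC_left mult_scaleC_right scaleC_scaleC scaleR_scaleC scaleC_minus_left)
      ultimately have "4 *\<^sub>R (p * p + q * q) = 2 *\<^sub>R (star y * y + z)"
        by (simp add: scaleR_add_right z_def algebra_simps scaleR_2)
      then have "(1/4) *\<^sub>R (4 *\<^sub>R (p * p + q * q)) = (1/4) *\<^sub>R (2 *\<^sub>R (star y * y + z))" by simp
      then show ?thesis by simp
    qed
    then have "2 *\<^sub>R (p * p + q * q) + k * k = z"
      using yk by simp
    then show ?thesis using sp sq sa by (metis cpos_add cpos_scaleR cpos_square zero_le_numeral)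
  qed
  \<comment> \<open>Only as a square \<open>m * m\<close> does z come under
    \<open>norm_one_minus_square\<close>, which bounds \<open>1 - z\<close> by 1.\<close>
  obtain m where m: "star m = m" "m * m = z" using cpos_sqrt[OF \<open>cpos z\<close>] by blast
  have "(norm m)\<^sup>2 \<le> 1"
    using norm_sq_selfadjoint[OF m(1)] m(2) y1 norm_mult_ineq[of y "star y"] mult_le_one[OF y1 norm_ge_zero y1]
    by (simp add: z_def)
  then have "norm m \<le> 1" by (simp add: power_le_one_iff)
  then have z1: "norm (1 - z) \<le> 1" using norm_one_minus_square m by metis
  \<comment> \<open>From \<open>z * y = y * (star y * y) = - (y * c)\<close>: y intertwines the
    contraction \<open>1 - z\<close> with the growing element \<open>1 + c\<close>.\<close>
  have cy: "(1 - z) * y = y * (1 + c)"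
    using yk by (simp add: z_def c_def algebra_simps)
  have pow: "(1 - z) ^ n * y = y * (1 + c) ^ n" for n
  proof (induction n)
    case (Suc n)
    have "(1 - z) ^ Suc n * y = (1 - z) * (y * (1 + c) ^ n)" using Suc by (simp add: mult.assoc)
    also have "\<dots> = y * (1 + c) * (1 + c) ^ n" using cy by (simp flip: mult.assoc)
    finally show ?case by (simp add: mult.assoc)
  qed simp
  have bound: "norm (c * (1 + c) ^ n) \<le> 1" for n
  proof -
    have "c * (1 + c) ^ n = - (star y * ((1 - z) ^ n * y))"
      unfolding pow mult.assoc[symmetric] yk by (simp add: c_def)
    then have "norm (c * (1 + c) ^ n) = norm (star y * ((1 - z) ^ n * y))" by simp
    also have "\<dots> \<le> norm (star y) * (norm ((1 - z) ^ n) * norm y)"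
      by (rule order_trans[OF norm_mult_ineq]) (simp add: mult_left_mono norm_mult_ineq)
    also have "\<dots> \<le> 1 * (1 * 1)"
    proof -
      have "norm ((1 - z) ^ n) \<le> 1"
        using norm_power_ineq[of "1 - z" n] z1 by (meson norm_ge_zero order_trans power_le_one)
      then show ?thesis using y1 by (intro mult_mono) auto
    qed
    finally show ?thesis by simp
  qed
  \<comment> \<open>By Bernoulli, \<open>c * (1 + c) ^ n\<close> exceeds \<open>n\<close> times
    \<open>c * c\<close> by a positive element, while its norm stays at most 1.\<close>
  have "real n * norm (c * c) \<le> 1" for n
  proof -
    define q where "q = (1 + c) ^ n - 1 - of_nat n * c"
    have q: "cpos q" unfolding q_def c_def by (rule bernoulli_cpos[OF sa])
    have kp: "k * (1 + c) ^ n = (1 + c) ^ n * k"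
      by (rule power_commuting_commutes[symmetric]) (simp add: algebra_simps c_def)
    have kq: "k * q = q * k"
      unfolding q_def using kp by (simp add: algebra_simps c_def) (metis mult.assoc mult_of_nat_commute)
    have "c * (1 + c) ^ n - real n *\<^sub>R (c * c) = k * q * k + k * k"
    proof -
      have "c * (1 + c) ^ n = c * (q + 1 + of_nat n * c)" by (simp add: q_def)
      also have "\<dots> = k * q * k + k * k + c * (of_nat n * c)"
        using kq by (simp add: distrib_left c_def) (metis mult.assoc)
      also have "c * (of_nat n * c) = real n *\<^sub>R (c * c)"
        by (simp add: scaleR_conv_of_real) (metis mult.assoc mult_of_nat_commute)
      finally show ?thesis by simp
    qed
    moreover have "cpos (k * q * k + k * k)"
      using sa q kq by (intro cpos_add cpos_mult_commuting cpos_square)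
    moreover have "cpos (real n *\<^sub>R (c * c))"
      using sa by (intro cpos_scaleR cpos_square) (auto simp: c_def star_mult)
    ultimately have "norm (real n *\<^sub>R (c * c)) \<le> norm (c * (1 + c) ^ n)"
      by (intro norm_mono_cpos) auto
    then show ?thesis using bound[of n] by simp
  qed
  then have "norm (c * c) = 0"
    by (metis reals_Archimedean3 norm_ge_zero not_le order_le_less)
  then have "c = 0" using norm_sq_selfadjoint[of c] sa by (simp add: c_def star_mult)
  then show ?thesis using yk cstar_identity[of y] by (simp add: c_def)
qed

text \<open>Here m is the absolute value of \<open>h = star x * x\<close>, and
  \<open>v = m - h\<close> is twice the negative part of h. Since \<open>h * v = - (m * v)\<close>,
  the element \<open>x * v\<close> satisfies \<open>star (x * v) * (x * v) = - (v * m * v)\<close>,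
  minus the square of a self-adjoint element, and therefore vanishes. So v = 0 and h coincides with
  its absolute value.\<close>

theorem cpos_star_mult_self: "cpos (star x * x :: 'a::unital_cstar_algebra)"
proof -
  define h where "h = star x * x"
  have sh: "star h = h" by (simp add: h_def star_mult star_star)
  obtain m where m: "star m = m" "m * m = h * h" "cpos m" "\<And>y. y * (h * h) = h * h * y \<Longrightarrow> y * m = m * y"
    using cpos_sqrt[OF cpos_square[OF sh]] by blast
  have hm: "h * m = m * h" by (rule m(4)) (simp add: mult.assoc)
  define v where "v = m - h"
  have sv: "star v = v" by (simp add: v_def star_diff m(1) sh)
  have hv: "h * v = - (m * v)" by (simp add: v_def algebra_simps m(2) hm)
  have vm: "v * m = m * v" by (simp add: v_def algebra_simps hm)
  obtain d where d: "star d = d" "d * d = m" "v * d = d * v"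
    using cpos_sqrt[OF m(3)] vm by metis
  \<comment> \<open>Scales \<open>x * v\<close> into the unit ball; the added 1 avoids division by
    zero.\<close>
  define s where "s = 1 / (norm (x * v) + 1)"
  have s: "s > 0" by (simp add: s_def add_nonneg_pos)
  define y where "y = s *\<^sub>R (x * v)"
  define k where "k = s *\<^sub>R (v * d)"
  have "star y * y = - (k * k)"
  proof -
    have "star (x * v) * (x * v) = v * (h * v)" by (simp add: star_mult sv h_def mult.assoc)
    also have "\<dots> = - (v * (d * d * v))" by (simp add: hv d)
    also have "\<dots> = - ((v * d) * (v * d))" by (metis d(3) mult.assoc)
    finally show ?thesis by (simp add: y_def k_def star_scaleR)
  qed
  moreover have "star k = k" using d sv by (simp add: k_def star_scaleR star_mult)
  moreover have "norm y \<le> 1" using s by (simp add: y_def s_def field_simps)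
  ultimately have "y = 0" by (intro star_mult_self_ne_neg_square)
  then have "x * v = 0" using s by (simp add: y_def)
  then have "h * v = 0" by (simp add: h_def mult.assoc)
  \<comment> \<open>Both \<open>h * v\<close> and \<open>m * v\<close> vanish, and their difference
    is the square of v.\<close>
  moreover from this hv have "m * v = 0" by simp
  ultimately have "v * v = 0" by (simp add: v_def left_diff_distrib)
  then have "v = 0" using norm_sq_selfadjoint[OF sv] by simp
  then show ?thesis using m(3) by (simp add: v_def h_def)
qed

lemma cpos_conj:
  fixes x h :: "'a::unital_cstar_algebra"
  assumes "cpos h" shows "cpos (star x * h * x)"
proof -
  obtain k where k: "star k = k" "k * k = h" using cpos_sqrt[OF assms] by blast
  have "star x * h * x = star (k * x) * (k * x)" using k by (simp add: star_mult mult.assoc flip: k(2))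
  then show ?thesis by (simp add: cpos_star_mult_self)
qed

lemma cpos_norm_star_mult_self:
  "cpos (of_real ((norm x)\<^sup>2) - star x * (x :: 'a::unital_cstar_algebra))"
  by (rule cpos_norm_diff) (simp_all add: star_mult star_star cstar_identity)

text \<open>Inductively \<open>(1 + n k\<^sup>2) (1 - k\<^sup>2)\<^sup>n \<le> 1\<close>.\<close>

lemma norm_mult_one_minus_square_power:
  fixes k :: "'a::unital_cstar_algebra"
  assumes sa: "star k = k" and le: "norm k \<le> 1"
  shows "2 * real n * (norm (k * (1 - k * k) ^ n))\<^sup>2 \<le> 1"
proof -
  define g where "g = 1 - k * k"
  have sg: "star g = g" by (simp add: g_def star_diff star_mult sa)
  have kg: "k * g = g * k" by (simp add: g_def algebra_simps)
  have "norm (k * k) \<le> 1" using norm_sq_selfadjoint[OF sa] le by (simp add: power_le_one)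
  then have "cpos g" using cpos_norm_diff[of "k * k" 1] sa by (simp add: g_def star_mult)
  then obtain r where r: "star r = r" "r * r = g" "k * r = r * k"
    using cpos_sqrt kg by metis
  have krn: "k * r ^ n = r ^ n * k" for n
    using power_commuting_commutes[of r k n] r by simp
  have gn: "g ^ n = r ^ n * r ^ n" for n
    unfolding r(2)[symmetric] using power_mult_distrib by (metis power2_eq_square power_commutes power_mult mult.commute)
  have kgn: "k * g ^ n = g ^ n * k" for n
    using power_commuting_commutes[of g k n] kg by simp
  have main: "cpos (1 - (g ^ n + real n *\<^sub>R (k * k * g ^ n)))" for n
  proof (induction n)
    case (Suc n)
    \<comment> \<open>The expression \<open>(1 + n k^2) g^n\<close> drops by exactly
      \<open>(n + 1) k^4 g^n\<close> from n to n + 1, a multiple of the square of a self-adjoint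
      element.\<close>
    have eq: "(1 - (g ^ Suc n + real (Suc n) *\<^sub>R (k * k * g ^ Suc n))) =
        (1 - (g ^ n + real n *\<^sub>R (k * k * g ^ n))) + real (Suc n) *\<^sub>R (k * k * (k * k) * g ^ n)"
      by (simp add: g_def algebra_simps)
    moreover have "k * k * (k * k) * g ^ n = (k * k * r ^ n) * (k * k * r ^ n)"
      unfolding gn by (metis krn mult.assoc)
    moreover have "cpos ((k * k * r ^ n) * (k * k * r ^ n))"
      by (rule cpos_square) (simp add: star_mult star_power sa r, metis krn mult.assoc)
    ultimately show ?case unfolding eq by (simp only: cpos_add cpos_scaleR Suc of_nat_0_le_iff)
  qed simp
  \<comment> \<open>The exponent is doubled because the squared norm of \<open>k * g ^ n\<close> is
    the norm of \<open>k * k * g ^ (2 * n)\<close>; this is where the factor 2 of the statement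
    arises. Adding \<open>g ^ (2 * n)\<close> removes the first summand of
    \<open>main\<close>.\<close>
  have pw: "cpos (g ^ (2 * n))"
    using cpos_square[of "g ^ n"] sg by (simp add: star_power mult_2 power_add)
  have sq: "star (k * g ^ n) * (k * g ^ n) = k * k * g ^ (2 * n)"
    by (simp add: star_mult star_power sa sg mult_2 power_add) (metis kgn mult.assoc)
  have "cpos (real (2 * n) *\<^sub>R (k * k * g ^ (2 * n)))"
    unfolding sq[symmetric] by (intro cpos_scaleR cpos_star_mult_self) simp
  moreover have "cpos (1 - real (2 * n) *\<^sub>R (k * k * g ^ (2 * n)))"
    using cpos_add[OF main[of "2 * n"] pw] by (simp add: algebra_simps)
  ultimately have "norm (real (2 * n) *\<^sub>R (k * k * g ^ (2 * n))) \<le> 1"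
    by (rule norm_le_one_of_cpos)
  moreover have "norm (k * k * g ^ (2 * n)) = (norm (k * g ^ n))\<^sup>2"
    using cstar_identity[of "k * g ^ n"] unfolding sq .
  ultimately show ?thesis by (simp add: g_def)
qed

section \<open>The unitization\<close>

datatype 'a unitization = Unitized (alg_part: 'a) (scalar_part: complex)

text \<open>Left multiplication realizes the unitization by operators on the algebra itself; the
  operator norm of this action is what carries the C*-identity over.\<close>

definition unit_act :: "'a::cstar_algebra unitization \<Rightarrow> 'a \<Rightarrow> 'a" where
  "unit_act x b = alg_part x * b + scalar_part x *\<^sub>C b"

lemma scaleC_scaleR: "c *\<^sub>C (r *\<^sub>R x) = r *\<^sub>R (c *\<^sub>C (x::'a::cstar_algebra))"
  by (simp add: scaleC_scaleC mult.commute flip: scaleC_of_real)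

lemma scaleR_complex_scaleC: "(r *\<^sub>R c) *\<^sub>C x = r *\<^sub>R (c *\<^sub>C (x::'a::cstar_algebra))"
  by (simp add: scaleR_scaleC scaleR_conv_of_real)

lemma bounded_linear_scaleC: "bounded_linear (\<lambda>x. c *\<^sub>C (x::'a::cstar_algebra))"
  by (rule bounded_linear_intro[of _ "cmod c"])
    (simp_all add: scaleC_add_right scaleC_scaleR norm_scaleC mult.commute)

lemma bounded_linear_unit_act: "bounded_linear (unit_act x)"
  unfolding unit_act_def
  by (intro bounded_linear_add bounded_linear_mult_right bounded_linear_scaleC)

text \<open>The C*-identity, tested on the vector \<open>star a\<close>. It makes the embedding into
  the unitization isometric.\<close>

lemma norm_le_onorm_mult: "norm (a::'a::cstar_algebra) \<le> onorm (\<lambda>b. a * b)"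
proof (cases "a = 0")
  case False
  have "norm (a * star a) \<le> onorm (\<lambda>b. a * b) * norm (star a)"
    by (rule onorm[OF bounded_linear_mult_right])
  moreover have "norm (a * star a) = norm a * norm a"
    using cstar_identity[of "star a"] by (simp add: star_star power2_eq_square)
  ultimately show ?thesis using False by simp
qed (simp add: onorm_pos_le bounded_linear_mult_right)

text \<open>The maximum with the modulus of the scalar part makes this a norm also when the algebra
  already has a unit.\<close>

instantiation unitization :: (cstar_algebra) real_normed_algebra_1
begin

definition "zero_unitization = Unitized 0 0"
definition "one_unitization = Unitized 0 1"
definition "plus_unitization x y = Unitized (alg_part x + alg_part y) (scalar_part x + scalar_part y)"
definition "minus_unitization x y = Unitized (alg_part x - alg_part y) (scalar_part x - scalar_part y)"
definition "uminus_unitization x = Unitized (- alg_part x) (- scalar_part x)"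
definition "times_unitization x y = Unitized
  (alg_part x * alg_part y + scalar_part x *\<^sub>C alg_part y + scalar_part y *\<^sub>C alg_part x)
  (scalar_part x * scalar_part y)"
definition "scaleR_unitization r x = Unitized (r *\<^sub>R alg_part x) (r *\<^sub>R scalar_part x)"
definition "norm_unitization x = max (cmod (scalar_part x)) (onorm (unit_act x))"
definition "sgn_unitization x = inverse (norm x) *\<^sub>R (x::'a unitization)"
definition "dist_unitization x y = norm (x - y :: 'a unitization)"
definition "uniformity_unitization = (INF e\<in>{0 <..}. principal {(x, y::'a unitization). dist x y < e})"
definition "open_unitization S \<longleftrightarrow>
  (\<forall>x\<in>S. \<forall>\<^sub>F (x', y) in uniformity. x' = x \<longrightarrow> (y::'a unitization) \<in> S)"

lemmas unitization_defs = zero_unitization_def one_unitization_def plus_unitization_def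
  minus_unitization_def uminus_unitization_def times_unitization_def scaleR_unitization_def

lemma norm_unit_act: "norm (unit_act x b) \<le> norm x * norm b"
  using onorm[OF bounded_linear_unit_act[of x], of b]
  by (simp add: norm_unitization_def) (meson max.cobounded2 mult_right_mono norm_ge_zero order_trans)

lemma norm_unitization_leI:
  assumes "0 \<le> M" "\<And>b. norm (unit_act x b) \<le> M * norm b" "cmod (scalar_part x) \<le> M"
  shows "norm x \<le> M"
  using assms by (simp add: norm_unitization_def onorm_bound)

lemma cmod_scalar_part_le: "cmod (scalar_part x) \<le> norm x"
  by (simp add: norm_unitization_def)

lemma unit_act_add: "unit_act (x + y) b = unit_act x b + unit_act y b"
  by (simp add: unit_act_def unitization_defs algebra_simps scaleC_add_left)

lemma unit_act_mult: "unit_act (x * y) b = unit_act x (unit_act y b)"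
  by (simp add: unit_act_def unitization_defs algebra_simps scaleC_add_right mult_scaleC_left
    mult_scaleC_right scaleC_scaleC)

lemma norm_mult_unitization: "norm (x * y) \<le> norm x * norm (y::'a unitization)"
proof (rule norm_unitization_leI)
  fix b
  have "norm (unit_act (x * y) b) \<le> norm x * norm (unit_act y b)"
    unfolding unit_act_mult by (rule norm_unit_act)
  also have "\<dots> \<le> norm x * (norm y * norm b)"
    by (intro mult_left_mono norm_unit_act) (simp add: norm_unitization_def le_max_iff_disj)
  finally show "norm (unit_act (x * y) b) \<le> norm x * norm y * norm b" by (simp add: mult.assoc)
next
  have p: "0 \<le> norm z" for z :: "'a unitization" by (simp add: norm_unitization_def le_max_iff_disj)
  then show "0 \<le> norm x * norm y" by simp
  show "cmod (scalar_part (x * y)) \<le> norm x * norm y"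
    using cmod_scalar_part_le[of x] cmod_scalar_part_le[of y] p
    by (auto simp: times_unitization_def norm_mult intro!: mult_mono)
qed

lemma norm_le_parts: "norm x \<le> norm (alg_part x) + cmod (scalar_part x)"
proof (rule norm_unitization_leI)
  fix b
  have "norm (unit_act x b) \<le> norm (alg_part x * b) + norm (scalar_part x *\<^sub>C b)"
    unfolding unit_act_def by (rule norm_triangle_ineq)
  also have "\<dots> \<le> norm (alg_part x) * norm b + cmod (scalar_part x) * norm b"
    by (intro add_mono) (simp_all add: norm_mult_ineq norm_scaleC)
  finally show "norm (unit_act x b) \<le> (norm (alg_part x) + cmod (scalar_part x)) * norm b"
    by (simp add: algebra_simps)
qed auto

text \<open>One \<open>norm x\<close> bounds the action and a second one the scalar part subtracted
  from it. Together with \<open>cmod_scalar_part_le\<close> this reduces definiteness and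
  completeness to the two components.\<close>

lemma norm_alg_part_le: "norm (alg_part x) \<le> 2 * norm x"
proof -
  have "onorm (\<lambda>b. alg_part x * b) \<le> 2 * norm x"
  proof (rule onorm_bound)
    fix b
    have "norm (alg_part x * b) \<le> norm (unit_act x b) + norm (scalar_part x *\<^sub>C b)"
      using norm_triangle_ineq4[of "unit_act x b" "scalar_part x *\<^sub>C b"] by (simp add: unit_act_def)
    also have "\<dots> \<le> norm x * norm b + norm x * norm b"
      by (intro add_mono norm_unit_act) (simp add: norm_scaleC cmod_scalar_part_le mult_right_mono)
    finally show "norm (alg_part x * b) \<le> 2 * norm x * norm b" by (simp add: mult_ac)
  qed (simp add: norm_unitization_def le_max_iff_disj)
  then show ?thesis using norm_le_onorm_mult order_trans by blast
qed

lemma norm_scaleC_unitization: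
  "norm (Unitized (c *\<^sub>C alg_part x) (c * scalar_part x)) = cmod c * norm x"
proof -
  define m where "m c x = Unitized (c *\<^sub>C alg_part x) (c * scalar_part x)" for c and x :: "'a unitization"
  have p: "0 \<le> norm z" for z :: "'a unitization" by (simp add: norm_unitization_def le_max_iff_disj)
  have act: "unit_act (m c x) b = c *\<^sub>C unit_act x b" for c x b
    by (simp add: unit_act_def m_def scaleC_add_right mult_scaleC_left scaleC_scaleC)
  have ne: "norm (m c x) \<le> cmod c * norm x" for c x
  proof (rule norm_unitization_leI)
    fix b
    show "norm (unit_act (m c x) b) \<le> cmod c * norm x * norm b"
      by (simp add: act norm_scaleC norm_unit_act mult_left_mono mult.assoc)
    show "cmod (scalar_part (m c x)) \<le> cmod c * norm x"
      by (simp add: m_def norm_mult cmod_scalar_part_le mult_left_mono)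
  qed (use p in simp)
  have "norm (m c x) = cmod c * norm x"
  proof (cases "c = 0")
    case True then show ?thesis using ne[of 0 x] p[of "m 0 x"] by simp
  next
    case False
    have "m (inverse c) (m c x) = x" using False
      by (cases x) (simp add: m_def scaleC_scaleC)
    then have "norm x \<le> inverse (cmod c) * norm (m c x)"
      using ne[of "inverse c" "m c x"] by (simp add: norm_inverse)
    then have "cmod c * norm x \<le> norm (m c x)" using False by (simp add: field_simps)
    then show ?thesis using ne[of c x] by simp
  qed
  then show ?thesis by (simp add: m_def)
qed

instance
proof
  have p: "0 \<le> norm z" for z :: "'a unitization" by (simp add: norm_unitization_def le_max_iff_disj)
  fix x y z :: "'a unitization" and r :: real
  show "norm (x + y) \<le> norm x + norm y" for x y :: "'a unitization"
  proof (rule norm_unitization_leI)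
    fix b
    show "norm (unit_act (x + y) b) \<le> (norm x + norm y) * norm b"
      unfolding unit_act_add distrib_right
      by (rule order_trans[OF norm_triangle_ineq]) (intro add_mono norm_unit_act)
    show "cmod (scalar_part (x + y)) \<le> norm x + norm y"
      using cmod_scalar_part_le[of x] cmod_scalar_part_le[of y]
        norm_triangle_ineq[of "scalar_part x" "scalar_part y"] by (simp add: plus_unitization_def)
  qed (use p in simp)
  show "norm (r *\<^sub>R x) = \<bar>r\<bar> * norm x"
    using norm_scaleC_unitization[of "complex_of_real r" x]
    by (simp add: scaleR_unitization_def scaleC_of_real scaleR_conv_of_real)
  show "norm x = 0 \<longleftrightarrow> x = 0" for x :: "'a unitization"
  proof
    assume "norm x = 0"
    then have "alg_part x = 0" "scalar_part x = 0"
      using norm_alg_part_le[of x] cmod_scalar_part_le[of x] by auto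
    then show "x = 0" by (cases x) (simp add: zero_unitization_def)
  next
    assume "x = 0"
    then show "norm x = 0" using norm_le_parts[of x] p[of x] by (simp add: zero_unitization_def)
  qed
  show "norm (x * y) \<le> norm x * norm y" by (rule norm_mult_unitization)
  show "norm (1::'a unitization) = 1"
  proof (rule antisym)
    show "norm (1::'a unitization) \<le> 1" using norm_le_parts[of 1] by (simp add: one_unitization_def)
    show "1 \<le> norm (1::'a unitization)" using cmod_scalar_part_le[of 1] by (simp add: one_unitization_def)
  qed
qed (simp_all add: unitization_defs algebra_simps scaleC_add_right scaleC_add_left mult_scaleC_left
    mult_scaleC_right scaleC_scaleC scaleC_scaleR scaleR_complex_scaleC
    scaleR_add_left scaleR_add_right scaleC_diff_right
    dist_unitization_def uniformity_unitization_def open_unitization_def sgn_unitization_def)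

end

instance unitization :: (cstar_algebra) banach
proof
  fix X :: "nat \<Rightarrow> 'a unitization" assume X: "Cauchy X"
  show "convergent X"
  proof -
    have N: "\<exists>N. \<forall>m\<ge>N. \<forall>n\<ge>N. norm (X m - X n) < e" if "e > 0" for e
      using X that by (simp add: Cauchy_def dist_unitization_def)
    have "Cauchy (\<lambda>n. alg_part (X n))"
    proof (rule CauchyI)
      fix e :: real assume "e > 0"
      then obtain N where "\<forall>m\<ge>N. \<forall>n\<ge>N. norm (X m - X n) < e / 2" using N[of "e / 2"] by auto
      moreover have "norm (alg_part (X m) - alg_part (X n)) \<le> 2 * norm (X m - X n)" for m n
        using norm_alg_part_le[of "X m - X n"] by (simp add: minus_unitization_def)
      ultimately show "\<exists>M. \<forall>m\<ge>M. \<forall>n\<ge>M. norm (alg_part (X m) - alg_part (X n)) < e"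
        by (smt (verit) field_sum_of_halves)
    qed
    then obtain a where a: "(\<lambda>n. alg_part (X n)) \<longlonglongrightarrow> a" unfolding Cauchy_convergent_iff convergent_def by blast
    have "Cauchy (\<lambda>n. scalar_part (X n))"
    proof (rule CauchyI)
      fix e :: real assume "e > 0"
      then obtain N where "\<forall>m\<ge>N. \<forall>n\<ge>N. norm (X m - X n) < e" using N[of e] by auto
      moreover have "norm (scalar_part (X m) - scalar_part (X n)) \<le> norm (X m - X n)" for m n
        using cmod_scalar_part_le[of "X m - X n"] by (simp add: minus_unitization_def)
      ultimately show "\<exists>M. \<forall>m\<ge>M. \<forall>n\<ge>M. norm (scalar_part (X m) - scalar_part (X n)) < e"
        by (meson le_less_trans)
    qed
    then obtain l where l: "(\<lambda>n. scalar_part (X n)) \<longlonglongrightarrow> l" unfolding Cauchy_convergent_iff convergent_def by blast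
    have lim: "(\<lambda>n. norm (alg_part (X n) - a) + norm (scalar_part (X n) - l)) \<longlonglongrightarrow> 0 + 0"
      using a l by (intro tendsto_add) (simp_all add: LIM_zero tendsto_norm_zero)
    have le: "dist (X n) (Unitized a l) \<le> norm (alg_part (X n) - a) + norm (scalar_part (X n) - l)" for n
      using norm_le_parts[of "X n - Unitized a l"] by (simp add: minus_unitization_def dist_unitization_def)
    have "(\<lambda>n. dist (X n) (Unitized a l)) \<longlonglongrightarrow> 0"
      by (rule Lim_null_comparison[of _ "\<lambda>n. norm (alg_part (X n) - a) + norm (scalar_part (X n) - l)"])
        (use lim le in simp_all)
    then have "X \<longlonglongrightarrow> Unitized a l" by (rule tendsto_dist_iff[THEN iffD2])
    then show ?thesis by (auto simp: convergent_def)
  qed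
qed

instantiation unitization :: (cstar_algebra) unital_cstar_algebra
begin

definition "scaleC_unitization c x = Unitized (c *\<^sub>C alg_part x) (c * scalar_part x)"
definition "star_unitization x = Unitized (star (alg_part x)) (cnj (scalar_part x))"

text \<open>For z in the unitization, the C*-identity of the algebra applied to
  \<open>unit_act z b\<close> gives \<open>star b * unit_act (star z * z) b\<close>, hence one
  inequality for the operator norm; for the scalar part it is a computation. That inequality forces
  \<open>star\<close> to be isometric, and submultiplicativity then gives the converse.\<close>

lemma cstar_identity_unitization: "norm (star x * x) = (norm (x::'a unitization))\<^sup>2"
proof -
  have le: "(norm z)\<^sup>2 \<le> norm (star z * z)" for z :: "'a unitization"
  proof -
    have "norm z \<le> sqrt (norm (star z * z))"
    proof (rule norm_unitization_leI)
      fix b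
      have "(norm (unit_act z b))\<^sup>2 = norm (star (unit_act z b) * unit_act z b)"
        by (rule cstar_identity[symmetric])
      also have "star (unit_act z b) * unit_act z b = star b * unit_act (star z * z) b"
        by (simp add: unit_act_def unitization_defs star_unitization_def star_add star_mult star_scaleC algebra_simps
          scaleC_add_right mult_scaleC_left mult_scaleC_right scaleC_scaleC)
      also have "norm \<dots> \<le> norm b * norm (unit_act (star z * z) b)"
        using norm_mult_ineq[of "star b"] by simp
      also have "\<dots> \<le> norm b * (norm (star z * z) * norm b)"
        by (intro mult_left_mono norm_unit_act) simp
      finally have "(norm (unit_act z b))\<^sup>2 \<le> (sqrt (norm (star z * z)) * norm b)\<^sup>2"
        by (simp add: power_mult_distrib power2_eq_square mult_ac)
      then show "norm (unit_act z b) \<le> sqrt (norm (star z * z)) * norm b"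
        by (rule power2_le_imp_le) simp
    next
      have "(cmod (scalar_part z))\<^sup>2 = cmod (scalar_part (star z * z))"
        by (simp add: unitization_defs star_unitization_def norm_mult power2_eq_square)
      also have "\<dots> \<le> norm (star z * z)" by (rule cmod_scalar_part_le)
      finally show "cmod (scalar_part z) \<le> sqrt (norm (star z * z))" by (rule real_le_rsqrt)
    qed simp
    then show ?thesis
      by (metis norm_ge_zero power_mono real_sqrt_pow2)
  qed
  have st: "star (star z) = z" for z :: "'a unitization"
    by (simp add: star_unitization_def star_star)
  have nle: "norm z \<le> norm (star z)" for z :: "'a unitization"
  proof (cases "norm z = 0")
    case False
    have "norm z * norm z \<le> norm (star z) * norm z"
      using le[of z] norm_mult_ineq[of "star z" z] by (simp add: power2_eq_square)
    then show ?thesis using False by simp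
  qed simp
  have "norm (star x) = norm x" using nle[of x] nle[of "star x"] by (simp add: st)
  then show ?thesis using le[of x] norm_mult_ineq[of "star x" x] by (simp add: power2_eq_square)
qed

instance
proof
  fix x :: "'a unitization" and r :: real and c :: complex
  show "complex_of_real r *\<^sub>C x = r *\<^sub>R x"
    by (simp add: scaleC_unitization_def scaleR_unitization_def scaleC_of_real scaleR_conv_of_real)
  show "norm (c *\<^sub>C x) = cmod c * norm x"
    by (simp add: scaleC_unitization_def norm_scaleC_unitization)
  show "norm (star x * x) = (norm x)\<^sup>2" by (rule cstar_identity_unitization)
qed (simp_all add: unitization_defs scaleC_unitization_def star_unitization_def algebra_simps
    scaleC_add_right scaleC_add_left mult_scaleC_left mult_scaleC_right scaleC_scaleC star_star
    star_add star_mult star_scaleC)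

end

lemmas unitization_cstar_defs = unitization_defs scaleC_unitization_def star_unitization_def

section \<open>The embedding of the algebra into its unitization\<close>

definition emb :: "'a::cstar_algebra \<Rightarrow> 'a unitization" where
  "emb a = Unitized a 0"

lemma emb_zero [simp]: "emb 0 = 0"
  by (simp add: emb_def unitization_cstar_defs)

lemma emb_add: "emb (a + b) = emb a + emb b"
  by (simp add: emb_def unitization_cstar_defs)

lemma emb_diff: "emb (a - b) = emb a - emb b"
  by (simp add: emb_def unitization_cstar_defs)

lemma emb_minus: "emb (- a) = - emb a"
  by (simp add: emb_def unitization_cstar_defs)

lemma emb_mult: "emb (a * b) = emb a * emb b"
  by (simp add: emb_def unitization_cstar_defs)

lemma emb_star: "emb (star a) = star (emb a)"
  by (simp add: emb_def unitization_cstar_defs)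

lemma emb_scaleR: "emb (r *\<^sub>R a) = r *\<^sub>R emb a"
  by (simp add: emb_def unitization_cstar_defs)

lemma norm_emb [simp]: "norm (emb a) = norm a"
proof (rule antisym)
  show "norm (emb a) \<le> norm a" using norm_le_parts[of "emb a"] by (simp add: emb_def)
  have "unit_act (emb a) = (\<lambda>b. a * b)" by (simp add: unit_act_def emb_def fun_eq_iff)
  then show "norm a \<le> norm (emb a)" using norm_le_onorm_mult[of a] by (simp add: norm_unitization_def)
qed

lemma of_real_unitization: "of_real r = Unitized (0::'a::cstar_algebra) (complex_of_real r)"
  by (simp add: of_real_def unitization_cstar_defs)

lemma closed_idealD:
  assumes "closed_ideal I"
  shows "closed I" "0 \<in> I" "\<And>x y. x \<in> I \<Longrightarrow> y \<in> I \<Longrightarrow> x + y \<in> I" "\<And>c x. x \<in> I \<Longrightarrow> c *\<^sub>C x \<in> I"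
    "\<And>a x. x \<in> I \<Longrightarrow> a * x \<in> I" "\<And>a x. x \<in> I \<Longrightarrow> x * a \<in> I"
    "\<And>r x. x \<in> I \<Longrightarrow> r *\<^sub>R x \<in> I" "\<And>x. x \<in> I \<Longrightarrow> - x \<in> I" "\<And>x y. x \<in> I \<Longrightarrow> y \<in> I \<Longrightarrow> x - y \<in> I"
proof -
  show 1: "closed I" "0 \<in> I" "\<And>x y. x \<in> I \<Longrightarrow> y \<in> I \<Longrightarrow> x + y \<in> I" "\<And>c x. x \<in> I \<Longrightarrow> c *\<^sub>C x \<in> I"
    "\<And>a x. x \<in> I \<Longrightarrow> a * x \<in> I" "\<And>a x. x \<in> I \<Longrightarrow> x * a \<in> I"
    using assms unfolding closed_ideal_def by blast+
  show 2: "\<And>r x. x \<in> I \<Longrightarrow> r *\<^sub>R x \<in> I" using 1(4) by (metis scaleC_of_real)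
  show 3: "\<And>x. x \<in> I \<Longrightarrow> - x \<in> I" using 1(4) by (metis scaleC_minus_left scaleC_one)
  show "\<And>x y. x \<in> I \<Longrightarrow> y \<in> I \<Longrightarrow> x - y \<in> I" using 1(3) 3 by (metis add_uminus_conv_diff)
qed

text \<open>\<open>s - a\<^sup>*a\<close> is assumed positive modulo the ideal.  For the self-adjoint \<open>k = i / M\<close> the
  elements \<open>e = (1 - k\<^sup>2)\<^sup>n\<close> are of the form \<open>1 - u\<close> with \<open>u\<close> in the ideal and \<open>e i e \<rightarrow> 0\<close>, so
  compressing by \<open>e\<close> yields \<open>\<parallel>a - a u\<parallel>\<^sup>2 \<le> s + o(1)\<close>.\<close>

lemma infdist_ideal_le:
  fixes I :: "'a::cstar_algebra set"
  assumes I: "closed_ideal I" and i: "i \<in> I" "star i = i" and s: "0 \<le> s"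
    and pos: "cpos (of_real s - emb (star a * a) - emb i)"
  shows "(infdist a I)\<^sup>2 \<le> s"
proof (rule field_le_epsilon)
  fix \<epsilon> :: real assume \<epsilon>: "\<epsilon> > 0"
  \<comment> \<open>Makes \<open>k = i / M\<close> a well-defined element of norm at most 1.\<close>
  define M where "M = norm i + 1"
  have M: "M > 0" by (simp add: M_def add_nonneg_pos)
  define k where "k = (1 / M) *\<^sub>R i"
  have kI: "k \<in> I" using I i by (simp add: k_def closed_idealD)
  have sk: "star (emb k) = emb k" using i by (simp add: k_def star_scaleR flip: emb_star)
  have nk: "norm (emb k) \<le> 1" using M by (simp add: k_def M_def)
  \<comment> \<open>Chosen so that \<open>2 * n * (norm (k * e))^2 \<le> 1\<close> yields
    \<open>M * norm (k * e) \<le> \<epsilon>\<close>.\<close>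
  obtain n :: nat where n: "n \<ge> 1" "real n \<ge> M\<^sup>2 / \<epsilon>\<^sup>2"
    by (metis One_nat_def Suc_leI max.cobounded1 max.cobounded2 max_def nat_le_real_less of_nat_1 of_nat_le_iff order_trans real_arch_simple)
  define e where "e = (1 - emb k * emb k) ^ n"
  have se: "star e = e" by (simp add: e_def star_power star_diff star_mult sk)
  have ne: "norm e \<le> 1"
    using norm_power_ineq[of "1 - emb k * emb k" n] norm_one_minus_square[OF sk nk]
    unfolding e_def by (meson norm_ge_zero order_trans power_le_one)
  have nke: "2 * real n * (norm (emb k * e))\<^sup>2 \<le> 1"
    unfolding e_def by (rule norm_mult_one_minus_square_power[OF sk nk])
  define T where "T = e * emb i * e"
  have iMk: "emb i = M *\<^sub>R emb k" using M by (simp add: k_def emb_scaleR)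
  have "norm T \<le> M * norm (emb k * e)"
  proof -
    have "T = M *\<^sub>R (e * (emb k * e))" by (simp add: T_def iMk mult.assoc)
    then have "norm T = M * norm (e * (emb k * e))" using M by simp
    also have "\<dots> \<le> M * (norm e * norm (emb k * e))"
      using M by (intro mult_left_mono norm_mult_ineq) simp
    also have "\<dots> \<le> M * (1 * norm (emb k * e))"
      using M ne by (intro mult_left_mono mult_right_mono) auto
    finally show ?thesis by simp
  qed
  also have "\<dots> \<le> \<epsilon>"
  proof (rule power2_le_imp_le)
    have "(M * norm (emb k * e))\<^sup>2 = M\<^sup>2 * (norm (emb k * e))\<^sup>2" by (simp add: power_mult_distrib)
    also have "\<dots> \<le> (real n * \<epsilon>\<^sup>2) * (norm (emb k * e))\<^sup>2"
      using n(2) \<epsilon> by (intro mult_right_mono) (auto simp: field_simps)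
    also have "\<dots> \<le> \<epsilon>\<^sup>2 * (2 * real n * (norm (emb k * e))\<^sup>2)"
      by (simp add: mult_ac)
    also have "\<dots> \<le> \<epsilon>\<^sup>2" using mult_left_mono[OF nke, of "\<epsilon>\<^sup>2"] by simp
    finally show "(M * norm (emb k * e))\<^sup>2 \<le> \<epsilon>\<^sup>2" .
  qed (use \<epsilon> in simp)
  finally have nT: "norm T \<le> \<epsilon>" .
  have "star T = T" by (simp add: T_def star_mult se mult.assoc i flip: emb_star)
  then have "cpos (of_real \<epsilon> + T)" using nT by (rule cpos_norm_add)
  moreover have "cpos (star e * (of_real s - emb (star a * a) - emb i) * e)"
    by (rule cpos_conj[OF pos])
  \<comment> \<open>Compression replaces the scalar s by \<open>s * e * e\<close>; this positive
    term restores s.\<close>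
  moreover have "cpos (s *\<^sub>R (of_real 1 - e * e))"
  proof (intro cpos_scaleR cpos_norm_diff s)
    show "norm (e * e) \<le> 1" using norm_sq_selfadjoint[OF se] ne by (simp add: power_le_one)
  qed (simp add: star_mult se)
  ultimately have "cpos ((of_real \<epsilon> + T) + star e * (of_real s - emb (star a * a) - emb i) * e
      + s *\<^sub>R (of_real 1 - e * e))"
    by (rule cpos_add[OF cpos_add])
  moreover have "(of_real \<epsilon> + T) + star e * (of_real s - emb (star a * a) - emb i) * e
      + s *\<^sub>R (of_real 1 - e * e) = of_real (s + \<epsilon>) - star (emb a * e) * (emb a * e)"
    by (simp add: T_def se star_mult emb_mult emb_star left_diff_distrib right_diff_distrib mult.assoc)
      (simp add: of_real_def scaleR_diff_right)
  ultimately have "cpos (of_real (s + \<epsilon>) - star (emb a * e) * (emb a * e))" by (simp only:)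
  then have "norm (star (emb a * e) * (emb a * e)) \<le> s + \<epsilon>"
    using s \<epsilon> by (intro norm_le_of_cpos cpos_star_mult_self) simp_all
  then have X: "(norm (emb a * e))\<^sup>2 \<le> s + \<epsilon>" by (simp only: cstar_identity)
  have "\<exists>u\<in>I. (1 - emb k * emb k) ^ m = 1 - emb u" for m
  proof (induction m)
    case 0 then show ?case using closed_idealD(2)[OF I] by force
  next
    case (Suc m)
    then obtain u where u: "u \<in> I" "(1 - emb k * emb k) ^ m = 1 - emb u" by blast
    have "(1 - emb k * emb k) ^ Suc m = 1 - emb (u + k * k - k * k * u)"
      by (simp add: u emb_diff emb_add emb_mult algebra_simps)
    then show ?case using u kI I by (meson closed_idealD(3,5,9))
  qed
  then obtain u where u: "u \<in> I" "e = 1 - emb u" unfolding e_def by blast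
  have "emb a * e = emb (a - a * u)" by (simp add: u emb_diff emb_mult algebra_simps)
  then have "(dist a (a * u))\<^sup>2 \<le> s + \<epsilon>" using X by (simp add: dist_norm)
  moreover have "infdist a I \<le> dist a (a * u)"
    using u I by (intro infdist_le) (simp add: closed_idealD)
  ultimately show "(infdist a I)\<^sup>2 \<le> s + \<epsilon>"
    by (meson infdist_nonneg order_trans power_mono)
qed

section \<open>Extreme functionals below a sublinear functional\<close>

definition sublinear :: "('v::real_vector \<Rightarrow> real) \<Rightarrow> bool" where
  "sublinear p \<longleftrightarrow> (\<forall>x y. p (x + y) \<le> p x + p y) \<and> (\<forall>r x. 0 \<le> r \<longrightarrow> p (r *\<^sub>R x) = r * p x)"

lemma sublinear_zero: "sublinear p \<Longrightarrow> p 0 = 0"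
  unfolding sublinear_def by (metis mult_zero_left order_refl scaleR_zero_left)

lemma sublinear_minus: "sublinear p \<Longrightarrow> - p (- x) \<le> p x"
  using sublinear_zero[of p] unfolding sublinear_def by (metis add.right_inverse diff_ge_0_iff_ge diff_minus_eq_add add.commute)

text \<open>The functionals \<open>q\<close> of this kind describe the faces \<open>{f. f \<le> q}\<close> of the convex set of linear
  functionals below \<open>p\<close>.\<close>

definition facial :: "('v::real_vector \<Rightarrow> real) \<Rightarrow> ('v \<Rightarrow> real) \<Rightarrow> bool" where
  "facial p q \<longleftrightarrow> sublinear q \<and> q \<le> p \<and>
     (\<forall>g h t. linear g \<and> linear h \<and> g \<le> p \<and> h \<le> p \<and> 0 < t \<and> t < 1 \<and>
        (\<lambda>x. t * g x + (1 - t) * h x) \<le> q \<longrightarrow> g \<le> q \<and> h \<le> q)"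

text \<open>Cuts out the functionals below \<open>q\<close> that attain the value \<open>q b\<close> at \<open>b\<close>.\<close>

definition tilt :: "('v::real_vector \<Rightarrow> real) \<Rightarrow> 'v \<Rightarrow> 'v \<Rightarrow> real" where
  "tilt q b y = (INF t\<in>{0..}. q (y + t *\<^sub>R b) - t * q b)"

lemma tilt_bdd:
  assumes "sublinear q"
  shows "bdd_below ((\<lambda>t. q (y + t *\<^sub>R b) - t * q b) ` {0..})"
proof (rule bdd_belowI2)
  fix t :: real assume t: "t \<in> {0..}"
  have "t * q b = q ((y + t *\<^sub>R b) + - y)" using assms t by (simp add: sublinear_def)
  also have "\<dots> \<le> q (y + t *\<^sub>R b) + q (- y)" using assms by (metis sublinear_def)
  finally show "- q (- y) \<le> q (y + t *\<^sub>R b) - t * q b" by simp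
qed

lemma tilt_le:
  assumes "sublinear q" "0 \<le> t" shows "tilt q b y \<le> q (y + t *\<^sub>R b) - t * q b"
  unfolding tilt_def using assms by (intro cINF_lower tilt_bdd) auto

lemma tilt_le_self: "sublinear q \<Longrightarrow> tilt q b \<le> q"
  using tilt_le[of q 0] by (simp add: le_fun_def)

text \<open>The choice t = 1. For a linear f below the tilt it says \<open>f b \<ge> q b\<close>, so
  f attains the largest possible value at b.\<close>

lemma tilt_minus: "sublinear q \<Longrightarrow> tilt q b (- b) \<le> - q b"
  using tilt_le[of q 1 b "- b"] sublinear_zero[of q] by simp

lemma le_tilt: "(\<And>t. 0 \<le> t \<Longrightarrow> m \<le> q (y + t *\<^sub>R b) - t * q b) \<Longrightarrow> m \<le> tilt q b y"
  unfolding tilt_def by (intro cINF_greatest) auto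

lemma sublinear_tilt:
  assumes q: "sublinear q" shows "sublinear (tilt q b)"
proof -
  have add: "tilt q b (x + y) \<le> tilt q b x + tilt q b y" for x y
  proof -
    have "tilt q b (x + y) - tilt q b x \<le> tilt q b y"
    proof (rule le_tilt)
      fix t :: real assume t: "0 \<le> t"
      have "tilt q b (x + y) - (q (y + t *\<^sub>R b) - t * q b) \<le> tilt q b x"
      proof (rule le_tilt)
        fix r :: real assume r: "0 \<le> r"
        have "tilt q b (x + y) \<le> q (x + y + (r + t) *\<^sub>R b) - (r + t) * q b"
          using q r t by (intro tilt_le) auto
        also have "x + y + (r + t) *\<^sub>R b = (x + r *\<^sub>R b) + (y + t *\<^sub>R b)"
          by (simp add: algebra_simps)
        also have "q \<dots> \<le> q (x + r *\<^sub>R b) + q (y + t *\<^sub>R b)" using q by (simp add: sublinear_def)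
        finally show "tilt q b (x + y) - (q (y + t *\<^sub>R b) - t * q b) \<le> q (x + r *\<^sub>R b) - r * q b"
          by (simp add: algebra_simps)
      qed
      then show "tilt q b (x + y) - tilt q b x \<le> q (y + t *\<^sub>R b) - t * q b" by simp
    qed
    then show ?thesis by simp
  qed
  have t0: "tilt q b 0 = 0"
  proof (rule antisym)
    show "tilt q b 0 \<le> 0" using tilt_le[OF q, of 0 b 0] sublinear_zero[OF q] by simp
    show "0 \<le> tilt q b 0" using q by (intro le_tilt) (simp add: sublinear_def)
  qed
  have le: "tilt q b (r *\<^sub>R x) \<le> r * tilt q b x" if r: "0 < r" for r x
  proof -
    have "tilt q b (r *\<^sub>R x) / r \<le> tilt q b x"
    proof (rule le_tilt)
      fix t :: real assume t: "0 \<le> t"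
      have "tilt q b (r *\<^sub>R x) \<le> q (r *\<^sub>R x + (r * t) *\<^sub>R b) - (r * t) * q b"
        using q r t by (intro tilt_le) auto
      also have "r *\<^sub>R x + (r * t) *\<^sub>R b = r *\<^sub>R (x + t *\<^sub>R b)" by (simp add: scaleR_add_right)
      also have "q \<dots> = r * q (x + t *\<^sub>R b)" using q r by (simp add: sublinear_def)
      finally show "tilt q b (r *\<^sub>R x) / r \<le> q (x + t *\<^sub>R b) - t * q b"
        using r by (simp add: field_simps)
    qed
    then show ?thesis using r by (simp add: field_simps)
  qed
  have "tilt q b (r *\<^sub>R x) = r * tilt q b x" if r: "0 < r" for r x
  proof -
    have "tilt q b (inverse r *\<^sub>R (r *\<^sub>R x)) \<le> inverse r * tilt q b (r *\<^sub>R x)"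
      using r by (intro le) simp
    then have "r * tilt q b x \<le> tilt q b (r *\<^sub>R x)" using r by (simp add: field_simps)
    then show ?thesis using le[OF r, of x] by simp
  qed
  then have "tilt q b (r *\<^sub>R x) = r * tilt q b x" if "0 \<le> r" for r x
    using that t0 by (cases "r = 0") auto
  then show ?thesis using add by (simp add: sublinear_def)
qed

text \<open>A proper convex combination attains the maximum \<open>q b\<close> at b only if both of
  its parts do.\<close>

lemma facial_tilt:
  assumes "facial p q" shows "facial p (tilt q b)"
proof -
  have q: "sublinear q" "q \<le> p" using assms by (auto simp: facial_def)
  have "g \<le> tilt q b \<and> h \<le> tilt q b"
    if gh: "linear g" "linear h" "g \<le> p" "h \<le> p" "0 < t" "t < 1"
      and le: "(\<lambda>x. t * g x + (1 - t) * h x) \<le> tilt q b" for g h t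
  proof -
    have "(\<lambda>x. t * g x + (1 - t) * h x) \<le> q" using le tilt_le_self[OF q(1)] by (rule order_trans)
    then have gq: "g \<le> q" "h \<le> q" using assms gh unfolding facial_def by blast+
    have "t * g (- b) + (1 - t) * h (- b) \<le> - q b"
      using le tilt_minus[OF q(1), of b] by (meson le_funE order_trans)
    then have ge: "q b \<le> t * g b + (1 - t) * h b" using gh by (simp add: linear_neg)
    have gb: "g b \<le> q b" "h b \<le> q b" using gq by (auto simp: le_fun_def)
    have "t * g b \<le> t * q b" "(1 - t) * h b \<le> (1 - t) * q b" using gb gh by (auto intro: mult_left_mono)
    then have "t * q b \<le> t * g b" "(1 - t) * q b \<le> (1 - t) * h b" using ge by (auto simp: algebra_simps)
    then have eq: "g b = q b" "h b = q b" using gb gh by auto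
    have "f \<le> tilt q b" if f: "linear f" "f \<le> q" "f b = q b" for f
    proof (rule le_funI, rule le_tilt)
      fix y and r :: real
      have "f (y + r *\<^sub>R b) \<le> q (y + r *\<^sub>R b)" using f by (simp add: le_fun_def)
      then show "f y \<le> q (y + r *\<^sub>R b) - r * q b"
        using f by (simp add: linear_add linear_scale)
    qed
    then show ?thesis using gh gq eq by blast
  qed
  then show ?thesis unfolding facial_def
    using sublinear_tilt[OF q(1)] order_trans[OF tilt_le_self[OF q(1)] q(2)] by blast
qed

text \<open>The values \<open>- p (- x)\<close> bound the chain from below. Subadditivity of the
  infimum uses comparability: for two members of the chain the smaller one serves both
  arguments.\<close>

lemma facial_chain_INF:
  assumes C: "\<And>q. q \<in> C \<Longrightarrow> facial p q" and ne: "C \<noteq> {}"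
    and chain: "\<And>q r. q \<in> C \<Longrightarrow> r \<in> C \<Longrightarrow> q \<le> r \<or> r \<le> q"
  shows "facial p (\<lambda>x. INF q\<in>C. q x)" "\<And>q. q \<in> C \<Longrightarrow> (\<lambda>x. INF q\<in>C. q x) \<le> q"
proof -
  define u where "u = (\<lambda>x. INF q\<in>C. q x)"
  have sub: "sublinear q" "q \<le> p" if "q \<in> C" for q using C[OF that] by (auto simp: facial_def)
  have bdd: "bdd_below ((\<lambda>q. q x) ` C)" for x
  proof (rule bdd_belowI2)
    fix q assume q: "q \<in> C"
    show "- p (- x) \<le> q x"
      using sublinear_minus[OF sub(1)[OF q], of x] sub(2)[OF q] by (smt (verit) le_funE)
  qed
  have uq: "u x \<le> q x" if "q \<in> C" for q x
    unfolding u_def using that bdd by (intro cINF_lower) auto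
  have qu: "m \<le> u x" if "\<And>q. q \<in> C \<Longrightarrow> m \<le> q x" for m x
    unfolding u_def using that ne by (intro cINF_greatest) auto
  show "(\<lambda>x. INF q\<in>C. q x) \<le> q" if "q \<in> C" for q
    using uq[OF that] by (simp add: u_def le_fun_def)
  have "u (x + y) \<le> u x + u y" for x y
  proof -
    have "u (x + y) - u x \<le> u y"
    proof (rule qu)
      fix q assume q: "q \<in> C"
      have "u (x + y) - q y \<le> u x"
      proof (rule qu)
        fix r assume r: "r \<in> C"
        define m where "m = (if q \<le> r then q else r)"
        have m: "m \<in> C" "m \<le> q" "m \<le> r" using q r chain[OF q r] by (auto simp: m_def)
        have "u (x + y) \<le> m x + m y"
          using uq[OF m(1), of "x + y"] sub(1)[OF m(1)] by (meson order_trans sublinear_def)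
        also have "\<dots> \<le> r x + q y" using m by (intro add_mono) (auto simp: le_fun_def)
        finally show "u (x + y) - q y \<le> r x" by simp
      qed
      then show "u (x + y) - u x \<le> q y" by simp
    qed
    then show ?thesis by simp
  qed
  moreover have "u (r *\<^sub>R x) = r * u x" if r: "0 \<le> r" for r x
  proof (cases "r = 0")
    case True
    have "u 0 = (INF q\<in>C. 0)" unfolding u_def using sub(1) sublinear_zero by (intro INF_cong) auto
    then have "u 0 = 0" using ne by simp
    then show ?thesis using True by simp
  next
    case False
    have le: "u (r *\<^sub>R x) \<le> r * u x" if r: "0 < r" for r x
    proof -
      have "u (r *\<^sub>R x) / r \<le> u x"
      proof (rule qu)
        fix q assume q: "q \<in> C"
        have "u (r *\<^sub>R x) \<le> r * q x"
          using uq[OF q, of "r *\<^sub>R x"] sub(1)[OF q] r by (simp add: sublinear_def)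
        then show "u (r *\<^sub>R x) / r \<le> q x" using r by (simp add: field_simps)
      qed
      then show ?thesis using r by (simp add: field_simps)
    qed
    have "u (inverse r *\<^sub>R (r *\<^sub>R x)) \<le> inverse r * u (r *\<^sub>R x)" using r False by (intro le) simp
    then have "r * u x \<le> u (r *\<^sub>R x)" using r False by (simp add: field_simps)
    then show ?thesis using le[of r x] r False by simp
  qed
  moreover have uq': "u \<le> q" if "q \<in> C" for q using uq[OF that] by (rule le_funI)
  moreover have "u \<le> p" using ne uq' sub(2) by (auto intro: order_trans)
  moreover have "g \<le> u \<and> h \<le> u"
    if gh: "linear g" "linear h" "g \<le> p" "h \<le> p" "0 < t" "t < 1"
      and le: "(\<lambda>x. t * g x + (1 - t) * h x) \<le> u" for g h t
  proof -
    have "g \<le> q \<and> h \<le> q" if q: "q \<in> C" for q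
    proof -
      have "(\<lambda>x. t * g x + (1 - t) * h x) \<le> q"
        using le uq'[OF q] by (rule order_trans)
      then show ?thesis using C[OF q] gh unfolding facial_def by blast
    qed
    then show ?thesis by (auto simp: le_fun_def intro: qu)
  qed
  ultimately have "facial p u" unfolding facial_def sublinear_def by blast
  then show "facial p (\<lambda>x. INF q\<in>C. q x)" by (simp only: u_def)
qed

text \<open>Hahn-Banach and Krein-Milman in one application of Zorn's lemma. A minimal facial
  functional is unchanged by every tilt, which makes it odd and hence linear: a minimal face is a
  single point. Starting below \<open>tilt p b\<close> fixes the value at b.\<close>

theorem extreme_functional_exists:
  fixes p :: "'v::real_vector \<Rightarrow> real"
  assumes p: "sublinear p"
  shows "\<exists>f. linear f \<and> f \<le> p \<and> f b = p b \<and>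
    (\<forall>g h t. linear g \<and> linear h \<and> g \<le> p \<and> h \<le> p \<and> 0 < t \<and> t < 1 \<and>
       f = (\<lambda>x. t * g x + (1 - t) * h x) \<longrightarrow> g = f \<and> h = f)"
proof -
  define A where "A = {q. facial p q \<and> q \<le> tilt p b}"
  \<comment> \<open>The order is reversed, so a maximal element for R is a pointwise minimal
    functional.\<close>
  define R where "R = relation_of (\<lambda>q r. r \<le> q) A"
  have "partial_order_on A R"
    unfolding R_def by (rule partial_order_on_relation_ofI) auto
  moreover have "\<exists>u\<in>A. \<forall>q\<in>C. u \<le> q" if C: "C \<in> Chains R" for C
  proof (cases "C = {}")
    case True
    have "facial p p" using p by (auto simp: facial_def)
    then have "tilt p b \<in> A" by (simp add: A_def facial_tilt)
    then show ?thesis using True by blast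
  next
    case False
    have CA: "C \<subseteq> A" using C False Chains_relation_of unfolding R_def by blast
    have ch: "q \<le> r \<or> r \<le> q" if "q \<in> C" "r \<in> C" for q r
      using C that unfolding Chains_def R_def relation_of_def by auto
    have f: "facial p (\<lambda>x. INF q\<in>C. q x)"
      using CA ch False by (intro facial_chain_INF(1)) (auto simp: A_def)
    have l: "(\<lambda>x. INF q\<in>C. q x) \<le> q" if "q \<in> C" for q
      using CA ch False that by (intro facial_chain_INF(2)[of C p]) (auto simp: A_def)
    obtain q0 where "q0 \<in> C" using False by blast
    then have "(\<lambda>x. INF q\<in>C. q x) \<le> tilt p b" using l CA unfolding A_def by (blast intro: order_trans)
    then show ?thesis using f l unfolding A_def by blast
  qed
  ultimately obtain f where f: "f \<in> A" "\<And>q. q \<in> A \<Longrightarrow> q \<le> f \<Longrightarrow> q = f"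
    unfolding R_def using predicate_Zorn[of A "\<lambda>q r. r \<le> q"] by metis
  have fac: "facial p f" "f \<le> tilt p b" using f(1) by (auto simp: A_def)
  have sub: "sublinear f" "f \<le> p" using fac by (auto simp: facial_def)
  have neg: "f (- x) = - f x" for x
  proof -
    have "tilt f x = f"
      using f(2)[of "tilt f x"] facial_tilt[OF fac(1)] tilt_le_self[OF sub(1), of x] fac(2)
      unfolding A_def by auto
    then have "f (- x) \<le> - f x" using tilt_minus[OF sub(1), of x] by simp
    then show ?thesis using sublinear_minus[OF sub(1), of x] by simp
  qed
  have lin: "linear f"
  proof (rule linearI)
    fix x y
    have "f (- x + - y) \<le> f (- x) + f (- y)" using sub(1) unfolding sublinear_def by blast
    then have "- f (x + y) \<le> - f x + - f y" using neg[of "x + y"] neg[of x] neg[of y] by simp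
    then show "f (x + y) = f x + f y" using sub(1) by (simp add: sublinear_def antisym)
  next
    fix r x
    show "f (r *\<^sub>R x) = r *\<^sub>R f x"
    proof (cases "0 \<le> r")
      case False
      then have "f ((- r) *\<^sub>R x) = (- r) * f x"
        by (intro sub(1)[unfolded sublinear_def, THEN conjunct2, rule_format]) simp
      then show ?thesis using neg[of "r *\<^sub>R x"] by simp
    qed (use sub(1) in \<open>simp add: sublinear_def\<close>)
  qed
  have "f (- b) \<le> - p b" using fac(2) tilt_minus[OF p, of b] by (meson le_funE order_trans)
  then have fb: "f b = p b" using neg[of b] sub(2) by (simp add: le_fun_def antisym)
  have ext: "g = f" if "linear g" "g \<le> f" for g
  proof
    fix x
    have "g (- x) \<le> f (- x)" "g x \<le> f x" using that(2) by (auto simp: le_fun_def)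
    then show "g x = f x" using neg[of x] that(1) by (simp add: linear_neg)
  qed
  have "g = f \<and> h = f"
    if "linear g" "linear h" "g \<le> p" "h \<le> p" "0 < t" "t < 1" "f = (\<lambda>x. t * g x + (1 - t) * h x)" for g h t
  proof -
    have "g \<le> f \<and> h \<le> f" using fac(1) that unfolding facial_def by (metis order_refl)
    then show ?thesis using ext that by blast
  qed
  then show ?thesis using lin sub(2) fb by blast
qed

section \<open>Geometry of Hilbert spaces\<close>

text \<open>Shared by both Cauchy-Schwarz inequalities and by the first variation argument for
  nearest points. The case of vanishing \<gamma> matters because seminorms have null
  vectors.\<close>

lemma discriminant_complex:
  fixes \<beta> :: complex and \<alpha> \<gamma> :: real
  assumes "\<And>c. 0 \<le> \<alpha> + 2 * Re (c * \<beta>) + (cmod c)\<^sup>2 * \<gamma>" "0 \<le> \<gamma>"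
  shows "(cmod \<beta>)\<^sup>2 \<le> \<alpha> * \<gamma>"
proof (cases "\<gamma> = 0")
  case True
  show ?thesis
  proof (cases "\<beta> = 0")
    case False
    \<comment> \<open>With this c the supposedly nonnegative expression equals -1.\<close>
    define c where "c = of_real (- (\<alpha> + 1) / (2 * (cmod \<beta>)\<^sup>2)) * cnj \<beta>"
    have "c * \<beta> = of_real (- (\<alpha> + 1) / (2 * (cmod \<beta>)\<^sup>2)) * of_real ((cmod \<beta>)\<^sup>2)"
      by (simp only: c_def complex_norm_square[symmetric] mult.assoc mult.commute[of "cnj \<beta>"])
    then have "Re (c * \<beta>) = - (\<alpha> + 1) / (2 * (cmod \<beta>)\<^sup>2) * (cmod \<beta>)\<^sup>2"
      by (metis Re_complex_of_real of_real_mult)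
    also have "\<dots> = - (\<alpha> + 1) / 2" using False by simp
    finally show ?thesis using assms(1)[of c] True by simp
  qed (use True in simp)
next
  case False
  \<comment> \<open>The minimizer of the quadratic expression.\<close>
  define c where "c = of_real (- 1 / \<gamma>) * cnj \<beta>"
  have "c * \<beta> = of_real (- 1 / \<gamma>) * of_real ((cmod \<beta>)\<^sup>2)"
    by (simp only: c_def complex_norm_square[symmetric] mult.assoc mult.commute[of "cnj \<beta>"])
  then have "Re (c * \<beta>) = - 1 / \<gamma> * (cmod \<beta>)\<^sup>2"
    by (metis Re_complex_of_real of_real_mult)
  moreover have "(cmod c)\<^sup>2 = (cmod \<beta>)\<^sup>2 / \<gamma>\<^sup>2"
    by (simp add: c_def norm_mult norm_divide power_divide)
  ultimately have "0 \<le> \<alpha> - (cmod \<beta>)\<^sup>2 / \<gamma>"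
    using assms(1)[of c] False by (simp add: power2_eq_square)
  then show ?thesis using False assms(2) by (simp add: field_simps)
qed

context hilbert_space
begin

lemma diff_closed: "x \<in> hcarrier H \<Longrightarrow> y \<in> hcarrier H \<Longrightarrow> hdiff H x y \<in> hcarrier H"
  by (simp add: hdiff_def add_closed scale_closed)

lemmas closed = zero_closed add_closed scale_closed diff_closed

lemma inner_diff_right: "x \<in> hcarrier H \<Longrightarrow> y \<in> hcarrier H \<Longrightarrow> z \<in> hcarrier H \<Longrightarrow>
    hinner H x (hdiff H y z) = hinner H x y - hinner H x z"
  by (simp add: hdiff_def closed inner_add_right inner_scale_right)

lemma inner_zero_right: "x \<in> hcarrier H \<Longrightarrow> hinner H x (hzero H) = 0"
  using inner_diff_right[of x "hzero H" "hzero H"] by (simp add: diff_self closed)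

lemma inner_add_left: "x \<in> hcarrier H \<Longrightarrow> y \<in> hcarrier H \<Longrightarrow> z \<in> hcarrier H \<Longrightarrow>
    hinner H (hadd H y z) x = hinner H y x + hinner H z x"
  by (metis add_closed inner_commute inner_add_right complex_cnj_add)

lemma inner_scale_left: "x \<in> hcarrier H \<Longrightarrow> y \<in> hcarrier H \<Longrightarrow>
    hinner H (hscale H c y) x = cnj c * hinner H y x"
  by (metis scale_closed inner_commute inner_scale_right complex_cnj_mult)

lemma inner_diff_left: "x \<in> hcarrier H \<Longrightarrow> y \<in> hcarrier H \<Longrightarrow> z \<in> hcarrier H \<Longrightarrow>
    hinner H (hdiff H y z) x = hinner H y x - hinner H z x"
  by (metis diff_closed inner_commute inner_diff_right complex_cnj_diff)

lemma inner_zero_left: "x \<in> hcarrier H \<Longrightarrow> hinner H (hzero H) x = 0"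
  by (metis zero_closed inner_commute inner_zero_right complex_cnj_zero)

lemmas inner_simps = inner_add_right inner_scale_right inner_diff_right inner_zero_right
  inner_add_left inner_scale_left inner_diff_left inner_zero_left

lemma inner_self: "x \<in> hcarrier H \<Longrightarrow> hinner H x x = of_real ((hnorm H x)\<^sup>2)"
  using inner_nonneg[of x] by (auto simp: hnorm_def nonneg_Reals_def simp flip: of_real_power)

lemma hnorm_sq: "x \<in> hcarrier H \<Longrightarrow> (hnorm H x)\<^sup>2 = Re (hinner H x x)"
  using inner_self[of x] by simp

lemma hnorm_nonneg: "x \<in> hcarrier H \<Longrightarrow> 0 \<le> hnorm H x"
  using inner_nonneg[of x] by (auto simp: hnorm_def nonneg_Reals_def)

lemma hnorm_eq_zero: "x \<in> hcarrier H \<Longrightarrow> hnorm H x = 0 \<longleftrightarrow> x = hzero H"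
  using inner_self[of x] inner_definite[of x] inner_zero_right[of "hzero H"] zero_closed
  by (auto simp: hnorm_def)

lemma eq_if_diff_zero:
  assumes "x \<in> hcarrier H" "y \<in> hcarrier H" "hdiff H x y = hzero H" shows "x = y"
proof -
  have "hadd H (hscale H (- 1) y) y = hzero H"
    using assms diff_self[of y] by (simp add: hdiff_def closed add_commute)
  then have "hadd H (hadd H x (hscale H (- 1) y)) y = x"
    using assms(1,2) by (simp add: add_assoc closed add_zero)
  then have "hadd H (hzero H) y = x" using assms(3) by (simp add: hdiff_def)
  then show ?thesis using assms by (metis add_commute add_zero zero_closed)
qed

text \<open>Vector identities in the explicit carrier are verified through this test, since the
  inner product expands sums, differences and multiples.\<close>

lemma inner_eqI:
  assumes "x \<in> hcarrier H" "y \<in> hcarrier H" "\<And>z. z \<in> hcarrier H \<Longrightarrow> hinner H z x = hinner H z y"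
  shows "x = y"
proof (rule eq_if_diff_zero)
  show "hdiff H x y = hzero H"
    using assms by (intro inner_definite) (simp_all add: closed inner_simps)
qed (use assms in auto)

lemma cauchy_schwarz:
  assumes "x \<in> hcarrier H" "y \<in> hcarrier H"
  shows "cmod (hinner H x y) \<le> hnorm H x * hnorm H y"
proof -
  have "(cmod (hinner H x y))\<^sup>2 \<le> (hnorm H x)\<^sup>2 * (hnorm H y)\<^sup>2"
  proof (rule discriminant_complex)
    fix c
    have c: "c * cnj c = of_real ((cmod c)\<^sup>2)" by (metis complex_norm_square of_real_power)
    have "hinner H (hadd H x (hscale H c y)) (hadd H x (hscale H c y)) =
        of_real ((hnorm H x)\<^sup>2) + (c * hinner H x y + cnj (c * hinner H x y)) + of_real ((cmod c)\<^sup>2 * (hnorm H y)\<^sup>2)"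
      using assms inner_self[OF assms(1)] inner_self[OF assms(2)] inner_commute[OF assms] c
      by (simp add: inner_simps closed algebra_simps)
    moreover have "0 \<le> Re (hinner H (hadd H x (hscale H c y)) (hadd H x (hscale H c y)))"
      using assms by (simp add: closed flip: hnorm_sq)
    ultimately show "0 \<le> (hnorm H x)\<^sup>2 + 2 * Re (c * hinner H x y) + (cmod c)\<^sup>2 * (hnorm H y)\<^sup>2"
      by simp
  qed simp
  then show ?thesis
    using assms by (metis hnorm_nonneg mult_nonneg_nonneg power2_le_imp_le power_mult_distrib)
qed

lemma hnorm_add_sq:
  assumes "x \<in> hcarrier H" "y \<in> hcarrier H"
  shows "(hnorm H (hadd H x y))\<^sup>2 = (hnorm H x)\<^sup>2 + 2 * Re (hinner H x y) + (hnorm H y)\<^sup>2"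
  using assms inner_commute[OF assms] by (simp add: hnorm_sq closed inner_simps)

lemma hnorm_diff_sq:
  assumes "x \<in> hcarrier H" "y \<in> hcarrier H"
  shows "(hnorm H (hdiff H x y))\<^sup>2 = (hnorm H x)\<^sup>2 - 2 * Re (hinner H x y) + (hnorm H y)\<^sup>2"
  using assms inner_commute[OF assms] by (simp add: hnorm_sq closed inner_simps)

lemma hnorm_scale: "x \<in> hcarrier H \<Longrightarrow> hnorm H (hscale H c x) = cmod c * hnorm H x"
proof (rule power2_eq_imp_eq)
  assume x: "x \<in> hcarrier H"
  have "hinner H (hscale H c x) (hscale H c x) = of_real ((cmod c)\<^sup>2 * (hnorm H x)\<^sup>2)"
    using x inner_self[OF x] complex_norm_square[of c] by (simp add: inner_simps closed mult.assoc)
  then show "(hnorm H (hscale H c x))\<^sup>2 = (cmod c * hnorm H x)\<^sup>2"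
    using x by (simp add: hnorm_sq[of "hscale H c x"] closed power_mult_distrib)
qed (auto simp: hnorm_nonneg closed)

lemma hnorm_triangle:
  assumes "x \<in> hcarrier H" "y \<in> hcarrier H"
  shows "hnorm H (hadd H x y) \<le> hnorm H x + hnorm H y"
proof (rule power2_le_imp_le)
  have "Re (hinner H x y) \<le> hnorm H x * hnorm H y"
    using cauchy_schwarz[OF assms] complex_Re_le_cmod order_trans by blast
  then show "(hnorm H (hadd H x y))\<^sup>2 \<le> (hnorm H x + hnorm H y)\<^sup>2"
    using assms by (simp add: hnorm_add_sq power2_sum)
qed (use assms in \<open>simp add: hnorm_nonneg\<close>)

lemma hnorm_diff_triangle:
  assumes "x \<in> hcarrier H" "y \<in> hcarrier H" "z \<in> hcarrier H"
  shows "hnorm H (hdiff H x z) \<le> hnorm H (hdiff H x y) + hnorm H (hdiff H y z)"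
proof -
  have "hdiff H x z = hadd H (hdiff H x y) (hdiff H y z)"
    using assms by (intro inner_eqI) (simp_all add: closed inner_simps)
  then show ?thesis using assms by (simp add: hnorm_triangle closed)
qed

lemma hnorm_diff_commute:
  assumes "x \<in> hcarrier H" "y \<in> hcarrier H"
  shows "hnorm H (hdiff H x y) = hnorm H (hdiff H y x)"
proof (rule power2_eq_imp_eq)
  show "(hnorm H (hdiff H x y))\<^sup>2 = (hnorm H (hdiff H y x))\<^sup>2"
    using assms inner_commute[OF assms] by (simp add: hnorm_diff_sq)
qed (use assms in \<open>auto simp: hnorm_nonneg closed\<close>)

text \<open>A minimizing sequence for the distance from x to K is Cauchy by the parallelogram
  identity; perturbing its limit inside K shows that the remainder is orthogonal to K.\<close>

lemma orthogonal_decomposition: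
  assumes K: "closed_hsubspace H K" and x: "x \<in> hcarrier H"
  shows "\<exists>y\<in>K. \<forall>k\<in>K. hinner H k (hdiff H x y) = 0"
proof -
  have KH: "k \<in> hcarrier H" if "k \<in> K" for k using K that by (auto simp: closed_hsubspace_def)
  define d where "d = (INF k\<in>K. (hnorm H (hdiff H x k))\<^sup>2)"
  have bdd: "bdd_below ((\<lambda>k. (hnorm H (hdiff H x k))\<^sup>2) ` K)" by (rule bdd_belowI2[of _ 0]) simp
  have K0: "hzero H \<in> K" using K by (simp add: closed_hsubspace_def)
  have d_le: "d \<le> (hnorm H (hdiff H x k))\<^sup>2" if "k \<in> K" for k
    unfolding d_def using bdd that by (rule cINF_lower)
  have "\<exists>k\<in>K. (hnorm H (hdiff H x k))\<^sup>2 < d + 1 / Suc n" for n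
    using cINF_less_iff[OF _ bdd, of "d + 1 / Suc n"] K0 unfolding d_def by auto
  then obtain s where s: "\<And>n. s n \<in> K" "\<And>n. (hnorm H (hdiff H x (s n)))\<^sup>2 < d + 1 / Suc n" by metis
  have sH: "s n \<in> hcarrier H" for n using s KH by blast
  have par: "(hnorm H (hdiff H (s m) (s n)))\<^sup>2 \<le> 2 / Suc m + 2 / Suc n" for m n
  proof -
    \<comment> \<open>The midpoint lies in K, so its distance to x cannot fall below the infimum
      d.\<close>
    define k where "k = hscale H (1/2) (hadd H (s m) (s n))"
    have "k \<in> K" using K s by (auto simp: k_def closed_hsubspace_def)
    have "hinner H (s n) (s m) = cnj (hinner H (s m) (s n))" "hinner H (s n) x = cnj (hinner H x (s n))"
      "hinner H (s m) x = cnj (hinner H x (s m))" by (blast intro: inner_commute sH x)+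
    then have "(hnorm H (hdiff H (s m) (s n)))\<^sup>2 =
        2 * (hnorm H (hdiff H x (s m)))\<^sup>2 + 2 * (hnorm H (hdiff H x (s n)))\<^sup>2 - 4 * (hnorm H (hdiff H x k))\<^sup>2"
      using x sH by (simp add: k_def hnorm_sq closed inner_simps) (simp add: field_simps)
    then show ?thesis using d_le[OF \<open>k \<in> K\<close>] s(2)[of m] s(2)[of n] by simp
  qed
  have "\<exists>y\<in>hcarrier H. (\<lambda>n. hnorm H (hdiff H (s n) y)) \<longlonglongrightarrow> 0"
  proof (rule complete[OF sH], intro allI impI)
    fix e :: real assume e: "e > 0"
    obtain N :: nat where N: "4 / e\<^sup>2 < real N" using reals_Archimedean2 by blast
    have "hnorm H (hdiff H (s m) (s n)) < e" if "m \<ge> N" "n \<ge> N" for m n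
    proof (rule power2_less_imp_less)
      have "2 / Suc m + 2 / Suc n \<le> 2 / Suc N + 2 / Suc N"
        using that by (intro add_mono divide_left_mono) auto
      also have "\<dots> < e\<^sup>2"
      proof -
        have "4 < e\<^sup>2 * real N" using N e by (simp add: field_simps)
        also have "\<dots> \<le> e\<^sup>2 * real (Suc N)" by (intro mult_left_mono) auto
        finally have "4 / real (Suc N) < e\<^sup>2" by (subst pos_divide_less_eq) auto
        then show ?thesis by simp
      qed
      finally show "(hnorm H (hdiff H (s m) (s n)))\<^sup>2 < e\<^sup>2" using par[of m n] by linarith
    qed (use e in simp)
    then show "\<exists>N. \<forall>m\<ge>N. \<forall>n\<ge>N. hnorm H (hdiff H (s m) (s n)) < e" by blast
  qed
  then obtain y where y: "y \<in> hcarrier H" "(\<lambda>n. hnorm H (hdiff H (s n) y)) \<longlonglongrightarrow> 0" by blast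
  have yK: "y \<in> K" using K s(1) y unfolding closed_hsubspace_def by blast
  define v where "v = hdiff H x y"
  have v: "v \<in> hcarrier H" using x y by (simp add: v_def closed)
  have d0: "0 \<le> d" unfolding d_def using K0 by (intro cINF_greatest) auto
  have "hnorm H v \<le> sqrt d"
  proof (rule LIMSEQ_le_const)
    have l: "(\<lambda>n. sqrt (d + 1 / Suc n) + hnorm H (hdiff H (s n) y)) \<longlonglongrightarrow> sqrt (d + 0) + 0"
      using LIMSEQ_inverse_real_of_nat by (intro tendsto_intros y(2)) (simp add: inverse_eq_divide)
    show "(\<lambda>n. sqrt (d + 1 / Suc n) + hnorm H (hdiff H (s n) y)) \<longlonglongrightarrow> sqrt d"
      using l by simp
    have "hnorm H v \<le> sqrt (d + 1 / Suc n) + hnorm H (hdiff H (s n) y)" for n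
    proof -
      have "hnorm H (hdiff H x (s n)) \<le> sqrt (d + 1 / Suc n)"
        using s(2)[of n] by (intro real_le_rsqrt) simp
      then show ?thesis using hnorm_diff_triangle[OF x sH y(1), of n] by (simp add: v_def)
    qed
    then show "\<exists>N. \<forall>n\<ge>N. hnorm H v \<le> sqrt (d + 1 / Suc n) + hnorm H (hdiff H (s n) y)" by blast
  qed
  then have vd: "(hnorm H v)\<^sup>2 \<le> d" using d0 v by (metis hnorm_nonneg real_sqrt_pow2 power_mono)
  have "hinner H k v = 0" if k: "k \<in> K" for k
  proof -
    \<comment> \<open>Minimality makes a quadratic expression with constant term 0 nonnegative, so
      its linear coefficient vanishes.\<close>
    have "(cmod (cnj (hinner H k v)))\<^sup>2 \<le> 0 * (hnorm H k)\<^sup>2"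
    proof (rule discriminant_complex)
      fix c
      define w where "w = hscale H (- c) k"
      have w: "w \<in> K" using K k by (simp add: w_def closed_hsubspace_def)
      then have yw: "hadd H y w \<in> K" using K yK by (simp add: closed_hsubspace_def)
      have "hdiff H x (hadd H y w) = hdiff H v w"
        using x y KH w by (intro inner_eqI) (simp_all add: v_def closed inner_simps)
      then have "(hnorm H v)\<^sup>2 \<le> (hnorm H (hdiff H v w))\<^sup>2" using vd d_le[OF yw] by simp
      also have "\<dots> = (hnorm H v)\<^sup>2 - 2 * Re (hinner H v w) + (hnorm H w)\<^sup>2"
        using v KH w by (simp add: hnorm_diff_sq)
      also have "hinner H v w = - (c * cnj (hinner H k v))"
        using v KH k inner_commute[of k v] by (simp add: w_def inner_simps)
      also have "hnorm H w = cmod c * hnorm H k" using KH k by (simp add: w_def hnorm_scale)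
      finally show "0 \<le> 0 + 2 * Re (c * cnj (hinner H k v)) + (cmod c)\<^sup>2 * (hnorm H k)\<^sup>2"
        by (simp add: power_mult_distrib)
    qed simp
    then show ?thesis by simp
  qed
  then show ?thesis using yK by (auto simp: v_def)
qed

text \<open>The part v, orthogonal to the kernel, of a vector outside the kernel represents the
  functional up to a scalar. The constant 1 in \<open>bound\<close> passes to the representing
  vector and later keeps the cyclic vector in the unit ball.\<close>

lemma riesz_representation:
  assumes add: "\<And>v w. v \<in> hcarrier H \<Longrightarrow> w \<in> hcarrier H \<Longrightarrow> \<Lambda> (hadd H v w) = \<Lambda> v + \<Lambda> w"
    and scale: "\<And>c v. v \<in> hcarrier H \<Longrightarrow> \<Lambda> (hscale H c v) = c * \<Lambda> v"
    and bound: "\<And>v. v \<in> hcarrier H \<Longrightarrow> cmod (\<Lambda> v) \<le> hnorm H v"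
  shows "\<exists>\<xi>\<in>hcarrier H. hnorm H \<xi> \<le> 1 \<and> (\<forall>v\<in>hcarrier H. \<Lambda> v = hinner H \<xi> v)"
proof -
  have diff: "\<Lambda> (hdiff H v w) = \<Lambda> v - \<Lambda> w" if "v \<in> hcarrier H" "w \<in> hcarrier H" for v w
    using that by (simp add: hdiff_def add scale closed)
  have "\<exists>\<xi>\<in>hcarrier H. \<forall>v\<in>hcarrier H. \<Lambda> v = hinner H \<xi> v"
  proof (cases "\<forall>v\<in>hcarrier H. \<Lambda> v = 0")
    case True then show ?thesis using inner_zero_left zero_closed by (intro bexI[of _ "hzero H"]) auto
  next
    case False
    then obtain z where z: "z \<in> hcarrier H" "\<Lambda> z \<noteq> 0" by blast
    define K where "K = {v \<in> hcarrier H. \<Lambda> v = 0}"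
    have "closed_hsubspace H K"
      unfolding closed_hsubspace_def
    proof (intro conjI ballI allI impI)
      show "hzero H \<in> K" using diff[of "hzero H" "hzero H"] by (simp add: K_def closed diff_self)
      fix s x assume x: "x \<in> hcarrier H" and s: "\<forall>n::nat. s n \<in> K"
        and lim: "(\<lambda>n. hnorm H (hdiff H (s n) x)) \<longlonglongrightarrow> 0"
      have "cmod (\<Lambda> x) \<le> 0"
      proof (rule LIMSEQ_le_const[OF lim], intro exI allI impI)
        fix n
        show "cmod (\<Lambda> x) \<le> hnorm H (hdiff H (s n) x)"
          using bound[of "hdiff H (s n) x"] diff[of "s n" x] s x by (simp add: K_def closed)
      qed
      then show "x \<in> K" using x by (simp add: K_def)
    qed (auto simp: K_def add scale closed)
    then obtain y where y: "y \<in> K" "\<And>k. k \<in> K \<Longrightarrow> hinner H k (hdiff H z y) = 0"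
      using orthogonal_decomposition z by blast
    define v where "v = hdiff H z y"
    have v: "v \<in> hcarrier H" "\<Lambda> v = \<Lambda> z" using y z by (auto simp: v_def K_def closed diff)
    have v0: "hinner H v v \<noteq> 0"
      using v z inner_definite[OF v(1)] diff[of "hzero H" "hzero H"] by (auto simp: closed diff_self)
    define \<xi> where "\<xi> = hscale H (cnj (\<Lambda> v / hinner H v v)) v"
    have "\<Lambda> w = hinner H \<xi> w" if w: "w \<in> hcarrier H" for w
    proof -
      define k where "k = hdiff H w (hscale H (\<Lambda> w / \<Lambda> v) v)"
      have "k \<in> K" using w v z by (simp add: k_def K_def closed diff scale)
      then have "hinner H k v = 0" using y(2) by (simp add: v_def)
      then have "hinner H v k = 0" using inner_commute[of k v] \<open>k \<in> K\<close> v by (simp add: K_def)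
      then have "hinner H v w = \<Lambda> w / \<Lambda> v * hinner H v v"
        using w v by (simp add: k_def inner_simps closed)
      then show ?thesis using w v v0 z by (simp add: \<xi>_def inner_simps)
    qed
    then show ?thesis using v by (intro bexI[of _ \<xi>]) (auto simp: \<xi>_def closed)
  qed
  then obtain \<xi> where \<xi>: "\<xi> \<in> hcarrier H" "\<And>v. v \<in> hcarrier H \<Longrightarrow> \<Lambda> v = hinner H \<xi> v" by blast
  have "(hnorm H \<xi>)\<^sup>2 \<le> hnorm H \<xi>"
    using bound[OF \<xi>(1)] \<xi>(2)[OF \<xi>(1)] inner_self[OF \<xi>(1)] by (simp add: norm_power)
  then have "hnorm H \<xi> \<le> 1" using hnorm_nonneg[OF \<xi>(1)]
    by (cases "hnorm H \<xi> = 0") (auto simp: power2_eq_square)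
  then show ?thesis using \<xi> by blast
qed

end

section \<open>The GNS representation of a positive functional\<close>

text \<open>The assumption \<open>bound\<close> makes left multiplication continuous for the GNS
  seminorm; for an \<open>ideal_functional\<close> it is checked by conjugating in the
  unitization.\<close>

locale positive_functional =
  fixes \<omega> :: "'a::cstar_algebra \<Rightarrow> complex"
  assumes add: "\<omega> (x + y) = \<omega> x + \<omega> y"
    and scale: "\<omega> (c *\<^sub>C x) = c * \<omega> x"
    and hermitian: "\<omega> (star x) = cnj (\<omega> x)"
    and positive: "0 \<le> Re (\<omega> (star x * x))"
    and bound: "Re (\<omega> (star (a * x) * (a * x))) \<le> (norm a)\<^sup>2 * Re (\<omega> (star x * x))"
begin

section \<open>The semi-inner product of a positive functional\<close>

definition ip :: "'a \<Rightarrow> 'a \<Rightarrow> complex" where "ip x y = \<omega> (star x * y)"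

definition sn :: "'a \<Rightarrow> real" where "sn x = sqrt (Re (ip x x))"

lemma minus: "\<omega> (- x) = - \<omega> x"
  using scale[of "- 1" x] by (simp add: scaleC_minus_left)

lemma diff: "\<omega> (x - y) = \<omega> x - \<omega> y"
  using add[of x "- y"] by (simp add: minus)

lemma zero: "\<omega> 0 = 0"
  using diff[of 0 0] by simp

lemma ip_commute: "ip y x = cnj (ip x y)"
  using hermitian[of "star x * y"] by (simp add: ip_def star_mult star_star)

lemma ip_add_right: "ip x (y + z) = ip x y + ip x z"
  by (simp add: ip_def distrib_left add)

lemma ip_diff_right: "ip x (y - z) = ip x y - ip x z"
  by (simp add: ip_def right_diff_distrib diff)

lemma ip_scale_right: "ip x (c *\<^sub>C y) = c * ip x y"
  by (simp add: ip_def mult_scaleC_right scale)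

lemma ip_add_left: "ip (y + z) x = ip y x + ip z x"
  by (simp add: ip_def star_add distrib_right add)

lemma ip_diff_left: "ip (y - z) x = ip y x - ip z x"
  by (simp add: ip_def star_diff left_diff_distrib diff)

lemma ip_scale_left: "ip (c *\<^sub>C y) x = cnj c * ip y x"
  by (simp add: ip_def star_scaleC mult_scaleC_left scale)

lemmas ip_simps = ip_add_right ip_diff_right ip_scale_right ip_add_left ip_diff_left ip_scale_left

lemma sn_nonneg [simp]: "0 \<le> sn x"
  using positive[of x] by (simp add: sn_def ip_def)

lemma ip_self: "ip x x = of_real ((sn x)\<^sup>2)"
proof -
  have "Im (ip x x) = 0" using ip_commute[of x x] by (simp add: complex_eq_iff)
  then show ?thesis using positive[of x] by (simp add: complex_eq_iff sn_def ip_def)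
qed

lemma sn_sq: "(sn x)\<^sup>2 = Re (ip x x)"
  using ip_self[of x] by simp

lemma ip_cauchy_schwarz: "cmod (ip x y) \<le> sn x * sn y"
proof -
  have "(cmod (ip x y))\<^sup>2 \<le> (sn x)\<^sup>2 * (sn y)\<^sup>2"
  proof (rule discriminant_complex)
    fix c
    have c: "c * cnj c = of_real ((cmod c)\<^sup>2)" by (metis complex_norm_square of_real_power)
    have "ip (x + c *\<^sub>C y) (x + c *\<^sub>C y) =
        of_real ((sn x)\<^sup>2) + (c * ip x y + cnj (c * ip x y)) + of_real ((cmod c)\<^sup>2 * (sn y)\<^sup>2)"
      using ip_self[of x] ip_self[of y] ip_commute[of y x] c by (simp add: ip_simps algebra_simps)
    moreover have "0 \<le> Re (ip (x + c *\<^sub>C y) (x + c *\<^sub>C y))" by (simp flip: sn_sq)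
    ultimately show "0 \<le> (sn x)\<^sup>2 + 2 * Re (c * ip x y) + (cmod c)\<^sup>2 * (sn y)\<^sup>2" by simp
  qed simp
  then show ?thesis by (metis sn_nonneg mult_nonneg_nonneg power2_le_imp_le power_mult_distrib)
qed

lemma sn_add: "sn (x + y) \<le> sn x + sn y"
proof (rule power2_le_imp_le)
  have "Re (ip x y) \<le> sn x * sn y"
    using ip_cauchy_schwarz[of x y] complex_Re_le_cmod order_trans by blast
  then show "(sn (x + y))\<^sup>2 \<le> (sn x + sn y)\<^sup>2"
    using ip_commute[of x y] by (simp add: sn_sq ip_simps power2_sum)
qed simp

lemma sn_scale: "sn (c *\<^sub>C x) = cmod c * sn x"
proof (rule power2_eq_imp_eq)
  have "ip (c *\<^sub>C x) (c *\<^sub>C x) = of_real ((cmod c)\<^sup>2 * (sn x)\<^sup>2)"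
    using ip_self[of x] complex_norm_square[of c] by (simp add: ip_simps)
  then show "(sn (c *\<^sub>C x))\<^sup>2 = (cmod c * sn x)\<^sup>2" by (simp add: sn_sq[of "c *\<^sub>C x"] power_mult_distrib)
qed auto

lemma sn_minus: "sn (- x) = sn x"
  using sn_scale[of "- 1" x] by (simp add: scaleC_minus_left)

lemma sn_diff_commute: "sn (x - y) = sn (y - x)"
  using sn_minus[of "x - y"] by simp

lemma sn_diff_triangle: "sn (x - z) \<le> sn (x - y) + sn (y - z)"
  using sn_add[of "x - y" "y - z"] by simp

lemma sn_zero [simp]: "sn 0 = 0"
  by (simp add: sn_def ip_def zero)

lemma sn_mult: "sn (a * x) \<le> norm a * sn x"
proof (rule power2_le_imp_le)
  show "(sn (a * x))\<^sup>2 \<le> (norm a * sn x)\<^sup>2"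
    using bound[of a x] by (simp add: sn_sq[unfolded ip_def] power_mult_distrib)
qed simp

section \<open>Cauchy sequences for the GNS seminorm\<close>

lemma gns_cauchy_iff: "s \<in> gns_cauchy \<omega> \<longleftrightarrow> (\<forall>e>0. \<exists>N. \<forall>m\<ge>N. \<forall>n\<ge>N. sn (s m - s n) < e)"
proof -
  have eq: "Re (\<omega> (star x * x)) = (sn x)\<^sup>2" for x by (simp add: sn_sq ip_def)
  have "(\<forall>e>0. \<exists>N. \<forall>m\<ge>N. \<forall>n\<ge>N. (sn (s m - s n))\<^sup>2 < e) \<longleftrightarrow>
      (\<forall>e>0. \<exists>N. \<forall>m\<ge>N. \<forall>n\<ge>N. sn (s m - s n) < e)" (is "?L \<longleftrightarrow> ?R")
  proof (intro iffI allI impI)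
    fix e :: real assume ?L "e > 0"
    then obtain N where "\<forall>m\<ge>N. \<forall>n\<ge>N. (sn (s m - s n))\<^sup>2 < e\<^sup>2" by (meson zero_less_power)
    then show "\<exists>N. \<forall>m\<ge>N. \<forall>n\<ge>N. sn (s m - s n) < e"
      using \<open>e > 0\<close> by (meson power2_less_imp_less less_imp_le)
  next
    fix e :: real assume ?R "e > 0"
    then obtain N where N: "\<forall>m\<ge>N. \<forall>n\<ge>N. sn (s m - s n) < sqrt e" by (meson real_sqrt_gt_zero)
    have "(sn (s m - s n))\<^sup>2 < e" if "m \<ge> N" "n \<ge> N" for m n
    proof -
      have "(sn (s m - s n))\<^sup>2 < (sqrt e)\<^sup>2"
        using N that by (intro power_strict_mono) auto
      then show ?thesis using \<open>e > 0\<close> by simp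
    qed
    then show "\<exists>N. \<forall>m\<ge>N. \<forall>n\<ge>N. (sn (s m - s n))\<^sup>2 < e" by blast
  qed
  then show ?thesis by (simp add: gns_cauchy_def eq)
qed

lemma gns_class_iff: "t \<in> gns_class \<omega> s \<longleftrightarrow> t \<in> gns_cauchy \<omega> \<and> (\<lambda>n. sn (s n - t n)) \<longlonglongrightarrow> 0"
proof -
  have eq: "\<omega> (star x * x) = of_real ((sn x)\<^sup>2)" for x using ip_self[of x] by (simp add: ip_def)
  have "(\<lambda>n. complex_of_real ((sn (s n - t n))\<^sup>2)) \<longlonglongrightarrow> 0 \<longleftrightarrow> (\<lambda>n. (sn (s n - t n))\<^sup>2) \<longlonglongrightarrow> 0"
    by (metis tendsto_of_real_iff of_real_0)
  also have "\<dots> \<longleftrightarrow> (\<lambda>n. sn (s n - t n)) \<longlonglongrightarrow> 0"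
  proof
    assume "(\<lambda>n. (sn (s n - t n))\<^sup>2) \<longlonglongrightarrow> 0"
    then have "(\<lambda>n. sqrt ((sn (s n - t n))\<^sup>2)) \<longlonglongrightarrow> sqrt 0" by (rule tendsto_real_sqrt)
    then show "(\<lambda>n. sn (s n - t n)) \<longlonglongrightarrow> 0" by simp
  next
    assume "(\<lambda>n. sn (s n - t n)) \<longlonglongrightarrow> 0"
    then have "(\<lambda>n. (sn (s n - t n))\<^sup>2) \<longlonglongrightarrow> 0\<^sup>2" by (rule tendsto_power)
    then show "(\<lambda>n. (sn (s n - t n))\<^sup>2) \<longlonglongrightarrow> 0" by simp
  qed
  finally show ?thesis by (simp add: gns_class_def eq)
qed

lemma cauchy_const [simp]: "(\<lambda>n. x) \<in> gns_cauchy \<omega>"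
  by (simp add: gns_cauchy_iff)

lemma cauchy_add:
  assumes "s \<in> gns_cauchy \<omega>" "t \<in> gns_cauchy \<omega>" shows "(\<lambda>n. s n + t n) \<in> gns_cauchy \<omega>"
  unfolding gns_cauchy_iff
proof (intro allI impI)
  fix e :: real assume "e > 0"
  then obtain M N where M: "\<forall>m\<ge>M. \<forall>n\<ge>M. sn (s m - s n) < e / 2" and N: "\<forall>m\<ge>N. \<forall>n\<ge>N. sn (t m - t n) < e / 2"
    using assms unfolding gns_cauchy_iff by (meson half_gt_zero)
  have "sn (s m + t m - (s n + t n)) < e" if "m \<ge> max M N" "n \<ge> max M N" for m n
  proof -
    have "s m + t m - (s n + t n) = (s m - s n) + (t m - t n)" by simp
    then have "sn (s m + t m - (s n + t n)) \<le> sn (s m - s n) + sn (t m - t n)" by (simp only: sn_add)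
    moreover have "sn (s m - s n) < e / 2" "sn (t m - t n) < e / 2" using M N that by auto
    ultimately show ?thesis by linarith
  qed
  then show "\<exists>N. \<forall>m\<ge>N. \<forall>n\<ge>N. sn (s m + t m - (s n + t n)) < e" by blast
qed

lemma cauchy_lipschitz:
  assumes s: "s \<in> gns_cauchy \<omega>" and L: "\<And>m n. sn (t m - t n) \<le> L * sn (s m - s n)"
  shows "t \<in> gns_cauchy \<omega>"
  unfolding gns_cauchy_iff
proof (intro allI impI)
  fix e :: real assume e: "e > 0"
  define K where "K = \<bar>L\<bar> + 1"
  have K: "K > 0" by (simp add: K_def add_nonneg_pos)
  then obtain N where N: "\<forall>m\<ge>N. \<forall>n\<ge>N. sn (s m - s n) < e / K"
    using s e unfolding gns_cauchy_iff by (meson divide_pos_pos)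
  have "sn (t m - t n) < e" if "m \<ge> N" "n \<ge> N" for m n
  proof -
    have "sn (t m - t n) \<le> K * sn (s m - s n)"
      by (rule order_trans[OF L]) (intro mult_right_mono, auto simp: K_def)
    also have "\<dots> < K * (e / K)" using N that K by (intro mult_strict_left_mono) auto
    finally show ?thesis using K by simp
  qed
  then show "\<exists>N. \<forall>m\<ge>N. \<forall>n\<ge>N. sn (t m - t n) < e" by blast
qed

lemma cauchy_scale: "s \<in> gns_cauchy \<omega> \<Longrightarrow> (\<lambda>n. c *\<^sub>C s n) \<in> gns_cauchy \<omega>"
  by (rule cauchy_lipschitz[of s _ "cmod c"]) (auto simp: sn_scale simp flip: scaleC_diff_right)

lemma cauchy_mult: "s \<in> gns_cauchy \<omega> \<Longrightarrow> (\<lambda>n. a * s n) \<in> gns_cauchy \<omega>"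
  by (rule cauchy_lipschitz[of s _ "norm a"]) (auto simp: sn_mult simp flip: right_diff_distrib)

lemma cauchy_diff:
  assumes "s \<in> gns_cauchy \<omega>" "t \<in> gns_cauchy \<omega>" shows "(\<lambda>n. s n - t n) \<in> gns_cauchy \<omega>"
  using cauchy_add[OF assms(1) cauchy_scale[OF assms(2), of "- 1"]] by (simp add: scaleC_minus_left)

lemma cauchy_bounded:
  assumes "s \<in> gns_cauchy \<omega>" shows "\<exists>B>0. \<forall>n. sn (s n) \<le> B"
proof -
  obtain N where N: "\<forall>m\<ge>N. \<forall>n\<ge>N. sn (s m - s n) < 1"
    using assms unfolding gns_cauchy_iff by (meson zero_less_one)
  define B where "B = Max (insert 1 ((\<lambda>n. sn (s n)) ` {..N})) + 1"
  have "sn (s n) \<le> B" for n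
  proof (cases "n \<le> N")
    case True
    then have "sn (s n) \<le> Max (insert 1 ((\<lambda>n. sn (s n)) ` {..N}))" by (intro Max_ge) auto
    then show ?thesis by (simp add: B_def)
  next
    case False
    then have "sn (s n) \<le> sn (s n - s N) + sn (s N)" "sn (s n - s N) < 1"
      using sn_add[of "s n - s N" "s N"] N by auto
    moreover have "sn (s N) \<le> Max (insert 1 ((\<lambda>n. sn (s n)) ` {..N}))" by (intro Max_ge) auto
    ultimately show ?thesis by (simp add: B_def)
  qed
  moreover have "B > 0"
    using Max_ge[of "insert 1 ((\<lambda>n. sn (s n)) ` {..N})" 1] by (simp add: B_def)
  ultimately show ?thesis by blast
qed

lemma ip_diff_le:
  "cmod (ip x y - ip x' y') \<le> sn (x - x') * sn y + sn x' * sn (y - y')"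
proof -
  have "ip x y - ip x' y' = ip (x - x') y + ip x' (y - y')" by (simp add: ip_simps)
  then show ?thesis
    using norm_triangle_ineq[of "ip (x - x') y" "ip x' (y - y')"]
      ip_cauchy_schwarz[of "x - x'" y] ip_cauchy_schwarz[of x' "y - y'"] by simp
qed

definition lim_ip :: "(nat \<Rightarrow> 'a) \<Rightarrow> (nat \<Rightarrow> 'a) \<Rightarrow> complex" where
  "lim_ip s t = lim (\<lambda>n. ip (s n) (t n))"

lemma lim_ip:
  assumes "s \<in> gns_cauchy \<omega>" "t \<in> gns_cauchy \<omega>"
  shows "(\<lambda>n. ip (s n) (t n)) \<longlonglongrightarrow> lim_ip s t"
proof -
  obtain B where B: "B > 0" "\<And>n. sn (s n) \<le> B" using cauchy_bounded[OF assms(1)] by blast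
  obtain C where C: "C > 0" "\<And>n. sn (t n) \<le> C" using cauchy_bounded[OF assms(2)] by blast
  have "Cauchy (\<lambda>n. ip (s n) (t n))"
  proof (rule CauchyI)
    fix e :: real assume e: "e > 0"
    obtain M where M: "\<forall>m\<ge>M. \<forall>n\<ge>M. sn (s m - s n) < e / (2 * C)"
      using assms(1) e C(1) unfolding gns_cauchy_iff by (meson divide_pos_pos mult_pos_pos zero_less_numeral)
    obtain N where N: "\<forall>m\<ge>N. \<forall>n\<ge>N. sn (t m - t n) < e / (2 * B)"
      using assms(2) e B(1) unfolding gns_cauchy_iff by (meson divide_pos_pos mult_pos_pos zero_less_numeral)
    have "norm (ip (s m) (t m) - ip (s n) (t n)) < e" if "m \<ge> max M N" "n \<ge> max M N" for m n
    proof -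
      have "norm (ip (s m) (t m) - ip (s n) (t n)) \<le> sn (s m - s n) * sn (t m) + sn (s n) * sn (t m - t n)"
        by (rule ip_diff_le)
      also have "\<dots> \<le> sn (s m - s n) * C + B * sn (t m - t n)"
        using B C by (intro add_mono mult_left_mono mult_right_mono) auto
      also have "\<dots> < e / (2 * C) * C + B * (e / (2 * B))"
        using M N that B C by (intro add_strict_mono mult_strict_left_mono mult_strict_right_mono) auto
      finally show ?thesis using B C by simp
    qed
    then show "\<exists>M. \<forall>m\<ge>M. \<forall>n\<ge>M. norm (ip (s m) (t m) - ip (s n) (t n)) < e" by blast
  qed
  then show ?thesis unfolding lim_ip_def by (simp add: Cauchy_convergent_iff convergent_LIMSEQ_iff)
qed

lemma gns_class_eq_iff:
  assumes "s \<in> gns_cauchy \<omega>" "t \<in> gns_cauchy \<omega>"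
  shows "gns_class \<omega> s = gns_class \<omega> t \<longleftrightarrow> (\<lambda>n. sn (s n - t n)) \<longlonglongrightarrow> 0"
proof
  assume "gns_class \<omega> s = gns_class \<omega> t"
  moreover have "t \<in> gns_class \<omega> t" using assms by (simp add: gns_class_iff)
  ultimately show "(\<lambda>n. sn (s n - t n)) \<longlonglongrightarrow> 0" by (metis gns_class_iff)
next
  have tr: "(\<lambda>n. sn (x n - z n)) \<longlonglongrightarrow> 0"
    if "(\<lambda>n. sn (x n - y n)) \<longlonglongrightarrow> 0" "(\<lambda>n. sn (y n - z n)) \<longlonglongrightarrow> 0" for x y z
    by (rule Lim_null_comparison[OF _ tendsto_add_zero[OF that]]) (simp add: sn_diff_triangle)
  assume st: "(\<lambda>n. sn (s n - t n)) \<longlonglongrightarrow> 0"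
  then have ts: "(\<lambda>n. sn (t n - s n)) \<longlonglongrightarrow> 0" by (simp add: sn_diff_commute)
  show "gns_class \<omega> s = gns_class \<omega> t"
    using tr[OF st] tr[OF ts] by (auto simp: gns_class_iff)
qed

lemma gns_class_self: "s \<in> gns_cauchy \<omega> \<Longrightarrow> s \<in> gns_class \<omega> s"
  by (simp add: gns_class_iff)

text \<open>Operations on classes are encoded as unions over all representatives; this evaluates
  them at one representative.\<close>

lemma UN_class_eq: "(\<And>s'. s' \<in> S \<Longrightarrow> f s' = X) \<Longrightarrow> s \<in> S \<Longrightarrow> (\<Union>s'\<in>S. f s') = X"
  by auto

lemma lipschitz_null:
  assumes "(\<lambda>n. sn (d n)) \<longlonglongrightarrow> 0" "\<And>n. sn (d' n) \<le> L * sn (d n)"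
  shows "(\<lambda>n. sn (d' n)) \<longlonglongrightarrow> 0"
  by (rule Lim_null_comparison[of _ "\<lambda>n. L * sn (d n)"]) (use assms tendsto_mult_right_zero in auto)

section \<open>The operations of the GNS space on representatives\<close>

lemma hcarrier_gns: "hcarrier (gns_space \<omega>) = gns_class \<omega> ` gns_cauchy \<omega>"
  by (simp add: gns_space_def)

lemma hzero_gns: "hzero (gns_space \<omega>) = gns_class \<omega> (\<lambda>n. 0)"
  by (simp add: gns_space_def)

lemma hadd_gns:
  assumes s: "s \<in> gns_cauchy \<omega>" and t: "t \<in> gns_cauchy \<omega>"
  shows "hadd (gns_space \<omega>) (gns_class \<omega> s) (gns_class \<omega> t) = gns_class \<omega> (\<lambda>n. s n + t n)"
proof -
  have "gns_class \<omega> (\<lambda>n. s' n + t' n) = gns_class \<omega> (\<lambda>n. s n + t n)"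
    if "s' \<in> gns_class \<omega> s" "t' \<in> gns_class \<omega> t" for s' t'
  proof -
    have s': "s' \<in> gns_cauchy \<omega>" "(\<lambda>n. sn (s n - s' n)) \<longlonglongrightarrow> 0"
      and t': "t' \<in> gns_cauchy \<omega>" "(\<lambda>n. sn (t n - t' n)) \<longlonglongrightarrow> 0"
      using that by (auto simp: gns_class_iff)
    have "(\<lambda>n. sn (s n + t n - (s' n + t' n))) \<longlonglongrightarrow> 0"
    proof (rule Lim_null_comparison[OF _ tendsto_add_zero[OF s'(2) t'(2)]], intro always_eventually allI)
      fix n
      have "s n + t n - (s' n + t' n) = (s n - s' n) + (t n - t' n)" by simp
      then show "norm (sn (s n + t n - (s' n + t' n))) \<le> sn (s n - s' n) + sn (t n - t' n)"
        by (simp only: sn_add real_norm_def abs_of_nonneg[OF sn_nonneg])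
    qed
    then have "gns_class \<omega> (\<lambda>n. s n + t n) = gns_class \<omega> (\<lambda>n. s' n + t' n)"
      by (subst gns_class_eq_iff) (auto intro: cauchy_add s s' t t')
    then show ?thesis by (rule sym)
  qed
  then have "(\<Union>s'\<in>gns_class \<omega> s. \<Union>t'\<in>gns_class \<omega> t. gns_class \<omega> (\<lambda>n. s' n + t' n)) =
      gns_class \<omega> (\<lambda>n. s n + t n)"
    by (intro UN_class_eq[OF UN_class_eq[OF _ gns_class_self[OF t]] gns_class_self[OF s]])
  then show ?thesis by (simp add: gns_space_def)
qed

lemma hscale_gns:
  assumes s: "s \<in> gns_cauchy \<omega>"
  shows "hscale (gns_space \<omega>) c (gns_class \<omega> s) = gns_class \<omega> (\<lambda>n. c *\<^sub>C s n)"
proof -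
  have "gns_class \<omega> (\<lambda>n. c *\<^sub>C s' n) = gns_class \<omega> (\<lambda>n. c *\<^sub>C s n)" if "s' \<in> gns_class \<omega> s" for s'
  proof -
    have s': "s' \<in> gns_cauchy \<omega>" "(\<lambda>n. sn (s n - s' n)) \<longlonglongrightarrow> 0" using that by (auto simp: gns_class_iff)
    have "(\<lambda>n. sn (c *\<^sub>C s n - c *\<^sub>C s' n)) \<longlonglongrightarrow> 0"
      by (rule lipschitz_null[OF s'(2), of _ "cmod c"]) (simp add: sn_scale flip: scaleC_diff_right)
    then have "gns_class \<omega> (\<lambda>n. c *\<^sub>C s n) = gns_class \<omega> (\<lambda>n. c *\<^sub>C s' n)"
      by (subst gns_class_eq_iff) (auto intro: cauchy_scale s s')
    then show ?thesis by (rule sym)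
  qed
  then have "(\<Union>s'\<in>gns_class \<omega> s. gns_class \<omega> (\<lambda>n. c *\<^sub>C s' n)) = gns_class \<omega> (\<lambda>n. c *\<^sub>C s n)"
    by (intro UN_class_eq[OF _ gns_class_self[OF s]])
  then show ?thesis by (simp add: gns_space_def)
qed

lemma hdiff_gns:
  assumes s: "s \<in> gns_cauchy \<omega>" and t: "t \<in> gns_cauchy \<omega>"
  shows "hdiff (gns_space \<omega>) (gns_class \<omega> s) (gns_class \<omega> t) = gns_class \<omega> (\<lambda>n. s n - t n)"
  using hscale_gns[OF t, of "- 1"] hadd_gns[OF s cauchy_scale[OF t, of "- 1"]]
  by (simp add: hdiff_def scaleC_minus_left)

lemma rep_act_gns:
  assumes s: "s \<in> gns_cauchy \<omega>"
  shows "rep_act (gns_rep \<omega>) a (gns_class \<omega> s) = gns_class \<omega> (\<lambda>n. a * s n)"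
proof -
  have "gns_class \<omega> (\<lambda>n. a * s' n) = gns_class \<omega> (\<lambda>n. a * s n)" if "s' \<in> gns_class \<omega> s" for s'
  proof -
    have s': "s' \<in> gns_cauchy \<omega>" "(\<lambda>n. sn (s n - s' n)) \<longlonglongrightarrow> 0" using that by (auto simp: gns_class_iff)
    have "(\<lambda>n. sn (a * s n - a * s' n)) \<longlonglongrightarrow> 0"
      by (rule lipschitz_null[OF s'(2), of _ "norm a"]) (simp add: sn_mult flip: right_diff_distrib)
    then have "gns_class \<omega> (\<lambda>n. a * s n) = gns_class \<omega> (\<lambda>n. a * s' n)"
      by (subst gns_class_eq_iff) (auto intro: cauchy_mult s s')
    then show ?thesis by (rule sym)
  qed
  then have "(\<Union>s'\<in>gns_class \<omega> s. gns_class \<omega> (\<lambda>n. a * s' n)) = gns_class \<omega> (\<lambda>n. a * s n)"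
    by (intro UN_class_eq[OF _ gns_class_self[OF s]])
  then show ?thesis by (simp add: gns_rep_def)
qed

lemma hinner_gns:
  assumes s: "s \<in> gns_cauchy \<omega>" and t: "t \<in> gns_cauchy \<omega>"
  shows "hinner (gns_space \<omega>) (gns_class \<omega> s) (gns_class \<omega> t) = lim_ip s t"
proof -
  have lim: "(\<lambda>n. ip (s' n) (t' n)) \<longlonglongrightarrow> lim_ip s t"
    if "s' \<in> gns_class \<omega> s" "t' \<in> gns_class \<omega> t" for s' t'
  proof -
    have s': "s' \<in> gns_cauchy \<omega>" "(\<lambda>n. sn (s n - s' n)) \<longlonglongrightarrow> 0"
      and t': "t' \<in> gns_cauchy \<omega>" "(\<lambda>n. sn (t n - t' n)) \<longlonglongrightarrow> 0"
      using that by (auto simp: gns_class_iff)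
    obtain B where B: "B > 0" "\<And>n. sn (t' n) \<le> B" using cauchy_bounded[OF t'(1)] by blast
    obtain C where C: "C > 0" "\<And>n. sn (s n) \<le> C" using cauchy_bounded[OF s] by blast
    have "(\<lambda>n. ip (s' n) (t' n) - ip (s n) (t n)) \<longlonglongrightarrow> 0"
    proof (rule Lim_null_comparison[of _ "\<lambda>n. sn (s n - s' n) * B + C * sn (t n - t' n)"],
        intro always_eventually allI)
      fix n
      have "norm (ip (s' n) (t' n) - ip (s n) (t n)) \<le> sn (s' n - s n) * sn (t' n) + sn (s n) * sn (t' n - t n)"
        by (rule ip_diff_le)
      also have "\<dots> \<le> sn (s' n - s n) * B + C * sn (t' n - t n)"
        using B C by (intro add_mono mult_left_mono mult_right_mono) auto
      finally show "norm (ip (s' n) (t' n) - ip (s n) (t n)) \<le> sn (s n - s' n) * B + C * sn (t n - t' n)"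
        by (simp only: sn_diff_commute)
    next
      show "(\<lambda>n. sn (s n - s' n) * B + C * sn (t n - t' n)) \<longlonglongrightarrow> 0"
        by (intro tendsto_add_zero tendsto_mult_left_zero tendsto_mult_right_zero s' t')
    qed
    from tendsto_add[OF this lim_ip[OF s t]] show ?thesis by simp
  qed
  have "(THE l. \<forall>s'\<in>gns_class \<omega> s. \<forall>t'\<in>gns_class \<omega> t. (\<lambda>n. ip (s' n) (t' n)) \<longlonglongrightarrow> l) = lim_ip s t"
  proof (rule the_equality)
    fix l assume "\<forall>s'\<in>gns_class \<omega> s. \<forall>t'\<in>gns_class \<omega> t. (\<lambda>n. ip (s' n) (t' n)) \<longlonglongrightarrow> l"
    then have "(\<lambda>n. ip (s n) (t n)) \<longlonglongrightarrow> l" using gns_class_self s t by blast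
    then show "l = lim_ip s t" using lim_ip[OF s t] by (rule LIMSEQ_unique)
  qed (use lim in blast)
  then show ?thesis by (simp add: gns_space_def ip_def)
qed

lemma hnorm_gns:
  assumes s: "s \<in> gns_cauchy \<omega>"
  shows "(\<lambda>n. sn (s n)) \<longlonglongrightarrow> hnorm (gns_space \<omega>) (gns_class \<omega> s)"
  unfolding hnorm_def hinner_gns[OF s s] sn_def by (intro tendsto_intros lim_ip s)

lemma hnorm_gns_le:
  assumes "s \<in> gns_cauchy \<omega>" "\<And>n. n \<ge> N \<Longrightarrow> sn (s n) \<le> e"
  shows "hnorm (gns_space \<omega>) (gns_class \<omega> s) \<le> e"
  using assms by (intro LIMSEQ_le_const2[OF hnorm_gns]) auto

lemma hnorm_gns_const: "hnorm (gns_space \<omega>) (gns_class \<omega> (\<lambda>n. x)) = sn x"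
  using hnorm_gns[OF cauchy_const, of x] LIMSEQ_unique tendsto_const by blast

text \<open>Each Cauchy sequence \<open>S n\<close> lies within \<open>1 / Suc n\<close> of a
  constant one with some value \<open>b n\<close>; the sequence b is itself Cauchy and represents
  the limit.\<close>

lemma gns_complete:
  assumes S: "\<And>n::nat. S n \<in> gns_cauchy \<omega>"
    and C: "\<forall>e>0. \<exists>N. \<forall>m\<ge>N. \<forall>n\<ge>N. hnorm (gns_space \<omega>) (gns_class \<omega> (\<lambda>k. S m k - S n k)) < e"
  shows "\<exists>b\<in>gns_cauchy \<omega>. (\<lambda>n. hnorm (gns_space \<omega>) (gns_class \<omega> (\<lambda>k. S n k - b k))) \<longlonglongrightarrow> 0"
proof -
  define Q where "Q s = hnorm (gns_space \<omega>) (gns_class \<omega> s)" for s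
  have Qlim: "(\<lambda>n. sn (s n)) \<longlonglongrightarrow> Q s" if "s \<in> gns_cauchy \<omega>" for s
    unfolding Q_def by (rule hnorm_gns[OF that])
  have Qtri: "Q (\<lambda>k. x k - z k) \<le> Q (\<lambda>k. x k - y k) + Q (\<lambda>k. y k - z k)"
    if "x \<in> gns_cauchy \<omega>" "y \<in> gns_cauchy \<omega>" "z \<in> gns_cauchy \<omega>" for x y z
    using that by (intro LIMSEQ_le[OF Qlim tendsto_add[OF Qlim Qlim]] cauchy_diff) (auto intro: sn_diff_triangle)
  have Qcomm: "Q (\<lambda>k. x k - y k) = Q (\<lambda>k. y k - x k)"
    if "x \<in> gns_cauchy \<omega>" "y \<in> gns_cauchy \<omega>" for x y
    using Qlim[OF cauchy_diff[OF that]] Qlim[OF cauchy_diff[OF that(2,1)]] LIMSEQ_unique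
    by (simp add: sn_diff_commute)
  have "\<exists>x. Q (\<lambda>k. S n k - x) \<le> 1 / Suc n" for n
  proof -
    obtain N where N: "\<forall>m\<ge>N. \<forall>k\<ge>N. sn (S n m - S n k) < 1 / Suc n"
      using S[of n] unfolding gns_cauchy_iff by (meson zero_less_divide_1_iff of_nat_0_less_iff zero_less_Suc)
    have "Q (\<lambda>k. S n k - S n N) \<le> 1 / Suc n"
      unfolding Q_def using N S by (intro hnorm_gns_le[of _ N] cauchy_diff) (auto intro: less_imp_le)
    then show ?thesis by blast
  qed
  then obtain b where b: "\<And>n. Q (\<lambda>k. S n k - b n) \<le> 1 / Suc n" by metis
  have bsn: "sn (b m - b n) \<le> 1 / Suc m + Q (\<lambda>k. S m k - S n k) + 1 / Suc n" for m n
  proof -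
    have "sn (b m - b n) = Q (\<lambda>k. b m - b n)" by (simp add: Q_def hnorm_gns_const)
    also have "\<dots> \<le> Q (\<lambda>k. b m - S n k) + Q (\<lambda>k. S n k - b n)" by (rule Qtri) (simp_all add: S)
    also have "Q (\<lambda>k. b m - S n k) \<le> Q (\<lambda>k. b m - S m k) + Q (\<lambda>k. S m k - S n k)"
      by (rule Qtri) (simp_all add: S)
    also have "Q (\<lambda>k. b m - S m k) = Q (\<lambda>k. S m k - b m)" by (rule Qcomm) (simp_all add: S)
    finally show ?thesis using b[of m] b[of n] by linarith
  qed
  have small: "\<exists>N. \<forall>n\<ge>N. 1 / real (Suc n) < e" if "e > 0" for e
  proof -
    have "\<forall>\<^sub>F n in sequentially. inverse (real (Suc n)) < e"
      using order_tendstoD(2)[OF LIMSEQ_inverse_real_of_nat that] .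
    then show ?thesis by (simp add: eventually_sequentially inverse_eq_divide)
  qed
  have bC: "b \<in> gns_cauchy \<omega>"
    unfolding gns_cauchy_iff
  proof (intro allI impI)
    fix e :: real assume e: "e > 0"
    obtain N where N: "\<forall>n\<ge>N. 1 / real (Suc n) < e / 3" using small[of "e / 3"] e by auto
    obtain M where M: "\<forall>m\<ge>M. \<forall>n\<ge>M. Q (\<lambda>k. S m k - S n k) < e / 3"
      using C e unfolding Q_def by (meson divide_pos_pos zero_less_numeral)
    have "sn (b m - b n) < e" if "m \<ge> max M N" "n \<ge> max M N" for m n
    proof -
      have "1 / real (Suc m) < e / 3" "1 / real (Suc n) < e / 3" "Q (\<lambda>k. S m k - S n k) < e / 3"
        using N M that by auto
      then show ?thesis using bsn[of m n] by linarith
    qed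
    then show "\<exists>N. \<forall>m\<ge>N. \<forall>n\<ge>N. sn (b m - b n) < e" by blast
  qed
  have "(\<lambda>n. Q (\<lambda>k. S n k - b k)) \<longlonglongrightarrow> 0"
  proof (rule LIMSEQ_I)
    fix e :: real assume e: "e > 0"
    obtain N where N: "\<forall>n\<ge>N. 1 / real (Suc n) < e / 2" using small[of "e / 2"] e by auto
    obtain M where M: "\<forall>m\<ge>M. \<forall>n\<ge>M. sn (b m - b n) < e / 2"
      using bC e unfolding gns_cauchy_iff by (meson half_gt_zero)
    have "norm (Q (\<lambda>k. S n k - b k) - 0) < e" if n: "n \<ge> max M N" for n
    proof -
      have "Q (\<lambda>k. S n k - b k) \<le> Q (\<lambda>k. S n k - b n) + Q (\<lambda>k. b n - b k)"
        by (rule Qtri) (simp_all add: S bC)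
      moreover have "Q (\<lambda>k. b n - b k) \<le> e / 2"
        unfolding Q_def using M n bC by (intro hnorm_gns_le[of _ M] cauchy_diff) (auto intro: less_imp_le)
      moreover have "1 / real (Suc n) < e / 2" using N n by auto
      moreover have "0 \<le> Q (\<lambda>k. S n k - b k)"
        using S bC by (intro LIMSEQ_le_const[OF Qlim] cauchy_diff) auto
      ultimately show ?thesis using b[of n] by simp
    qed
    then show "\<exists>N. \<forall>n\<ge>N. norm (Q (\<lambda>k. S n k - b k) - 0) < e" by blast
  qed
  then show ?thesis using bC unfolding Q_def by blast
qed

lemmas gns_ops = hzero_gns hadd_gns hscale_gns hdiff_gns hinner_gns cauchy_add cauchy_scale cauchy_diff

lemma lim_ip_eqI:
  assumes "s \<in> gns_cauchy \<omega>" "t \<in> gns_cauchy \<omega>" "(\<lambda>n. ip (s n) (t n)) \<longlonglongrightarrow> l"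
  shows "lim_ip s t = l"
  using lim_ip[OF assms(1,2)] assms(3) by (rule LIMSEQ_unique)

lemma lim_ip_add_right:
  "s \<in> gns_cauchy \<omega> \<Longrightarrow> t \<in> gns_cauchy \<omega> \<Longrightarrow> u \<in> gns_cauchy \<omega> \<Longrightarrow>
    lim_ip s (\<lambda>n. t n + u n) = lim_ip s t + lim_ip s u"
  by (intro lim_ip_eqI) (auto simp: ip_simps cauchy_add intro!: tendsto_intros lim_ip)

lemma lim_ip_scale_right:
  "s \<in> gns_cauchy \<omega> \<Longrightarrow> t \<in> gns_cauchy \<omega> \<Longrightarrow> lim_ip s (\<lambda>n. c *\<^sub>C t n) = c * lim_ip s t"
  by (intro lim_ip_eqI) (auto simp: ip_simps cauchy_scale intro!: tendsto_intros lim_ip)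

lemma lim_ip_commute:
  assumes "s \<in> gns_cauchy \<omega>" "t \<in> gns_cauchy \<omega>" shows "lim_ip t s = cnj (lim_ip s t)"
proof (rule lim_ip_eqI[OF assms(2,1)])
  have "(\<lambda>n. cnj (ip (s n) (t n))) \<longlonglongrightarrow> cnj (lim_ip s t)" by (intro tendsto_intros lim_ip assms)
  then show "(\<lambda>n. ip (t n) (s n)) \<longlonglongrightarrow> cnj (lim_ip s t)" by (simp flip: ip_commute)
qed

lemma lim_ip_self:
  assumes s: "s \<in> gns_cauchy \<omega>"
  shows "lim_ip s s = of_real ((hnorm (gns_space \<omega>) (gns_class \<omega> s))\<^sup>2)"
  unfolding ip_self using s by (intro lim_ip_eqI) (auto simp: ip_self intro!: tendsto_intros hnorm_gns)

lemma lim_ip_nonneg: "s \<in> gns_cauchy \<omega> \<Longrightarrow> lim_ip s s \<in> \<real>\<^sub>\<ge>\<^sub>0"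
  unfolding lim_ip_self by (subst nonneg_Reals_of_real_iff) simp

lemma lim_ip_definite:
  assumes s: "s \<in> gns_cauchy \<omega>" and 0: "lim_ip s s = 0"
  shows "gns_class \<omega> s = gns_class \<omega> (\<lambda>n. 0)"
  using hnorm_gns[OF s] 0 s by (simp add: lim_ip_self gns_class_eq_iff)

lemma hilbert_space_gns: "hilbert_space (gns_space \<omega>)"
proof (unfold_locales, unfold hcarrier_gns)
  fix S :: "nat \<Rightarrow> 'a gns_vector"
  assume S: "\<And>n. S n \<in> gns_class \<omega> ` gns_cauchy \<omega>"
    and C: "\<forall>e>0. \<exists>N. \<forall>m\<ge>N. \<forall>n\<ge>N. hnorm (gns_space \<omega>) (hdiff (gns_space \<omega>) (S m) (S n)) < e"
  from S have "\<forall>n. \<exists>s. s \<in> gns_cauchy \<omega> \<and> S n = gns_class \<omega> s" by blast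
  then obtain s where s: "\<And>n. s n \<in> gns_cauchy \<omega>" "\<And>n. S n = gns_class \<omega> (s n)" by metis
  have "\<exists>b\<in>gns_cauchy \<omega>. (\<lambda>n. hnorm (gns_space \<omega>) (gns_class \<omega> (\<lambda>k. s n k - b k))) \<longlonglongrightarrow> 0"
    by (rule gns_complete[OF s(1)]) (use C s in \<open>simp add: hdiff_gns\<close>)
  then obtain b where b: "b \<in> gns_cauchy \<omega>"
    "(\<lambda>n. hnorm (gns_space \<omega>) (gns_class \<omega> (\<lambda>k. s n k - b k))) \<longlonglongrightarrow> 0" by blast
  then show "\<exists>x\<in>gns_class \<omega> ` gns_cauchy \<omega>. (\<lambda>n. hnorm (gns_space \<omega>) (hdiff (gns_space \<omega>) (S n) x)) \<longlonglongrightarrow> 0"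
    using s by (intro bexI[of _ "gns_class \<omega> b"]) (auto simp: hdiff_gns)
qed (auto simp: gns_ops add_ac scaleC_add_right scaleC_add_left scaleC_scaleC
    lim_ip_add_right lim_ip_scale_right lim_ip_nonneg lim_ip_definite
    intro: lim_ip_commute)

lemma star_representation_gns: "star_representation (gns_rep \<omega>)"
proof -
  have sp: "rep_space (gns_rep \<omega>) = gns_space \<omega>" by (simp add: gns_rep_def)
  interpret hilbert_space "rep_space (gns_rep \<omega>)" unfolding sp by (rule hilbert_space_gns)
  have le: "hnorm (gns_space \<omega>) (gns_class \<omega> (\<lambda>n. a * s n)) \<le> norm a * hnorm (gns_space \<omega>) (gns_class \<omega> s)"
    if s: "s \<in> gns_cauchy \<omega>" for a s
    using s sn_mult
    by (intro LIMSEQ_le[OF hnorm_gns[OF cauchy_mult[OF s]] tendsto_mult_left[OF hnorm_gns[OF s]]]) auto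
  have le': "\<exists>K. \<forall>s\<in>gns_cauchy \<omega>. hnorm (gns_space \<omega>) (gns_class \<omega> (\<lambda>n. a * s n)) \<le>
      K * hnorm (gns_space \<omega>) (gns_class \<omega> s)" for a
    using le by blast
  have star: "lim_ip (\<lambda>n. star a * s n) t = lim_ip s (\<lambda>n. a * t n)"
    if "s \<in> gns_cauchy \<omega>" "t \<in> gns_cauchy \<omega>" for a s t
  proof (rule lim_ip_eqI)
    have "(\<lambda>n. ip (s n) (a * t n)) \<longlonglongrightarrow> lim_ip s (\<lambda>n. a * t n)"
      using that by (intro lim_ip cauchy_mult)
    then show "(\<lambda>n. ip (star a * s n) (t n)) \<longlonglongrightarrow> lim_ip s (\<lambda>n. a * t n)"
      by (simp add: ip_def star_mult star_star mult.assoc)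
  qed (use that in \<open>auto intro: cauchy_mult\<close>)
  show ?thesis
    by (unfold_locales, unfold sp)
      (auto simp: hcarrier_gns gns_ops rep_act_gns cauchy_mult le' star distrib_left distrib_right
        mult_scaleC_left mult_scaleC_right mult.assoc)
qed

end

section \<open>Separating points from a closed ideal by irreducible representations\<close>

text \<open>The components of a square root of \<open>s - b\<close> in the unitization. It
  translates positivity there into an identity inside the algebra, to which a representation applies
  directly, even a degenerate one.\<close>

lemma cpos_unitization_square:
  assumes "cpos (of_real s - emb b)"
  shows "\<exists>c r. star c = c \<and> s = r\<^sup>2 \<and> - b = c * c + (2 * r) *\<^sub>R c"
proof -
  obtain k where k: "star k = k" "k * k = of_real s - emb b" using cpos_sqrt[OF assms] by blast
  obtain c l where kc: "k = Unitized c l" by (cases k)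
  have c: "star c = c" and l: "cnj l = l" using k(1) by (simp_all add: kc star_unitization_def)
  define r where "r = Re l"
  have lr: "l = of_real r" using l by (simp add: r_def complex_eq_iff)
  have "k * k = Unitized (c * c + (2 * r) *\<^sub>R c) (of_real (r\<^sup>2))"
    by (simp add: kc times_unitization_def lr scaleC_of_real power2_eq_square)
      (simp add: scaleR_2 flip: scaleR_scaleR)
  moreover have "of_real s - emb b = Unitized (- b) (complex_of_real s)"
    by (simp add: of_real_unitization emb_def minus_unitization_def)
  ultimately have "- b = c * c + (2 * r) *\<^sub>R c" "complex_of_real s = of_real (r\<^sup>2)"
    using k(2) by simp_all
  then show ?thesis using c by (metis of_real_eq_iff)
qed

section \<open>Vector functionals and kernels of representations\<close>

context star_representation
begin

abbreviation "H \<equiv> rep_space \<pi>"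

lemma vector_state_add: "x \<in> hcarrier H \<Longrightarrow> vector_state \<pi> x (a + b) = vector_state \<pi> x a + vector_state \<pi> x b"
  by (simp add: vector_state_def rep_add inner_add_right act_closed)

lemma vector_state_scaleC: "x \<in> hcarrier H \<Longrightarrow> vector_state \<pi> x (c *\<^sub>C a) = c * vector_state \<pi> x a"
  by (simp add: vector_state_def rep_scaleC inner_scale_right act_closed)

lemma vector_state_scaleR: "x \<in> hcarrier H \<Longrightarrow> vector_state \<pi> x (r *\<^sub>R a) = of_real r * vector_state \<pi> x a"
  using vector_state_scaleC[of x "of_real r" a] by (simp add: scaleC_of_real)

lemma vector_state_minus: "x \<in> hcarrier H \<Longrightarrow> vector_state \<pi> x (- a) = - vector_state \<pi> x a"
  using vector_state_scaleC[of x "- 1" a] by (simp add: scaleC_minus_left)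

lemma vector_state_star_mult: "x \<in> hcarrier H \<Longrightarrow>
    vector_state \<pi> x (star a * a) = of_real ((hnorm H (rep_act \<pi> a x))\<^sup>2)"
  using rep_star[of "rep_act \<pi> a x" x "star a"] inner_self[of "rep_act \<pi> a x"]
    rep_star[of x "rep_act \<pi> a x" "star a"]
  by (simp add: vector_state_def rep_mult act_closed star_star)

lemma vector_state_star: "x \<in> hcarrier H \<Longrightarrow> vector_state \<pi> x (star a) = cnj (vector_state \<pi> x a)"
  using rep_star[of x x "star a"] inner_commute[of "rep_act \<pi> a x" x]
  by (simp add: vector_state_def act_closed star_star)

text \<open>Writing \<open>s - b = (c + r)\<^sup>2\<close> in the unitization gives
  \<open>s \<parallel>x\<parallel>\<^sup>2 - \<langle>x | \<pi>(b) x\<rangle> = \<parallel>r x + \<pi>(c) x\<parallel>\<^sup>2\<close>.\<close>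

lemma vector_state_le:
  assumes x: "x \<in> hcarrier H" and pos: "cpos (of_real s - emb b)"
  shows "Re (vector_state \<pi> x b) \<le> s * (hnorm H x)\<^sup>2"
proof -
  obtain c r where c: "star c = c" "s = r\<^sup>2" "- b = c * c + (2 * r) *\<^sub>R c"
    using cpos_unitization_square[OF pos] by blast
  have cx: "rep_act \<pi> c x \<in> hcarrier H" using x by (rule act_closed)
  have e1: "- vector_state \<pi> x b = vector_state \<pi> x (c * c) + of_real (2 * r) * vector_state \<pi> x c"
    using x c(3) by (metis vector_state_minus vector_state_add vector_state_scaleR)
  have e2: "vector_state \<pi> x (c * c) = of_real ((hnorm H (rep_act \<pi> c x))\<^sup>2)"
    using vector_state_star_mult[OF x, of c] c(1) by simp
  have b: "- Re (vector_state \<pi> x b) = (hnorm H (rep_act \<pi> c x))\<^sup>2 + 2 * r * Re (vector_state \<pi> x c)"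
    using arg_cong[OF e1, of Re] e2 by simp
  have "(hnorm H (hadd H (hscale H (of_real r) x) (rep_act \<pi> c x)))\<^sup>2
      = r\<^sup>2 * (hnorm H x)\<^sup>2 + 2 * r * Re (vector_state \<pi> x c) + (hnorm H (rep_act \<pi> c x))\<^sup>2"
    using x cx by (simp add: hnorm_add_sq hnorm_scale inner_scale_left scale_closed power_mult_distrib vector_state_def)
  moreover have "0 \<le> (hnorm H (hadd H (hscale H (of_real r) x) (rep_act \<pi> c x)))\<^sup>2" by simp
  ultimately show ?thesis using b c(2) by simp
qed

text \<open>The bound \<open>K\<close> in \<open>act_bounded\<close> depends on a in an unspecified
  way; the uniform bound comes from \<open>star a * a \<le> (norm a)^2\<close> through
  \<open>vector_state_le\<close>. It is what makes kernels closed.\<close>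

lemma rep_contractive:
  assumes x: "x \<in> hcarrier H" shows "hnorm H (rep_act \<pi> a x) \<le> norm a * hnorm H x"
proof (rule power2_le_imp_le)
  have "cpos (of_real ((norm a)\<^sup>2) - emb (star a * a))"
    using cpos_norm_star_mult_self[of "emb a"] by (simp add: emb_mult emb_star)
  then show "(hnorm H (rep_act \<pi> a x))\<^sup>2 \<le> (norm a * hnorm H x)\<^sup>2"
    using vector_state_le[OF x] x by (fastforce simp: vector_state_star_mult power_mult_distrib)
qed (use x in \<open>simp add: hnorm_nonneg\<close>)

lemma rep_zero: "x \<in> hcarrier H \<Longrightarrow> rep_act \<pi> 0 x = hzero H"
  using rep_contractive[of x 0] hnorm_nonneg[of "rep_act \<pi> 0 x"] hnorm_eq_zero[of "rep_act \<pi> 0 x"]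
  by (simp add: act_closed)

lemma scale_zero: "hscale H c (hzero H) = hzero H"
  using hnorm_scale[of "hzero H" c] hnorm_eq_zero zero_closed scale_closed
  by (metis mult_zero_right)

lemma act_zero: "rep_act \<pi> a (hzero H) = hzero H"
  using rep_contractive[of "hzero H" a] hnorm_eq_zero[of "hzero H"] zero_closed
    hnorm_nonneg[of "rep_act \<pi> a (hzero H)"] hnorm_eq_zero[of "rep_act \<pi> a (hzero H)"]
  by (simp add: act_closed)

lemma act_diff: "x \<in> hcarrier H \<Longrightarrow> y \<in> hcarrier H \<Longrightarrow>
    rep_act \<pi> a (hdiff H x y) = hdiff H (rep_act \<pi> a x) (rep_act \<pi> a y)"
  by (simp add: hdiff_def act_add act_scale scale_closed)

lemma closed_ideal_rep_ker: "closed_ideal (rep_ker \<pi>)"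
  unfolding closed_ideal_def
proof (intro conjI ballI allI)
  show "closed (rep_ker \<pi>)"
  unfolding closed_sequential_limits
  proof (intro allI impI, elim conjE)
    fix s l assume s: "\<forall>n. s n \<in> rep_ker \<pi>" and l: "s \<longlonglongrightarrow> l"
    have "rep_act \<pi> l x = hzero H" if x: "x \<in> hcarrier H" for x
    proof -
      have "hnorm H (rep_act \<pi> l x) \<le> norm (s n - l) * hnorm H x" for n
      proof -
        have "hadd H (rep_act \<pi> (l - s n) x) (rep_act \<pi> (s n) x) = rep_act \<pi> l x"
          using x by (simp flip: rep_add)
        then have "rep_act \<pi> l x = rep_act \<pi> (l - s n) x"
          using s x by (simp add: rep_ker_def add_zero act_closed)
        then show ?thesis using rep_contractive[OF x, of "l - s n"] by (simp add: norm_minus_commute)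
      qed
      moreover have "(\<lambda>n. norm (s n - l) * hnorm H x) \<longlonglongrightarrow> 0"
        using l by (intro tendsto_mult_left_zero tendsto_norm_zero) (simp add: LIM_zero_iff)
      ultimately have "hnorm H (rep_act \<pi> l x) \<le> 0" by (intro LIMSEQ_le_const) auto
      then show ?thesis using x hnorm_nonneg hnorm_eq_zero by (meson act_closed antisym)
    qed
    then show "l \<in> rep_ker \<pi>" by (simp add: rep_ker_def)
  qed
qed (auto simp: rep_ker_def rep_zero rep_add rep_scaleC rep_mult act_zero act_closed add_zero
    zero_closed scale_zero)

end

section \<open>Real parts and upper bounds modulo an ideal\<close>

definition re_part :: "'a::cstar_algebra \<Rightarrow> 'a" where
  "re_part a = (1/2) *\<^sub>R (a + star a)"

lemma star_re_part: "star (re_part a) = re_part a"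
  by (simp add: re_part_def star_scaleR star_add star_star add.commute)

lemma re_part_add: "re_part (a + b) = re_part a + re_part b"
  by (simp add: re_part_def star_add algebra_simps)

lemma re_part_scaleR: "re_part (r *\<^sub>R a) = r *\<^sub>R re_part a"
  by (simp add: re_part_def star_scaleR algebra_simps)

lemma re_part_selfadjoint: "star a = a \<Longrightarrow> re_part a = a"
  by (simp add: re_part_def scaleR_2[symmetric])

lemma re_part_minus: "re_part (- a) = - re_part a"
  using re_part_scaleR[of "- 1" a] by simp

lemma norm_re_part_le: "norm (re_part a) \<le> norm a"
  using norm_triangle_ineq[of a "star a"] by (simp add: re_part_def)

context
  fixes I :: "'a::cstar_algebra set"
  assumes I: "closed_ideal I"
begin

text \<open>The upper bounds of the real part of \<open>a\<close> modulo the ideal; their infimum is the largest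
  value at \<open>a\<close> of the real parts of positive functionals of norm at most one that vanish on the
  ideal.\<close>

definition upper_bounds :: "'a \<Rightarrow> real set" where
  "upper_bounds a = {s. \<exists>i\<in>I. star i = i \<and> cpos (of_real s - emb (re_part a + i))}"

definition numerical_sup :: "'a \<Rightarrow> real" where
  "numerical_sup a = Inf (upper_bounds a)"

lemma upper_boundsI: "i \<in> I \<Longrightarrow> star i = i \<Longrightarrow> cpos (of_real s - emb (re_part a + i)) \<Longrightarrow> s \<in> upper_bounds a"
  by (auto simp: upper_bounds_def)

text \<open>The scalar component of a positive element of the unitization is the square of a real
  number. That bounds never become negative reflects that the zero functional competes as
  well.\<close>

lemma upper_bounds_nonneg: "s \<in> upper_bounds a \<Longrightarrow> 0 \<le> s"
  using cpos_unitization_square unfolding upper_bounds_def by fastforce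

lemma norm_in_upper_bounds: "norm a \<in> upper_bounds a"
  by (rule upper_boundsI[of 0])
    (simp_all add: closed_idealD[OF I] star_re_part norm_re_part_le cpos_norm_diff flip: emb_star)

lemma numerical_sup_le: "s \<in> upper_bounds a \<Longrightarrow> numerical_sup a \<le> s"
  unfolding numerical_sup_def using upper_bounds_nonneg by (intro cInf_lower bdd_belowI[of _ 0]) auto

lemma le_numerical_sup: "(\<And>s. s \<in> upper_bounds a \<Longrightarrow> m \<le> s) \<Longrightarrow> m \<le> numerical_sup a"
  unfolding numerical_sup_def using norm_in_upper_bounds by (intro cInf_greatest) auto

lemma upper_bounds_add:
  assumes "s \<in> upper_bounds a" "t \<in> upper_bounds b" shows "s + t \<in> upper_bounds (a + b)"
proof -
  obtain i j where i: "i \<in> I" "star i = i" "cpos (of_real s - emb (re_part a + i))"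
    and j: "j \<in> I" "star j = j" "cpos (of_real t - emb (re_part b + j))"
    using assms by (auto simp: upper_bounds_def)
  have "cpos (of_real (s + t) - emb (re_part (a + b) + (i + j)))"
    using cpos_add[OF i(3) j(3)] by (simp add: re_part_add emb_add algebra_simps)
  then show ?thesis using i j I by (intro upper_boundsI[of "i + j"]) (auto simp: star_add closed_idealD)
qed

lemma upper_bounds_scaleR:
  assumes "s \<in> upper_bounds a" "0 \<le> r" shows "r * s \<in> upper_bounds (r *\<^sub>R a)"
proof -
  obtain i where i: "i \<in> I" "star i = i" "cpos (of_real s - emb (re_part a + i))"
    using assms by (auto simp: upper_bounds_def)
  have "of_real (r * s) - emb (re_part (r *\<^sub>R a) + r *\<^sub>R i) = r *\<^sub>R (of_real s - emb (re_part a + i))"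
    by (simp add: re_part_scaleR emb_add emb_scaleR of_real_def algebra_simps)
  then have "cpos (of_real (r * s) - emb (re_part (r *\<^sub>R a) + r *\<^sub>R i))"
    using cpos_scaleR[OF i(3) assms(2)] by (simp only:)
  then show ?thesis using i I by (intro upper_boundsI[of "r *\<^sub>R i"]) (auto simp: star_scaleR closed_idealD)
qed

lemma sublinear_numerical_sup: "sublinear numerical_sup"
  unfolding sublinear_def
proof (intro conjI allI impI)
  fix a b
  have "numerical_sup (a + b) - numerical_sup a \<le> numerical_sup b"
  proof (rule le_numerical_sup)
    fix t assume t: "t \<in> upper_bounds b"
    have "numerical_sup (a + b) - t \<le> numerical_sup a"
      by (rule le_numerical_sup) (use numerical_sup_le[OF upper_bounds_add[OF _ t]] in fastforce)
    then show "numerical_sup (a + b) - numerical_sup a \<le> t" by simp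
  qed
  then show "numerical_sup (a + b) \<le> numerical_sup a + numerical_sup b" by simp
next
  fix r :: real and a assume r: "0 \<le> r"
  have le: "numerical_sup (r *\<^sub>R a) \<le> r * numerical_sup a" if r: "0 < r" for r a
  proof -
    have "numerical_sup (r *\<^sub>R a) / r \<le> numerical_sup a"
    proof (rule le_numerical_sup)
      fix s assume "s \<in> upper_bounds a"
      then have "numerical_sup (r *\<^sub>R a) \<le> r * s" using r by (intro numerical_sup_le upper_bounds_scaleR) auto
      then show "numerical_sup (r *\<^sub>R a) / r \<le> s" using r by (simp add: field_simps)
    qed
    then show ?thesis using r by (simp add: field_simps)
  qed
  show "numerical_sup (r *\<^sub>R a) = r * numerical_sup a"
  proof (cases "r = 0")
    case True
    have "0 \<in> upper_bounds (0::'a)" using norm_in_upper_bounds[of 0] by simp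
    then have "numerical_sup 0 = 0"
      by (intro antisym numerical_sup_le le_numerical_sup upper_bounds_nonneg)
    then show ?thesis using True by simp
  next
    case False
    have "numerical_sup (inverse r *\<^sub>R (r *\<^sub>R a)) \<le> inverse r * numerical_sup (r *\<^sub>R a)"
      using r False by (intro le) auto
    then have "r * numerical_sup a \<le> numerical_sup (r *\<^sub>R a)" using r False by (simp add: field_simps)
    then show ?thesis using le[of r a] r False by simp
  qed
qed

lemma infdist_le_numerical_sup: "(infdist a I)\<^sup>2 \<le> numerical_sup (star a * a)"
proof (rule le_numerical_sup)
  fix s assume s: "s \<in> upper_bounds (star a * a)"
  then obtain i where i: "i \<in> I" "star i = i" "cpos (of_real s - emb (re_part (star a * a) + i))"
    by (auto simp: upper_bounds_def)
  then show "(infdist a I)\<^sup>2 \<le> s"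
    using infdist_ideal_le[OF I i(1,2) upper_bounds_nonneg[OF s]]
    by (simp add: re_part_selfadjoint star_mult star_star emb_add diff_diff_eq)
qed

text \<open>Any c above the squared norm is allowed, since upper bounds are nonnegative. This lets
  two orthogonal vectors be given weights that add up to 1 although their squared norms may
  not.\<close>

lemma vector_state_le_numerical_sup:
  assumes \<pi>: "star_representation \<pi>" and x: "x \<in> hcarrier (rep_space \<pi>)"
    and van: "\<And>i. i \<in> I \<Longrightarrow> vector_state \<pi> x i = 0"
    and c: "0 < c" "(hnorm (rep_space \<pi>) x)\<^sup>2 \<le> c"
  shows "Re (vector_state \<pi> x a) / c \<le> numerical_sup a"
proof (rule le_numerical_sup)
  interpret star_representation \<pi> by (rule \<pi>)
  fix s assume s: "s \<in> upper_bounds a"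
  then obtain i where i: "i \<in> I" "cpos (of_real s - emb (re_part a + i))"
    by (auto simp: upper_bounds_def)
  have "Re (vector_state \<pi> x a) = Re (vector_state \<pi> x (re_part a + i))"
    using x van[OF i(1)]
    by (simp add: vector_state_add re_part_def vector_state_scaleR vector_state_star)
  also have "\<dots> \<le> s * (hnorm (rep_space \<pi>) x)\<^sup>2" by (rule vector_state_le[OF x i(2)])
  also have "\<dots> \<le> s * c" using c upper_bounds_nonneg[OF s] by (intro mult_left_mono)
  finally show "Re (vector_state \<pi> x a) / c \<le> s" using c by (simp add: field_simps)
qed

end

section \<open>Functionals dominated by \<open>numerical_sup\<close>\<close>

locale ideal_functional =
  fixes I :: "'a::cstar_algebra set" and f :: "'a \<Rightarrow> real"
  assumes I: "closed_ideal I" and lin: "linear f" and le: "f \<le> numerical_sup I"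
begin

lemma f_le: "s \<in> upper_bounds I x \<Longrightarrow> f x \<le> s"
  using le numerical_sup_le[OF I] by (meson le_funE order_trans)

text \<open>Upper bounds see only the real part, so 0 bounds both x and \<open>- x\<close>.\<close>

lemma f_re_part_zero: "re_part x = 0 \<Longrightarrow> f x = 0"
proof -
  assume x: "re_part x = 0"
  have "0 \<in> upper_bounds I x" "0 \<in> upper_bounds I (- x)"
    using x by (auto intro!: upper_boundsI[OF I, of 0] simp: closed_idealD[OF I] re_part_minus)
  then have "f x \<le> 0" "f (- x) \<le> 0" by (auto intro: f_le)
  then show ?thesis using lin by (simp add: linear_neg)
qed

lemma f_star: "f (star x) = f x"
proof -
  have "f (x - star x) = 0"
    by (rule f_re_part_zero) (simp add: re_part_def star_diff star_star)
  then show ?thesis using lin by (simp add: linear_diff)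
qed

lemma f_ideal: "i \<in> I \<Longrightarrow> star i = i \<Longrightarrow> f i = 0"
proof -
  assume i: "i \<in> I" "star i = i"
  have "0 \<in> upper_bounds I i"
    using i by (intro upper_boundsI[OF I, of "- i"]) (auto simp: closed_idealD[OF I] re_part_selfadjoint)
  moreover have "0 \<in> upper_bounds I (- i)"
    using i by (intro upper_boundsI[OF I, of i]) (auto simp: re_part_selfadjoint)
  ultimately have "f i \<le> 0" "f (- i) \<le> 0" by (auto intro: f_le)
  then show ?thesis using lin by (simp add: linear_neg)
qed

lemma f_nonneg: "cpos (emb h) \<Longrightarrow> star h = h \<Longrightarrow> 0 \<le> f h"
proof -
  assume h: "cpos (emb h)" "star h = h"
  then have "0 \<in> upper_bounds I (- h)"
    by (intro upper_boundsI[OF I, of 0]) (auto simp: closed_idealD[OF I] re_part_selfadjoint emb_minus)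
  then have "f (- h) \<le> 0" by (rule f_le)
  then show ?thesis using lin by (simp add: linear_neg)
qed

text \<open>Expand \<open>star (t - x) * (t - x)\<close> in the unitization with
  \<open>t = f x\<close>. It does the work of Cauchy-Schwarz against a unit and makes the functional
  continuous for its own GNS seminorm.\<close>

lemma f_square_le: "(f x)\<^sup>2 \<le> f (star x * x)"
proof -
  define t where "t = f x"
  have "t\<^sup>2 \<in> upper_bounds I ((2 * t) *\<^sub>R x - star x * x)"
  proof (rule upper_boundsI[OF I, of 0])
    have r: "re_part ((2 * t) *\<^sub>R x - star x * x) = t *\<^sub>R x + t *\<^sub>R star x - star x * x"
    proof -
      have "re_part ((2 * t) *\<^sub>R x - star x * x) = (2 * t) *\<^sub>R re_part x - star x * x"
        using re_part_add[of "(2 * t) *\<^sub>R x" "- (star x * x)"]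
        by (simp add: re_part_scaleR re_part_minus re_part_selfadjoint star_mult star_star)
      then show ?thesis by (simp add: re_part_def scaleR_add_right)
    qed
    have "of_real (t\<^sup>2) - emb (re_part ((2 * t) *\<^sub>R x - star x * x) + 0) =
        star (of_real t - emb x) * (of_real t - emb x)"
      unfolding r by (simp add: emb_add emb_diff emb_scaleR emb_mult emb_star star_diff algebra_simps
        power2_eq_square scaleR_conv_of_real) (simp add: of_real_def)
    then show "cpos (of_real (t\<^sup>2) - emb (re_part ((2 * t) *\<^sub>R x - star x * x) + 0))"
      by (simp only: cpos_star_mult_self)
  qed (simp_all add: closed_idealD[OF I])
  then have "f ((2 * t) *\<^sub>R x - star x * x) \<le> t\<^sup>2" by (rule f_le)
  then have "2 * t * t - f (star x * x) \<le> t\<^sup>2"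
    using lin by (simp add: linear_diff linear_scale t_def)
  then show ?thesis by (simp add: t_def power2_eq_square)
qed

text \<open>The usual passage from a real functional to the complex linear one with real part
  f.\<close>

definition \<omega> :: "'a \<Rightarrow> complex" where
  "\<omega> a = of_real (f a) - \<i> * of_real (f (\<i> *\<^sub>C a))"

lemma Re_\<omega>: "Re (\<omega> a) = f a"
  by (simp add: \<omega>_def)

lemma f_scaleC: "f (c *\<^sub>C x) = Re c * f x + Im c * f (\<i> *\<^sub>C x)"
proof -
  have "c = of_real (Re c) + of_real (Im c) * \<i>" by (simp add: complex_eq_iff)
  then have "c *\<^sub>C x = Re c *\<^sub>R x + Im c *\<^sub>R (\<i> *\<^sub>C x)"
    by (metis scaleC_add_left scaleC_of_real scaleC_scaleC)
  then show ?thesis using lin by (simp add: linear_add linear_scale)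
qed

sublocale positive_functional \<omega>
proof
  fix x y a :: 'a and c :: complex
  show "\<omega> (x + y) = \<omega> x + \<omega> y"
    using lin by (simp add: \<omega>_def scaleC_add_right linear_add algebra_simps)
  show "\<omega> (c *\<^sub>C x) = c * \<omega> x"
    using f_scaleC[of c x] f_scaleC[of "\<i> * c" x] by (simp add: \<omega>_def scaleC_scaleC complex_eq_iff)
  show "\<omega> (star x) = cnj (\<omega> x)"
    using f_star[of x] f_star[of "- \<i> *\<^sub>C x"] lin
    by (simp add: \<omega>_def star_scaleC scaleC_minus_left linear_neg complex_eq_iff)
  show "0 \<le> Re (\<omega> (star x * x))"
    unfolding Re_\<omega> by (intro f_nonneg) (simp_all add: emb_mult emb_star cpos_star_mult_self star_mult star_star)
  show "Re (\<omega> (star (a * x) * (a * x))) \<le> (norm a)\<^sup>2 * Re (\<omega> (star x * x))"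
  proof -
    have "0 \<le> f ((norm a)\<^sup>2 *\<^sub>R (star x * x) - star (a * x) * (a * x))"
    proof (rule f_nonneg)
      have "cpos (star (emb x) * (of_real ((norm (emb a))\<^sup>2) - star (emb a) * emb a) * emb x)"
        by (intro cpos_conj cpos_norm_star_mult_self)
      moreover have "emb ((norm a)\<^sup>2 *\<^sub>R (star x * x) - star (a * x) * (a * x)) =
          star (emb x) * (of_real ((norm (emb a))\<^sup>2) - star (emb a) * emb a) * emb x"
        by (simp add: emb_diff emb_scaleR emb_mult emb_star star_mult left_diff_distrib right_diff_distrib mult.assoc)
          (simp add: of_real_def flip: of_real_power)
      ultimately show "cpos (emb ((norm a)\<^sup>2 *\<^sub>R (star x * x) - star (a * x) * (a * x)))" by (simp only:)
    qed (simp add: star_diff star_scaleR star_mult star_star)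
    then show ?thesis using lin by (simp add: Re_\<omega> linear_diff linear_scale)
  qed
qed

text \<open>A phase makes the value real and nonnegative without changing \<open>star x * x\<close>,
  so \<open>f_square_le\<close> applies.\<close>

lemma cmod_\<omega>_le: "cmod (\<omega> x) \<le> sn x"
proof -
  obtain c where c: "cmod c = 1" "c * \<omega> x = of_real (cmod (\<omega> x))"
  proof (cases "\<omega> x = 0")
    case False
    have "cnj (\<omega> x) * \<omega> x = of_real (cmod (\<omega> x)) * of_real (cmod (\<omega> x))"
      using complex_norm_square[of "\<omega> x"] by (simp add: power2_eq_square mult.commute)
    then show ?thesis
      using False by (intro that[of "cnj (\<omega> x) / of_real (cmod (\<omega> x))"]) (simp_all add: norm_divide)
  qed (use that[of 1] in simp)
  have "f (c *\<^sub>C x) = cmod (\<omega> x)" using c(2) by (simp add: scale flip: Re_\<omega>)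
  moreover have "star (c *\<^sub>C x) * (c *\<^sub>C x) = star x * x"
    using c(1) complex_norm_square[of c]
    by (simp add: star_scaleC mult_scaleC_left mult_scaleC_right scaleC_scaleC mult.commute)
  ultimately have "(cmod (\<omega> x))\<^sup>2 \<le> f (star x * x)" using f_square_le[of "c *\<^sub>C x"] by simp
  then show ?thesis by (simp add: sn_def ip_def Re_\<omega> real_le_rsqrt)
qed

end

section \<open>The cyclic vector\<close>

context positive_functional
begin

text \<open>The terms of s, taken as constant sequences, approximate its class: the image of the
  algebra is dense.\<close>

lemma gns_dense:
  assumes s: "s \<in> gns_cauchy \<omega>"
  shows "(\<lambda>n. hnorm (gns_space \<omega>) (hdiff (gns_space \<omega>) (gns_class \<omega> (\<lambda>k. s n)) (gns_class \<omega> s))) \<longlonglongrightarrow> 0"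
proof (rule LIMSEQ_I)
  interpret hilbert_space "gns_space \<omega>" by (rule hilbert_space_gns)
  fix e :: real assume e: "e > 0"
  obtain N where N: "\<forall>m\<ge>N. \<forall>n\<ge>N. sn (s m - s n) < e / 2"
    using s e unfolding gns_cauchy_iff by (meson half_gt_zero)
  have "norm (hnorm (gns_space \<omega>) (hdiff (gns_space \<omega>) (gns_class \<omega> (\<lambda>k. s n)) (gns_class \<omega> s)) - 0) < e"
    if n: "n \<ge> N" for n
  proof -
    have c: "(\<lambda>k. s n - s k) \<in> gns_cauchy \<omega>" using s by (simp add: cauchy_diff)
    have "hnorm (gns_space \<omega>) (gns_class \<omega> (\<lambda>k. s n - s k)) \<le> e / 2"
      using N n by (intro hnorm_gns_le[OF c, of N]) (auto intro: less_imp_le)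
    moreover have "0 \<le> hnorm (gns_space \<omega>) (gns_class \<omega> (\<lambda>k. s n - s k))"
      using c by (intro hnorm_nonneg) (simp add: hcarrier_gns)
    ultimately show ?thesis using s e by (simp add: hdiff_gns)
  qed
  then show "\<exists>N. \<forall>n\<ge>N. norm (hnorm (gns_space \<omega>) (hdiff (gns_space \<omega>) (gns_class \<omega> (\<lambda>k. s n)) (gns_class \<omega> s)) - 0) < e"
    by blast
qed

text \<open>By \<open>bd\<close> the functional extends continuously to the GNS space, and Riesz
  represents it by \<xi>. That a sends \<xi> to its own class is tested against an arbitrary vector
  by moving a across as \<open>star a\<close>.\<close>

lemma gns_cyclic_vector:
  assumes bd: "\<And>x. cmod (\<omega> x) \<le> sn x"
  shows "\<exists>\<xi>\<in>hcarrier (gns_space \<omega>). hnorm (gns_space \<omega>) \<xi> \<le> 1 \<and>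
    (\<forall>a. hinner (gns_space \<omega>) \<xi> (gns_class \<omega> (\<lambda>k. a)) = \<omega> a \<and>
      rep_act (gns_rep \<omega>) a \<xi> = gns_class \<omega> (\<lambda>k. a))"
proof -
  let ?H = "gns_space \<omega>"
  interpret hilbert_space ?H by (rule hilbert_space_gns)
  interpret R: star_representation "gns_rep \<omega>" by (rule star_representation_gns)
  have sp: "rep_space (gns_rep \<omega>) = ?H" by (simp add: gns_rep_def)
  \<comment> \<open>The choice of representative is arbitrary; the fact proved next for \<Lambda>
    shows that every representative gives the same limit.\<close>
  define \<Lambda> where "\<Lambda> X = lim (\<lambda>n. \<omega> ((SOME s. s \<in> gns_cauchy \<omega> \<and> X = gns_class \<omega> s) n))" for X
  have conv: "convergent (\<lambda>n. \<omega> (s n))" if s: "s \<in> gns_cauchy \<omega>" for s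
  proof -
    have "Cauchy (\<lambda>n. \<omega> (s n))"
    proof (rule CauchyI)
      fix e :: real assume "e > 0"
      then obtain N where N: "\<forall>m\<ge>N. \<forall>n\<ge>N. sn (s m - s n) < e"
        using s unfolding gns_cauchy_iff by blast
      have "norm (\<omega> (s m) - \<omega> (s n)) \<le> sn (s m - s n)" for m n using bd[of "s m - s n"] by (simp add: diff)
      then show "\<exists>M. \<forall>m\<ge>M. \<forall>n\<ge>M. norm (\<omega> (s m) - \<omega> (s n)) < e" using N by (meson le_less_trans)
    qed
    then show ?thesis by (simp add: Cauchy_convergent_iff)
  qed
  have \<Lambda>: "(\<lambda>n. \<omega> (s n)) \<longlonglongrightarrow> \<Lambda> (gns_class \<omega> s)" if s: "s \<in> gns_cauchy \<omega>" for s
  proof -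
    define t where "t = (SOME t. t \<in> gns_cauchy \<omega> \<and> gns_class \<omega> s = gns_class \<omega> t)"
    have t: "t \<in> gns_cauchy \<omega>" "gns_class \<omega> s = gns_class \<omega> t"
      unfolding t_def using someI_ex[of "\<lambda>t. t \<in> gns_cauchy \<omega> \<and> gns_class \<omega> s = gns_class \<omega> t"] s by blast+
    have "(\<lambda>n. \<omega> (t n)) \<longlonglongrightarrow> \<Lambda> (gns_class \<omega> s)"
      using conv[OF t(1)] unfolding \<Lambda>_def t_def[symmetric] by (simp add: convergent_LIMSEQ_iff)
    moreover have "(\<lambda>n. \<omega> (s n) - \<omega> (t n)) \<longlonglongrightarrow> 0"
    proof (rule Lim_null_comparison[of _ "\<lambda>n. sn (s n - t n)"])
      show "(\<lambda>n. sn (s n - t n)) \<longlonglongrightarrow> 0" using t s by (simp add: gns_class_eq_iff)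
      show "\<forall>\<^sub>F n in sequentially. norm (\<omega> (s n) - \<omega> (t n)) \<le> sn (s n - t n)"
        using bd by (intro always_eventually allI) (simp flip: diff)
    qed
    ultimately show ?thesis using tendsto_add[of "\<lambda>n. \<omega> (s n) - \<omega> (t n)" 0] by fastforce
  qed
  have "\<exists>\<xi>\<in>hcarrier ?H. hnorm ?H \<xi> \<le> 1 \<and> (\<forall>v\<in>hcarrier ?H. \<Lambda> v = hinner ?H \<xi> v)"
  proof (rule riesz_representation)
    fix v w c assume "v \<in> hcarrier ?H"
    then obtain s where s: "s \<in> gns_cauchy \<omega>" "v = gns_class \<omega> s" by (auto simp: hcarrier_gns)
    show "\<Lambda> (hscale ?H c v) = c * \<Lambda> v"
      using \<Lambda>[OF cauchy_scale[OF s(1), of c]] tendsto_mult_left[OF \<Lambda>[OF s(1)], of c] LIMSEQ_unique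
      by (auto simp: s hscale_gns scale)
    show "cmod (\<Lambda> v) \<le> hnorm ?H v"
      using LIMSEQ_le[OF tendsto_norm[OF \<Lambda>[OF s(1)]] hnorm_gns[OF s(1)]] bd by (auto simp: s)
    assume "w \<in> hcarrier ?H"
    then obtain t where t: "t \<in> gns_cauchy \<omega>" "w = gns_class \<omega> t" by (auto simp: hcarrier_gns)
    show "\<Lambda> (hadd ?H v w) = \<Lambda> v + \<Lambda> w"
      using \<Lambda>[OF cauchy_add[OF s(1) t(1)]] tendsto_add[OF \<Lambda>[OF s(1)] \<Lambda>[OF t(1)]] LIMSEQ_unique
      by (auto simp: s t hadd_gns add)
  qed
  then obtain \<xi> where \<xi>: "\<xi> \<in> hcarrier ?H" "hnorm ?H \<xi> \<le> 1" "\<And>v. v \<in> hcarrier ?H \<Longrightarrow> \<Lambda> v = hinner ?H \<xi> v"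
    by blast
  have in1: "hinner ?H \<xi> (gns_class \<omega> (\<lambda>k. a)) = \<omega> a" for a
  proof -
    have "\<Lambda> (gns_class \<omega> (\<lambda>k. a)) = \<omega> a" using \<Lambda>[OF cauchy_const, of a] LIMSEQ_unique tendsto_const by blast
    then show ?thesis using \<xi>(3)[of "gns_class \<omega> (\<lambda>k. a)"] by (simp add: hcarrier_gns)
  qed
  have "rep_act (gns_rep \<omega>) a \<xi> = gns_class \<omega> (\<lambda>k. a)" for a
  proof (rule inner_eqI)
    show "rep_act (gns_rep \<omega>) a \<xi> \<in> hcarrier ?H" using R.act_closed \<xi>(1) by (simp add: sp)
    fix z assume z: "z \<in> hcarrier ?H"
    then obtain s where s: "s \<in> gns_cauchy \<omega>" "z = gns_class \<omega> s" by (auto simp: hcarrier_gns)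
    have az: "rep_act (gns_rep \<omega>) (star a) z \<in> hcarrier ?H" using R.act_closed z by (simp add: sp)
    have "hinner ?H z (rep_act (gns_rep \<omega>) a \<xi>) = hinner ?H (rep_act (gns_rep \<omega>) (star a) z) \<xi>"
      using R.rep_star[of z \<xi> a] z \<xi>(1) by (simp add: sp)
    also have "\<dots> = cnj (\<Lambda> (rep_act (gns_rep \<omega>) (star a) z))"
      using inner_commute[OF \<xi>(1) az] \<xi>(3)[OF az] by simp
    also have "\<dots> = lim_ip s (\<lambda>k. a)"
    proof -
      have "(\<lambda>n. cnj (\<omega> (star a * s n))) \<longlonglongrightarrow> cnj (\<Lambda> (rep_act (gns_rep \<omega>) (star a) z))"
        using \<Lambda>[OF cauchy_mult[OF s(1), of "star a"]] by (simp add: s rep_act_gns tendsto_cnj)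
      then have "(\<lambda>n. ip (s n) a) \<longlonglongrightarrow> cnj (\<Lambda> (rep_act (gns_rep \<omega>) (star a) z))"
        by (simp add: ip_def star_mult star_star flip: hermitian)
      then show ?thesis using lim_ip[OF s(1) cauchy_const, of a] LIMSEQ_unique by blast
    qed
    also have "\<dots> = hinner ?H z (gns_class \<omega> (\<lambda>k. a))" by (simp add: s hinner_gns)
    finally show "hinner ?H z (rep_act (gns_rep \<omega>) a \<xi>) = hinner ?H z (gns_class \<omega> (\<lambda>k. a))" .
  qed (simp add: hcarrier_gns)
  then show ?thesis using \<xi> in1 by blast
qed

end

section \<open>Irreducibility from extremality\<close>

context ideal_functional
begin

abbreviation "K \<equiv> gns_space \<omega>"
abbreviation "\<rho> \<equiv> gns_rep \<omega>"

lemma rep_space_\<rho>: "rep_space \<rho> = K"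
  by (simp add: gns_rep_def)

text \<open>\<open>f_ideal\<close> covers the self-adjoint elements of the ideal, and
  \<open>star (i * s n) * (i * s n)\<close> is one of them.\<close>

lemma ideal_subset_rep_ker: "I \<subseteq> rep_ker \<rho>"
proof
  fix i assume i: "i \<in> I"
  have "rep_act \<rho> i x = hzero K" if x: "x \<in> hcarrier K" for x
  proof -
    obtain s where s: "s \<in> gns_cauchy \<omega>" "x = gns_class \<omega> s" using x by (auto simp: hcarrier_gns)
    have "sn (i * s n) = 0" for n
    proof -
      have "f (star (i * s n) * (i * s n)) = 0"
        using i I by (intro f_ideal) (simp_all add: closed_idealD star_mult star_star)
      then show ?thesis by (simp add: sn_def ip_def Re_\<omega>)
    qed
    then show ?thesis using s by (simp add: rep_act_gns hzero_gns gns_class_eq_iff cauchy_mult)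
  qed
  then show "i \<in> rep_ker \<rho>" by (simp add: rep_ker_def rep_space_\<rho>)
qed

text \<open>Projecting the cyclic vector to an invariant subspace and to its complement would split \<open>f\<close>
  into proportional parts; the projections of the cyclic vector then have proportional
  \<open>\<parallel>\<pi>(a) y\<parallel>\<close> and \<open>\<parallel>\<pi>(a) v\<parallel>\<close> for all \<open>a\<close>, which fails when \<open>\<pi>(a\<^sub>n) \<xi> \<rightarrow> y\<close>.\<close>

lemma irreducible_gns:
  assumes nz: "f (star a * a) > 0"
    and ext: "\<And>g h t. linear g \<Longrightarrow> linear h \<Longrightarrow> g \<le> numerical_sup I \<Longrightarrow> h \<le> numerical_sup I \<Longrightarrow>
      0 < t \<Longrightarrow> t < 1 \<Longrightarrow> f = (\<lambda>x. t * g x + (1 - t) * h x) \<Longrightarrow> g = f \<and> h = f"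
  shows "irreducible_rep \<rho> \<and> a \<notin> rep_ker \<rho>"
proof -
  interpret hilbert_space K by (rule hilbert_space_gns)
  interpret R: star_representation \<rho> by (rule star_representation_gns)
  note R' = R.act_closed[unfolded rep_space_\<rho>]
  obtain \<xi> where \<xi>: "\<xi> \<in> hcarrier K" "hnorm K \<xi> \<le> 1"
    "\<And>b. hinner K \<xi> (gns_class \<omega> (\<lambda>k. b)) = \<omega> b" "\<And>b. rep_act \<rho> b \<xi> = gns_class \<omega> (\<lambda>k. b)"
    using gns_cyclic_vector[OF cmod_\<omega>_le] by blast
  have "rep_act \<rho> a \<xi> \<noteq> hzero K"
  proof
    assume "rep_act \<rho> a \<xi> = hzero K"
    then have "sn a = 0" using \<xi>(4)[of a] hnorm_gns_const[of a] hnorm_eq_zero zero_closed by metis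
    then show False using nz by (simp add: sn_def ip_def Re_\<omega>)
  qed
  then have ak: "a \<notin> rep_ker \<rho>" and nzr: "rep_nonzero_on \<rho> UNIV"
    using \<xi>(1) by (auto simp: rep_ker_def rep_nonzero_on_def rep_space_\<rho>)
  have "C = {hzero K} \<or> C = hcarrier K"
    if C: "closed_hsubspace K C" and inv: "\<And>b x. x \<in> C \<Longrightarrow> rep_act \<rho> b x \<in> C" for C
  proof -
    have CK: "x \<in> hcarrier K" if "x \<in> C" for x using C that by (auto simp: closed_hsubspace_def)
    have Ccl: "x \<in> C" if "\<And>n. s n \<in> C" "x \<in> hcarrier K" "(\<lambda>n. hnorm K (hdiff K (s n) x)) \<longlonglongrightarrow> 0" for s :: "nat \<Rightarrow> _" and x
      using C that unfolding closed_hsubspace_def by blast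
    obtain y where y: "y \<in> C" "\<And>k. k \<in> C \<Longrightarrow> hinner K k (hdiff K \<xi> y) = 0"
      using orthogonal_decomposition[OF C \<xi>(1)] by blast
    define v where "v = hdiff K \<xi> y"
    have v: "v \<in> hcarrier K" and yK: "y \<in> hcarrier K" using \<xi>(1) y CK by (auto simp: v_def closed)
    have perp: "hinner K k (rep_act \<rho> b v) = 0" if k: "k \<in> C" for k b
      \<comment> \<open>Invariance of C passes to its orthogonal complement through
        \<open>star b\<close>.\<close>
      using R.rep_star[of k v b] y(2)[OF inv[OF k, of "star b"]] v CK[OF k] by (simp add: rep_space_\<rho> v_def)
    have perp': "hinner K (rep_act \<rho> b v) k = 0" if k: "k \<in> C" for k b
      using inner_commute[of k "rep_act \<rho> b v"] perp[OF k] CK[OF k] R'[OF v] by simp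
    have xyv: "\<xi> = hadd K y v"
      using \<xi>(1) yK v by (intro inner_eqI) (simp_all add: v_def closed inner_simps)
    have act: "rep_act \<rho> b \<xi> = hadd K (rep_act \<rho> b y) (rep_act \<rho> b v)" for b
      unfolding xyv using R.act_add yK v by (simp add: rep_space_\<rho>)
    consider "y = hzero K" | "v = hzero K" | "y \<noteq> hzero K" "v \<noteq> hzero K" by blast
    then show ?thesis
    proof cases
      case 1
      \<comment> \<open>Here \<xi> = v, so the dense orbit of \<xi> is orthogonal to C.\<close>
      have "k = hzero K" if k: "k \<in> C" for k
      proof -
        obtain s where s: "s \<in> gns_cauchy \<omega>" "k = gns_class \<omega> s" using CK[OF k] by (auto simp: hcarrier_gns)
        have v\<xi>: "v = \<xi>" using 1 xyv v \<xi>(1) by (metis add_commute add_zero zero_closed)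
        have "lim_ip s s = 0"
        proof (rule LIMSEQ_unique)
          show "(\<lambda>n. ip (s n) (s n)) \<longlonglongrightarrow> lim_ip s s" using s by (intro lim_ip)
          have kn: "hinner K k (gns_class \<omega> (\<lambda>j. s n)) = 0" for n
            using perp[OF k, of "s n"] by (simp add: v\<xi> \<xi>(4))
          have "cmod (hinner K k k) \<le> 0"
          proof (rule LIMSEQ_le_const)
            show "(\<lambda>n. hnorm K k * hnorm K (hdiff K (gns_class \<omega> (\<lambda>j. s n)) k)) \<longlonglongrightarrow> 0"
              unfolding s(2) by (rule tendsto_mult_right_zero[OF gns_dense[OF s(1)]])
            have "cmod (hinner K k k) \<le> hnorm K k * hnorm K (hdiff K (gns_class \<omega> (\<lambda>j. s n)) k)" for n
            proof -
              have c: "gns_class \<omega> (\<lambda>j. s n) \<in> hcarrier K" by (simp add: hcarrier_gns)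
              have "hinner K k (hdiff K (gns_class \<omega> (\<lambda>j. s n)) k) = - hinner K k k"
                using c kn CK[OF k] by (simp add: inner_simps)
              then show ?thesis
                using cauchy_schwarz[OF CK[OF k] diff_closed[OF c CK[OF k]]] by simp
            qed
            then show "\<exists>N. \<forall>n\<ge>N. cmod (hinner K k k) \<le> hnorm K k * hnorm K (hdiff K (gns_class \<omega> (\<lambda>j. s n)) k)"
              by blast
          qed
          then have "lim_ip s s = 0" using s by (simp add: hinner_gns)
          then show "(\<lambda>n. ip (s n) (s n)) \<longlonglongrightarrow> 0" using lim_ip[OF s(1) s(1)] by simp
        qed
        then show ?thesis using lim_ip_definite[OF s(1)] by (simp add: s hzero_gns)
      qed
      moreover have "hzero K \<in> C" using C by (simp add: closed_hsubspace_def)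
      ultimately show ?thesis by blast
    next
      case 2
      then have \<xi>C: "\<xi> \<in> C" using xyv y(1) yK add_zero by simp
      have "x \<in> C" if x: "x \<in> hcarrier K" for x
      proof -
        obtain s where s: "s \<in> gns_cauchy \<omega>" "x = gns_class \<omega> s" using x by (auto simp: hcarrier_gns)
        have "gns_class \<omega> (\<lambda>k. s n) \<in> C" for n using inv[OF \<xi>C, of "s n"] by (simp add: \<xi>(4))
        then show ?thesis using x gns_dense[OF s(1)]
          by (intro Ccl[of "\<lambda>n. gns_class \<omega> (\<lambda>k. s n)" x]) (simp_all add: s)
      qed
      then show ?thesis using CK by blast
    next
      case 3
      \<comment> \<open>The weight of y. The vector v receives \<open>1 - \<tau>\<close>, which may
        exceed its squared norm because \<xi> is only known to lie in the unit ball.\<close>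
      define \<tau> where "\<tau> = (hnorm K y)\<^sup>2"
      have pos: "0 < hnorm K y" "0 < hnorm K v"
        using 3 yK v by (metis hnorm_eq_zero hnorm_nonneg order_le_less)+
      have "hinner K y v = 0" using y by (simp add: v_def)
      then have "(hnorm K \<xi>)\<^sup>2 = (hnorm K y)\<^sup>2 + (hnorm K v)\<^sup>2"
        unfolding xyv using yK v by (simp add: hnorm_add_sq)
      moreover have "(hnorm K \<xi>)\<^sup>2 \<le> 1" using \<xi>(1,2) by (simp add: power_le_one hnorm_nonneg)
      ultimately have sum: "\<tau> + (hnorm K v)\<^sup>2 \<le> 1" by (simp add: \<tau>_def)
      have v2: "0 < (hnorm K v)\<^sup>2" and \<tau>0: "0 < \<tau>" using pos by (auto simp: \<tau>_def)
      have \<tau>1: "\<tau> < 1" using sum v2 by linarith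
      define g where "g b = Re (vector_state \<rho> y b) / \<tau>" for b
      define h where "h b = Re (vector_state \<rho> v b) / (1 - \<tau>)" for b
      have van: "vector_state \<rho> x i = 0" if "x \<in> hcarrier K" "i \<in> I" for x i
        using ideal_subset_rep_ker that inner_zero_right
        by (auto simp: vector_state_def rep_ker_def rep_space_\<rho>)
      have lin_vs: "linear (\<lambda>b. Re (vector_state \<rho> x b) / c)" if "x \<in> hcarrier K" for x c
        using that by (intro linearI)
          (simp_all add: R.vector_state_add R.vector_state_scaleR rep_space_\<rho> add_divide_distrib)
      have "g \<le> numerical_sup I"
        unfolding g_def using yK van \<tau>0
        by (intro le_funI vector_state_le_numerical_sup[OF I star_representation_gns])
          (auto simp: rep_space_\<rho> \<tau>_def)
      moreover have "h \<le> numerical_sup I"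
        unfolding h_def using v van \<tau>1 sum
        by (intro le_funI vector_state_le_numerical_sup[OF I star_representation_gns])
          (auto simp: rep_space_\<rho>)
      moreover have "f = (\<lambda>x. \<tau> * g x + (1 - \<tau>) * h x)"
      proof
        fix b
        have "\<omega> b = hinner K \<xi> (rep_act \<rho> b \<xi>)" by (simp add: \<xi>)
        also have "\<dots> = hinner K (hadd K y v) (hadd K (rep_act \<rho> b y) (rep_act \<rho> b v))"
          by (simp add: act flip: xyv)
        also have "\<dots> = vector_state \<rho> y b + vector_state \<rho> v b"
        proof -
          have "hinner K v (rep_act \<rho> b y) = 0"
            using inner_commute[of "rep_act \<rho> b y" v] y(2)[OF inv[OF y(1), of b]] v R'[OF yK]
            by (simp add: v_def)
          then show ?thesis using yK v R' perp[OF y(1), of b]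
            by (simp add: inner_simps closed vector_state_def rep_space_\<rho>)
        qed
        finally have "f b = Re (vector_state \<rho> y b) + Re (vector_state \<rho> v b)"
          by (simp flip: Re_\<omega>)
        then show "f b = \<tau> * g b + (1 - \<tau>) * h b" using \<tau>0 \<tau>1 by (simp add: g_def h_def)
      qed
      ultimately have "h = f"
        using ext[of g h \<tau>] \<tau>0 \<tau>1 lin_vs yK v unfolding g_def h_def by blast
      have actv: "(hnorm K (rep_act \<rho> b v))\<^sup>2 = (1 - \<tau>) * (sn b)\<^sup>2" for b
      proof -
        have "(hnorm K (rep_act \<rho> b v))\<^sup>2 = (1 - \<tau>) * h (star b * b)"
          using R.vector_state_star_mult[of v b] v \<tau>1 by (simp add: h_def rep_space_\<rho>)
        then show ?thesis by (simp add: \<open>h = f\<close> sn_sq ip_def Re_\<omega>)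
      qed
      obtain s where s: "s \<in> gns_cauchy \<omega>" "y = gns_class \<omega> s" using yK by (auto simp: hcarrier_gns)
      define d where "d = (\<lambda>n. hnorm K (hdiff K (gns_class \<omega> (\<lambda>k. s n)) y))"
      have d: "d \<longlonglongrightarrow> 0" using gns_dense[OF s(1)] by (simp add: d_def s(2))
      \<comment> \<open>The vector \<open>rep_act \<rho> b v\<close> is the component orthogonal to
        C of the class of b minus y, since \<open>rep_act \<rho> b y\<close> and y lie in C. Along
        terms of s, whose classes tend to y, the right side tends to 0, whereas by
        \<open>actv\<close> the square of the left tends to
        \<open>(1 - \<tau>) * (hnorm K y)^2\<close>, which is positive.\<close>
      have "hnorm K (rep_act \<rho> b v) \<le> hnorm K (hdiff K (gns_class \<omega> (\<lambda>k. b)) y)" for b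
      proof -
        define w where "w = rep_act \<rho> b v"
        have w: "w \<in> hcarrier K" using R'[OF v] by (simp add: w_def)
        have e: "hdiff K (gns_class \<omega> (\<lambda>k. b)) y \<in> hcarrier K"
          using yK by (intro closed) (simp_all add: hcarrier_gns)
        have "hinner K w (hdiff K (gns_class \<omega> (\<lambda>k. b)) y) = hinner K w w"
          unfolding \<xi>(4)[symmetric] act w_def[symmetric]
          using w yK R'[OF yK] perp'[OF inv[OF y(1)]] perp'[OF y(1)]
          by (simp add: inner_simps closed w_def)
        then have "(hnorm K w)\<^sup>2 \<le> hnorm K w * hnorm K (hdiff K (gns_class \<omega> (\<lambda>k. b)) y)"
          using cauchy_schwarz[OF w e] inner_self[OF w] by (simp add: norm_power)
        then show ?thesis using hnorm_nonneg[OF w] hnorm_nonneg[OF e]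
          by (cases "hnorm K w = 0") (auto simp: power2_eq_square w_def)
      qed
      then have "(1 - \<tau>) * (sn (s n))\<^sup>2 \<le> (d n)\<^sup>2" for n
        using v R' by (simp add: d_def power_mono hnorm_nonneg flip: actv)
      moreover have "(\<lambda>n. (1 - \<tau>) * (sn (s n))\<^sup>2) \<longlonglongrightarrow> (1 - \<tau>) * (hnorm K y)\<^sup>2"
        unfolding s(2) by (intro tendsto_intros hnorm_gns s)
      moreover have "(\<lambda>n. (d n)\<^sup>2) \<longlonglongrightarrow> 0\<^sup>2" by (intro tendsto_intros d)
      ultimately have "(1 - \<tau>) * (hnorm K y)\<^sup>2 \<le> 0\<^sup>2"
        by (intro LIMSEQ_le[of "\<lambda>n. (1 - \<tau>) * (sn (s n))\<^sup>2" _ "\<lambda>n. (d n)\<^sup>2"]) blast+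
      then show ?thesis using pos \<tau>1 by (simp add: mult_le_0_iff)
    qed
  qed
  then have "irreducible_rep \<rho>"
    unfolding irreducible_rep_def rep_space_\<rho> using nzr star_representation_gns by blast
  then show ?thesis using ak by blast
qed

end

theorem irreducible_rep_separating:
  fixes I :: "'a::cstar_algebra set"
  assumes I: "closed_ideal I" and a: "a \<notin> I"
  shows "\<exists>\<pi>\<in>irreps. I \<subseteq> rep_ker \<pi> \<and> a \<notin> rep_ker \<pi>"
proof -
  obtain f where f: "linear f" "f \<le> numerical_sup I" "f (star a * a) = numerical_sup I (star a * a)"
    and ext: "\<forall>g h t. linear g \<and> linear h \<and> g \<le> numerical_sup I \<and> h \<le> numerical_sup I \<and> 0 < t \<and> t < 1 \<and>
       f = (\<lambda>x. t * g x + (1 - t) * h x) \<longrightarrow> g = f \<and> h = f"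
    using extreme_functional_exists[OF sublinear_numerical_sup[OF I], of "star a * a"] by blast
  interpret ideal_functional I f by (intro ideal_functional.intro I f)
  have "infdist a I > 0"
    using I a closed_idealD(1,2)[OF I] in_closed_iff_infdist_zero[of I a] infdist_nonneg[of a I]
    by (metis empty_iff order_le_less)
  then have "f (star a * a) > 0" using infdist_le_numerical_sup[OF I, of a] f(3)
    by (metis order_less_le_trans zero_less_power)
  then have "irreducible_rep \<rho> \<and> a \<notin> rep_ker \<rho>" using ext by (intro irreducible_gns) auto
  then show ?thesis using ideal_subset_rep_ker by (auto simp: irreps_def)
qed

section \<open>The Jacobson topology and closed ideals\<close>

lemma (in star_representation) scale_zero_left: "x \<in> hcarrier H \<Longrightarrow> hscale H 0 x = hzero H"
  using hnorm_scale[of x 0] hnorm_eq_zero[of "hscale H 0 x"] by (simp add: scale_closed)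

section \<open>Kernels of unitary equivalence classes\<close>

lemma rep_ker_unitarily_equivalent:
  assumes "star_representation \<pi>" "star_representation \<rho>" "unitarily_equivalent \<pi> \<rho>"
  shows "rep_ker \<pi> = rep_ker \<rho>"
proof -
  interpret P: star_representation \<pi> by fact
  interpret R: star_representation \<rho> by fact
  obtain U where U: "bij_betw U (hcarrier (rep_space \<pi>)) (hcarrier (rep_space \<rho>))"
    and scale: "\<And>c x. x \<in> hcarrier (rep_space \<pi>) \<Longrightarrow> U (hscale (rep_space \<pi>) c x) = hscale (rep_space \<rho>) c (U x)"
    and act: "\<And>a x. x \<in> hcarrier (rep_space \<pi>) \<Longrightarrow> U (rep_act \<pi> a x) = rep_act \<rho> a (U x)"
    using assms(3) unfolding unitarily_equivalent_def by blast
  have UH: "U x \<in> hcarrier (rep_space \<rho>)" if "x \<in> hcarrier (rep_space \<pi>)" for x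
    using U that by (auto simp: bij_betw_def)
  have U0: "U (hzero (rep_space \<pi>)) = hzero (rep_space \<rho>)"
    using scale[OF P.zero_closed, of 0] P.scale_zero_left[OF P.zero_closed] R.scale_zero_left[OF UH[OF P.zero_closed]]
    by simp
  have iff: "U x = hzero (rep_space \<rho>) \<longleftrightarrow> x = hzero (rep_space \<pi>)" if "x \<in> hcarrier (rep_space \<pi>)" for x
    using U U0 that P.zero_closed unfolding bij_betw_def by (metis inj_on_eq_iff)
  have "a \<in> rep_ker \<rho> \<longleftrightarrow> a \<in> rep_ker \<pi>" for a
  proof -
    have "a \<in> rep_ker \<rho> \<longleftrightarrow> (\<forall>x\<in>hcarrier (rep_space \<pi>). rep_act \<rho> a (U x) = hzero (rep_space \<rho>))"
    proof -
      have "hcarrier (rep_space \<rho>) = U ` hcarrier (rep_space \<pi>)" using U by (simp add: bij_betw_def)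
      then show ?thesis by (simp add: rep_ker_def)
    qed
    also have "\<dots> \<longleftrightarrow> (\<forall>x\<in>hcarrier (rep_space \<pi>). rep_act \<pi> a x = hzero (rep_space \<pi>))"
    proof (rule ball_cong[OF refl])
      fix x assume x: "x \<in> hcarrier (rep_space \<pi>)"
      show "rep_act \<rho> a (U x) = hzero (rep_space \<rho>) \<longleftrightarrow> rep_act \<pi> a x = hzero (rep_space \<pi>)"
        using iff[OF P.act_closed[OF x, of a]] act[OF x, of a] by simp
    qed
    finally show ?thesis by (simp add: rep_ker_def)
  qed
  then show ?thesis by blast
qed

lemma irreps_star_representation: "\<pi> \<in> irreps \<Longrightarrow> star_representation \<pi>"
  by (simp add: irreps_def irreducible_rep_def)

lemma unitary_equivalence_refl: "\<pi> \<in> irreps \<Longrightarrow> (\<pi>, \<pi>) \<in> unitary_equivalence"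
  unfolding unitary_equivalence_def unitarily_equivalent_def by (auto intro!: exI[of _ id])

lemma class_ker_eq:
  assumes "c \<in> spectrum" "\<pi> \<in> c" shows "\<pi> \<in> irreps" "class_ker c = rep_ker \<pi>"
proof -
  obtain \<rho> where \<rho>: "\<rho> \<in> irreps" "c = unitary_equivalence `` {\<rho>}"
    using assms(1) by (auto simp: spectrum_def quotient_def)
  have eq: "rep_ker \<sigma> = rep_ker \<rho>" if "\<sigma> \<in> c" for \<sigma>
    using that \<rho> rep_ker_unitarily_equivalent[of \<rho> \<sigma>]
    by (auto simp: unitary_equivalence_def irreps_star_representation)
  show "\<pi> \<in> irreps" using assms \<rho> by (auto simp: unitary_equivalence_def)
  show "class_ker c = rep_ker \<pi>" using eq assms(2) by (auto simp: class_ker_def)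
qed

lemma spectrum_nonempty: "c \<in> spectrum \<Longrightarrow> c \<noteq> {}"
  using unitary_equivalence_refl by (auto simp: spectrum_def quotient_def)

lemma class_ker_image: "class_ker ` spectrum = primitive_ideals"
proof
  show "class_ker ` spectrum \<subseteq> primitive_ideals"
    unfolding primitive_ideals_def using class_ker_eq spectrum_nonempty by fast
  have "rep_ker \<pi> \<in> class_ker ` spectrum" if \<pi>: "\<pi> \<in> irreps" for \<pi>
  proof -
    have "unitary_equivalence `` {\<pi>} \<in> spectrum" using \<pi> by (auto simp: spectrum_def quotient_def)
    moreover have "\<pi> \<in> unitary_equivalence `` {\<pi>}" using unitary_equivalence_refl[OF \<pi>] by blast
    ultimately show ?thesis using class_ker_eq(2) by blast
  qed
  then show "primitive_ideals \<subseteq> class_ker ` spectrum" by (auto simp: primitive_ideals_def)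
qed

lemma spectrum_of_ideal_iff: "c \<in> spectrum_of_ideal I \<longleftrightarrow> c \<in> spectrum \<and> \<not> I \<subseteq> class_ker c"
proof -
  have nz: "rep_nonzero_on \<pi> I \<longleftrightarrow> \<not> I \<subseteq> rep_ker \<pi>" for \<pi> :: "('a, 'a gns_vector) rep"
    by (auto simp: rep_nonzero_on_def rep_ker_def)
  show ?thesis
    using class_ker_eq(2)[of c] spectrum_nonempty[of c] unfolding spectrum_of_ideal_def nz by fastforce
qed

lemma primitive_ideal_closed_ideal: "P \<in> primitive_ideals \<Longrightarrow> closed_ideal P"
  using star_representation.closed_ideal_rep_ker irreps_star_representation
  by (auto simp: primitive_ideals_def)

lemma primitive_ideal_proper: "P \<in> primitive_ideals \<Longrightarrow> P \<noteq> UNIV"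
  by (auto simp: primitive_ideals_def irreps_def irreducible_rep_def rep_nonzero_on_def rep_ker_def)

text \<open>The empty family is included and yields the whole algebra, the ideal that belongs to the
  open set of all primitive ideals.\<close>

lemma closed_ideal_Inter: "(\<And>J. J \<in> \<J> \<Longrightarrow> closed_ideal J) \<Longrightarrow> closed_ideal (\<Inter>\<J>)"
  unfolding closed_ideal_def by (intro conjI closed_Inter) blast+

lemma closed_ideal_eq_Inter:
  assumes I: "closed_ideal I" shows "I = \<Inter>{P \<in> primitive_ideals. I \<subseteq> P}"
  using irreducible_rep_separating[OF I] by (auto simp: primitive_ideals_def)

text \<open>The vectors annihilated by I form a closed invariant subspace. If it is everything, I
  lies in the kernel; if it is zero, then J lies in the kernel, because J maps each vector into it:
  products of elements of I and J belong to P.\<close>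

lemma primitive_ideal_prime:
  fixes P :: "'a::cstar_algebra set"
  assumes P: "P \<in> primitive_ideals" and I: "closed_ideal I" and J: "closed_ideal J" and IJ: "I \<inter> J \<subseteq> P"
  shows "I \<subseteq> P \<or> J \<subseteq> P"
proof -
  obtain \<pi> :: "('a, 'a gns_vector) rep" where \<pi>: "irreducible_rep \<pi>" "P = rep_ker \<pi>"
    using P unfolding primitive_ideals_def irreps_def by blast
  interpret star_representation \<pi> using \<pi>(1) by (simp add: irreducible_rep_def)
  define C where "C = {x \<in> hcarrier H. \<forall>a\<in>I. rep_act \<pi> a x = hzero H}"
  have "closed_hsubspace H C"
    unfolding closed_hsubspace_def
  proof (intro conjI ballI allI impI)
    fix s x assume s: "\<forall>n::nat. s n \<in> C" and x: "x \<in> hcarrier H"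
      and lim: "(\<lambda>n. hnorm H (hdiff H (s n) x)) \<longlonglongrightarrow> 0"
    have "rep_act \<pi> a x = hzero H" if a: "a \<in> I" for a
    proof -
      have "hnorm H (rep_act \<pi> a x) \<le> norm a * hnorm H (hdiff H (s n) x)" for n
      proof -
        have sn: "s n \<in> hcarrier H" "rep_act \<pi> a (s n) = hzero H" using s a by (auto simp: C_def)
        have "rep_act \<pi> a (hdiff H x (s n)) = hdiff H (rep_act \<pi> a x) (hzero H)"
          using sn x by (simp add: act_diff)
        also have "\<dots> = rep_act \<pi> a x"
          using x by (intro inner_eqI) (simp_all add: closed act_closed inner_simps)
        finally show ?thesis
          using rep_contractive[of "hdiff H x (s n)" a] sn x hnorm_diff_commute[of x "s n"]
          by (simp add: closed)
      qed
      then have "hnorm H (rep_act \<pi> a x) \<le> 0"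
        by (intro LIMSEQ_le_const[OF tendsto_mult_right_zero[OF lim]]) blast
      then show ?thesis using x hnorm_nonneg hnorm_eq_zero by (meson act_closed antisym)
    qed
    then show "x \<in> C" using x by (simp add: C_def)
  qed (auto simp: C_def closed act_zero act_add act_scale add_zero scale_zero)
  moreover have "rep_act \<pi> b x \<in> C" if "x \<in> C" for b x
    using that I by (auto simp: C_def act_closed closed_idealD simp flip: rep_mult)
  ultimately consider "C = {hzero H}" | "C = hcarrier H"
    using \<pi>(1) unfolding irreducible_rep_def by blast
  then show ?thesis
  proof cases
    case 1
    have "rep_act \<pi> b x = hzero H" if b: "b \<in> J" and x: "x \<in> hcarrier H" for b x
    proof -
      have "rep_act \<pi> a (rep_act \<pi> b x) = hzero H" if a: "a \<in> I" for a
      proof -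
        have "a * b \<in> P" using a b I J IJ by (auto simp: closed_idealD)
        then show ?thesis using x by (simp add: \<pi>(2) rep_ker_def flip: rep_mult)
      qed
      then have "rep_act \<pi> b x \<in> C" using x by (simp add: C_def act_closed)
      then show ?thesis using 1 by simp
    qed
    then show ?thesis by (auto simp: \<pi>(2) rep_ker_def)
  qed (auto simp: \<pi>(2) rep_ker_def C_def)
qed

text \<open>The defining predicate has to satisfy the axioms of a topology before it can be read
  back from \<open>topology\<close>. Primeness enters for intersections of two open sets.\<close>

lemma openin_hull_kernel_topology:
  "openin hull_kernel_topology U \<longleftrightarrow> U \<subseteq> primitive_ideals \<and>
    {P \<in> primitive_ideals. \<Inter>(primitive_ideals - U) \<subseteq> P} = primitive_ideals - (U :: 'a::cstar_algebra set set)"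
    (is "_ \<longleftrightarrow> ?op U")
proof -
  let ?X = "primitive_ideals :: 'a set set"
  \<comment> \<open>One inclusion is automatic: members of the complement of U contain its
    intersection. What remains is a condition on each point of U.\<close>
  have hull: "?op U \<longleftrightarrow> U \<subseteq> ?X \<and> (\<forall>P\<in>U. \<not> \<Inter>(?X - U) \<subseteq> P)" for U by blast
  have "?op (U \<inter> V)" if U: "?op U" and V: "?op V" for U V
    unfolding hull
  proof (intro conjI ballI notI)
    show "U \<inter> V \<subseteq> ?X" using U by blast
    fix P assume P: "P \<in> U \<inter> V" and le: "\<Inter>(?X - U \<inter> V) \<subseteq> P"
    have "?X - U \<inter> V = (?X - U) \<union> (?X - V)" by blast
    then have "\<Inter>(?X - U) \<inter> \<Inter>(?X - V) \<subseteq> P" using le by (simp add: Inter_Un_distrib)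
    then have "\<Inter>(?X - U) \<subseteq> P \<or> \<Inter>(?X - V) \<subseteq> P"
      using P U by (intro primitive_ideal_prime closed_ideal_Inter)
        (auto intro: primitive_ideal_closed_ideal)
    then show False using P U V unfolding hull by blast
  qed
  moreover have "?op (\<Union>\<K>)" if "\<forall>U\<in>\<K>. ?op U" for \<K>
    unfolding hull
  proof (intro conjI ballI notI)
    show "\<Union>\<K> \<subseteq> ?X" using that by blast
    fix P assume "P \<in> \<Union>\<K>" and le: "\<Inter>(?X - \<Union>\<K>) \<subseteq> P"
    then obtain U where U: "U \<in> \<K>" "P \<in> U" by blast
    have "\<Inter>(?X - U) \<subseteq> \<Inter>(?X - \<Union>\<K>)" using U by (intro Inter_anti_mono) blast
    then have "\<Inter>(?X - U) \<subseteq> P" using le by (rule order_trans)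
    moreover have "?op U" using that U(1) by (rule bspec)
    then have "\<forall>P\<in>U. \<not> \<Inter>(?X - U) \<subseteq> P" unfolding hull by (rule conjunct2)
    ultimately show False using U(2) by blast
  qed
  ultimately have "istopology ?op" unfolding istopology_def by blast
  then show ?thesis unfolding hull_kernel_topology_def by (simp add: topology_inverse')
qed

text \<open>An open set comes from the intersection of the primitive ideals outside it. Conversely
  the primitive ideals above I form a closed set, since their intersection still contains I.\<close>

lemma openin_jacobson_topology:
  "openin jacobson_topology U \<longleftrightarrow> (\<exists>I :: 'a::cstar_algebra set. closed_ideal I \<and> U = spectrum_of_ideal I)"
proof
  assume "openin jacobson_topology U"
  then obtain V :: "'a set set" where V: "openin hull_kernel_topology V" "U = class_ker -` V \<inter> spectrum"
    by (auto simp: jacobson_topology_def openin_pullback_topology)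
  define I where "I = \<Inter>(primitive_ideals - V)"
  have "closed_ideal I"
    unfolding I_def by (intro closed_ideal_Inter) (auto intro: primitive_ideal_closed_ideal)
  moreover have "c \<in> U \<longleftrightarrow> c \<in> spectrum_of_ideal I" for c
  proof (cases "c \<in> spectrum")
    case True
    then have "class_ker c \<in> primitive_ideals" using class_ker_image by blast
    then have "class_ker c \<in> V \<longleftrightarrow> \<not> I \<subseteq> class_ker c"
      using V(1) unfolding openin_hull_kernel_topology I_def by blast
    then show ?thesis using True by (simp add: V(2) spectrum_of_ideal_iff)
  qed (simp add: V(2) spectrum_of_ideal_iff)
  ultimately show "\<exists>I. closed_ideal I \<and> U = spectrum_of_ideal I" by blast
next
  assume "\<exists>I :: 'a set. closed_ideal I \<and> U = spectrum_of_ideal I"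
  then obtain I :: "'a set" where I: "closed_ideal I" "U = spectrum_of_ideal I" by blast
  define V where "V = {P \<in> primitive_ideals. \<not> I \<subseteq> P}"
  have "openin hull_kernel_topology V"
    unfolding openin_hull_kernel_topology V_def by blast
  moreover have "U = class_ker -` V \<inter> spectrum"
    using class_ker_image by (auto simp: I(2) V_def spectrum_of_ideal_iff)
  ultimately show "openin jacobson_topology U"
    by (auto simp: jacobson_topology_def openin_pullback_topology)
qed

lemma spectrum_of_ideal_UNIV: "spectrum_of_ideal (UNIV :: 'a::cstar_algebra set) = spectrum"
proof -
  have "class_ker c \<noteq> UNIV" if "c \<in> spectrum" for c :: "'a rep_class"
    using that class_ker_image primitive_ideal_proper by blast
  then show ?thesis by (auto simp: spectrum_of_ideal_iff top.extremum_unique)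
qed

lemma closed_ideal_UNIV: "closed_ideal UNIV"
  by (simp add: closed_ideal_def)

lemma spectrum_of_ideal_subset: "spectrum_of_ideal I \<subseteq> spectrum"
  by (auto simp: spectrum_of_ideal_iff)

lemma topspace_jacobson_topology: "topspace jacobson_topology = spectrum"
proof
  show "topspace jacobson_topology \<subseteq> spectrum"
    using openin_topspace[of jacobson_topology] spectrum_of_ideal_subset
    unfolding openin_jacobson_topology by blast
  show "spectrum \<subseteq> topspace jacobson_topology"
    using openin_jacobson_topology[of spectrum] spectrum_of_ideal_UNIV closed_ideal_UNIV
    by (metis openin_subset)
qed

lemma closedin_jacobson_topology:
  "closedin jacobson_topology V \<longleftrightarrow> (\<exists>I :: 'a::cstar_algebra set. closed_ideal I \<and> V = spectrum - spectrum_of_ideal I)"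
  unfolding closedin_def topspace_jacobson_topology openin_jacobson_topology
  using spectrum_of_ideal_subset by blast

section \<open>Recovering ideals and bases\<close>

lemma spectrum_of_ideal_inj:
  assumes "closed_ideal I" "closed_ideal J" "spectrum_of_ideal I = spectrum_of_ideal J"
  shows "I = J"
proof -
  have "I \<subseteq> P \<longleftrightarrow> J \<subseteq> P" if "P \<in> primitive_ideals" for P
    using that assms(3) unfolding class_ker_image[symmetric] set_eq_iff spectrum_of_ideal_iff by blast
  then have "{P \<in> primitive_ideals. I \<subseteq> P} = {P \<in> primitive_ideals. J \<subseteq> P}" by blast
  then show ?thesis using closed_ideal_eq_Inter[OF assms(1)] closed_ideal_eq_Inter[OF assms(2)] by simp
qed

lemma bundle_restriction_inj:
  assumes "U \<subseteq> spectrum" "V \<subseteq> spectrum"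
    and eq: "bundle_restriction uniform_kaehler_bundle U = bundle_restriction uniform_kaehler_bundle V"
  shows "U = V"
proof -
  have "base_space (bundle_restriction uniform_kaehler_bundle W) = subtopology jacobson_topology W" for W :: "'a rep_class set"
    by (simp add: bundle_restriction_def uniform_kaehler_bundle_def Let_def)
  then have "topspace (subtopology jacobson_topology U) = topspace (subtopology jacobson_topology V)"
    using eq by metis
  then show ?thesis using assms by (simp add: topspace_jacobson_topology Int_absorb1)
qed

section \<open>The kernel of a direct sum\<close>

lemma rep_ker_rep_sum:
  assumes "\<And>i. i \<in> S \<Longrightarrow> star_representation (\<pi> i)"
  shows "rep_ker (rep_sum S \<pi>) = (\<Inter>i\<in>S. rep_ker (\<pi> i))"
proof (intro equalityI subsetI INT_I)
  fix a i assume a: "a \<in> rep_ker (rep_sum S \<pi>)" and i: "i \<in> S"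
  have "rep_act (\<pi> i) a x = hzero (rep_space (\<pi> i))" if x: "x \<in> hcarrier (rep_space (\<pi> i))" for x
  proof -
    \<comment> \<open>The vector x placed in the summand i; at most one nonzero term makes the
      family square summable.\<close>
    define f where "f = (\<lambda>j\<in>S. if j = i then x else hzero (rep_space (\<pi> j)))"
    have z: "hzero (rep_space (\<pi> j)) \<in> hcarrier (rep_space (\<pi> j))"
      "hnorm (rep_space (\<pi> j)) (hzero (rep_space (\<pi> j))) = 0" if "j \<in> S" for j
    proof -
      interpret star_representation "\<pi> j" using assms that by blast
      show "hzero (rep_space (\<pi> j)) \<in> hcarrier (rep_space (\<pi> j))" by (rule zero_closed)
      then show "hnorm (rep_space (\<pi> j)) (hzero (rep_space (\<pi> j))) = 0" by (simp add: hnorm_eq_zero)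
    qed
    have "(\<lambda>j. (hnorm (rep_space (\<pi> j)) (f j))\<^sup>2) summable_on S"
    proof (rule finite_nonzero_values_imp_summable_on, rule finite_subset)
      show "{j \<in> S. (hnorm (rep_space (\<pi> j)) (f j))\<^sup>2 \<noteq> 0} \<subseteq> {i}" using z by (auto simp: f_def)
    qed simp
    moreover have "f \<in> (\<Pi>\<^sub>E j\<in>S. hcarrier (rep_space (\<pi> j)))" using z x by (auto simp: f_def)
    ultimately have "(\<lambda>j\<in>S. rep_act (\<pi> j) a (f j)) = (\<lambda>j\<in>S. hzero (rep_space (\<pi> j)))"
      using a by (auto simp: rep_ker_def rep_sum_def hilbert_sum_def)
    from fun_cong[OF this, of i] show ?thesis using i by (simp add: f_def)
  qed
  then show "a \<in> rep_ker (\<pi> i)" by (simp add: rep_ker_def)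
next
  fix a assume "a \<in> (\<Inter>i\<in>S. rep_ker (\<pi> i))"
  then show "a \<in> rep_ker (rep_sum S \<pi>)"
    by (auto simp: rep_ker_def rep_sum_def hilbert_sum_def intro!: restrict_ext)
qed

text \<open>The quotient structure remembers its ideal as the zero coset, so a map on quotients can
  be defined through the ideal.\<close>

lemma cs_zero_quotient_cstar: "cs_zero (quotient_cstar I) = I"
  by (simp add: quotient_cstar_def ideal_coset_def)

theorem proposition2p6:
  shows
   "bij_betw (\<lambda>I :: 'a::cstar_algebra set.
        bundle_restriction uniform_kaehler_bundle (spectrum_of_ideal I))
      {I. closed_ideal I} Bun_o
    \<and> (\<forall>I :: 'a set. closed_ideal I \<longrightarrow>
        (\<forall>\<sigma>. (\<forall>c \<in> spectrum - spectrum_of_ideal I. \<sigma> c \<in> c) \<longrightarrow>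
           I = rep_ker (rep_sum (spectrum - spectrum_of_ideal I) \<sigma>)))
    \<and> (\<exists>F :: 'a set cstar_structure \<Rightarrow> 'a cstar_bundle.
        (\<forall>I :: 'a set. closed_ideal I \<longrightarrow>
           F (quotient_cstar I) =
             bundle_restriction uniform_kaehler_bundle (spectrum - spectrum_of_ideal I)) \<and>
        bij_betw F quotient_cstar_algebras Bun_c)"
proof (intro conjI allI impI)
  show "bij_betw (\<lambda>I :: 'a set. bundle_restriction uniform_kaehler_bundle (spectrum_of_ideal I))
      {I. closed_ideal I} Bun_o"
    unfolding bij_betw_def
  proof
    show "inj_on (\<lambda>I :: 'a set. bundle_restriction uniform_kaehler_bundle (spectrum_of_ideal I)) {I. closed_ideal I}"
      using spectrum_of_ideal_inj bundle_restriction_inj spectrum_of_ideal_subset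
      by (intro inj_onI) blast
    show "(\<lambda>I :: 'a set. bundle_restriction uniform_kaehler_bundle (spectrum_of_ideal I)) ` {I. closed_ideal I} = Bun_o"
      unfolding Bun_o_def openin_jacobson_topology by blast
  qed
next
  fix I :: "'a set" and \<sigma> :: "'a rep_class \<Rightarrow> ('a, 'a gns_vector) rep"
  assume I: "closed_ideal I" and \<sigma>: "\<forall>c\<in>spectrum - spectrum_of_ideal I. \<sigma> c \<in> c"
  let ?S = "spectrum - spectrum_of_ideal I"
  have \<sigma>c: "\<sigma> c \<in> irreps" "class_ker c = rep_ker (\<sigma> c)" if "c \<in> ?S" for c
    using class_ker_eq[of c "\<sigma> c"] \<sigma> that by blast+
  have "I = \<Inter>{P \<in> primitive_ideals. I \<subseteq> P}" by (rule closed_ideal_eq_Inter[OF I])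
  \<comment> \<open>Classes outside the open set of I are those whose kernel contains I; any system
    \<sigma> of representatives computes these kernels.\<close>
  also have "{P \<in> primitive_ideals. I \<subseteq> P} = class_ker ` ?S"
    unfolding class_ker_image[symmetric] by (auto simp: spectrum_of_ideal_iff)
  also have "\<Inter>(class_ker ` ?S) = (\<Inter>c\<in>?S. rep_ker (\<sigma> c))" using \<sigma>c(2) by simp
  also have "\<dots> = rep_ker (rep_sum ?S \<sigma>)"
    using \<sigma>c(1) by (intro rep_ker_rep_sum[symmetric] irreps_star_representation)
  finally show "I = rep_ker (rep_sum ?S \<sigma>)" .
next
  define F where "F q = bundle_restriction uniform_kaehler_bundle (spectrum - spectrum_of_ideal (cs_zero q))"
    for q :: "'a set cstar_structure"
  have Fq: "F (quotient_cstar I) = bundle_restriction uniform_kaehler_bundle (spectrum - spectrum_of_ideal I)" for I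
    by (simp add: F_def cs_zero_quotient_cstar)
  have "bij_betw F quotient_cstar_algebras Bun_c"
    unfolding bij_betw_def
  proof
    show "inj_on F quotient_cstar_algebras"
    proof (rule inj_onI)
      fix p q assume "p \<in> quotient_cstar_algebras" "q \<in> quotient_cstar_algebras" and eq: "F p = F q"
      then obtain I J where I: "closed_ideal I" "p = quotient_cstar I" and J: "closed_ideal J" "q = quotient_cstar J"
        by (auto simp: quotient_cstar_algebras_def)
      have "spectrum - spectrum_of_ideal I = spectrum - spectrum_of_ideal J"
        using eq unfolding I J Fq by (intro bundle_restriction_inj) auto
      then have "spectrum_of_ideal I = spectrum_of_ideal J" using spectrum_of_ideal_subset by blast
      then show "p = q" using spectrum_of_ideal_inj[OF I(1) J(1)] by (simp add: I J)
    qed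
    have "F ` quotient_cstar_algebras = {F (quotient_cstar I) | I. closed_ideal I}"
      unfolding quotient_cstar_algebras_def by blast
    also have "\<dots> = Bun_c"
      unfolding Fq Bun_c_def closedin_jacobson_topology by blast
    finally show "F ` quotient_cstar_algebras = Bun_c" .
  qed
  then show "\<exists>F :: 'a set cstar_structure \<Rightarrow> 'a cstar_bundle.
        (\<forall>I :: 'a set. closed_ideal I \<longrightarrow>
           F (quotient_cstar I) =
             bundle_restriction uniform_kaehler_bundle (spectrum - spectrum_of_ideal I)) \<and>
        bij_betw F quotient_cstar_algebras Bun_c"
    using Fq by blast
qed

end
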